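(* Let $T$ be an integral domain, $M$ a nonzero maximal ideal of $T$, $k=T/M$, $\varphi:T\to k$ the canonical projection, $D$ a proper subring of $k$ whose quotient field is $k$, and $R=\varphi^{-1}(D)$. Suppose that the map $\tilde\varphi:\mathcal U(T)\to k^\bullet/\mathcal U(D)$, $u\mapsto\varphi(u)\,\mathcal U(D)$, is surjective and that $\ast$ is a star operation of finite type on $R$. Then the sequence $$0\longrightarrow \mathrm{Cl}^{\ast_\varphi}(D)\stackrel{\overline{\alpha}}{\longrightarrow}\mathrm{Cl}^{\ast}(R)\stackrel{\overline{\beta}}{\longrightarrow}\mathrm{Cl}^{(\ast)_T}(T)\longrightarrow 0,$$ where $\overline\alpha([J])=[\varphi^{-1}(J)]$ and $\overline\beta([H])=[HT]$, is split exact.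
   Context: $\mathcal U(\cdot)$ denotes the group of units of a ring, and $k^\bullet=k\setminus\{0\}$. For an integral domain $A$ with quotient field $K$, $\boldsymbol F(A)$ is the set of nonzero fractional ideals of $A$ and $\boldsymbol f(A)$ the set of nonzero finitely generated ones; $I^{-1}=(A:_K I)$. A star operation on $A$ is a map $\ast:\boldsymbol F(A)\to\boldsymbol F(A)$, $E\mapsto E^\ast$, such that for all $0\ne x\in K$ and $E,F\in\boldsymbol F(A)$: $(xA)^\ast=xA$ and $(xE)^\ast=xE^\ast$; $E\subseteq F$ implies $E^\ast\subseteq F^\ast$; $E\subseteq E^\ast=(E^\ast)^\ast$. Put $E^{\ast_f}=\bigcup\{F^\ast\mid F\in\boldsymbol f(A),\,F\subseteq E\}$; $\ast$ is of finite type if $\ast=\ast_f$. The $v$-operation is $E^{v_A}=(E^{-1})^{-1}$. A $\ast$-ideal is $E\in\boldsymbol F(A)$ with $E=E^\ast$; $I\in\boldsymbol F(A)$ is $\ast$-invertible if $(II^{-1})^\ast=A$. $\mathrm{Inv}^\ast(A)$ is the abelian group of $\ast$-invertible $\ast$-ideals under $(I,J)\mapsto(IJ)^\ast$, $\mathrm{Prin}(A)$ its subgroup of nonzero principal fractional ideals, and $\mathrm{Cl}^\ast(A)=\mathrm{Inv}^\ast(A)/\mathrm{Prin}(A)$. Projection: for a star operation $\ast$ on $R$, $\ast_\varphi$ is the star operation on $D$ given, for $F\in\boldsymbol F(D)$, by $F^{\ast_\varphi}=\bigcap\{y\,\varphi((\varphi^{-1}(y^{-1}F))^\ast)\mid y\in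 L,\ F\subseteq yD\}$, $L$ being the quotient field of $D$; in this setting it equals $F^{\ast_\varphi}=(\varphi^{-1}(F))^\ast/M$. Extension: $R$ and $T$ have the same quotient field and $(R:T)=M\neq0$, so $\boldsymbol F(T)\subseteq\boldsymbol F(R)$; $(\ast)_T$ is the star operation on $T$ given by $E^{(\ast)_T}=E^\ast\cap E^{v_T}$ for $E\in\boldsymbol F(T)$. Under the stated hypotheses $\overline\alpha$ and $\overline\beta$ are well-defined group homomorphisms. *)

theory Defs
  imports "HOL-Algebra.Algebra"
begin

text \<open>
  An integral domain with quotient field \<open>K\<close> is represented by its carrier \<open>A\<close>, a subset of the
  carrier of the field \<open>K\<close>; as a ring it is \<open>K\<lparr>carrier := A\<rparr>\<close>. The three domains \<open>T\<close>, \<open>R\<close> (inside a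
  common field \<open>K\<close>) and \<open>D\<close> (inside \<open>T/M\<close>) are treated uniformly in this way.
\<close>

definition quotient_field_of :: "('a, 'm) ring_scheme \<Rightarrow> 'a set \<Rightarrow> bool" where
  "quotient_field_of K A \<longleftrightarrow> field K \<and> subdomain A K \<and>
     (\<forall>x\<in>carrier K. \<exists>a\<in>A. \<exists>b\<in>A - {\<zero>\<^bsub>K\<^esub>}. x = a \<otimes>\<^bsub>K\<^esub> inv\<^bsub>K\<^esub> b)"


subsection \<open>Fractional ideals and star operations\<close>

text \<open>Nonzero fractional ideals. For \<open>x \<in> K\<close>, the set \<open>xE\<close> is the left coset \<open>x <#\<^bsub>K\<^esub> E\<close>.\<close>

definition frac_ideals :: "('a, 'm) ring_scheme \<Rightarrow> 'a set \<Rightarrow> 'a set set" where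
  "frac_ideals K A = {E. additive_subgroup E K \<and> (\<forall>a\<in>A. \<forall>x\<in>E. a \<otimes>\<^bsub>K\<^esub> x \<in> E) \<and>
     (\<exists>d\<in>A - {\<zero>\<^bsub>K\<^esub>}. d <#\<^bsub>K\<^esub> E \<subseteq> A) \<and> E \<noteq> {\<zero>\<^bsub>K\<^esub>}}"

definition fg_frac_ideals :: "('a, 'm) ring_scheme \<Rightarrow> 'a set \<Rightarrow> 'a set set" where
  "fg_frac_ideals K A =
     {E \<in> frac_ideals K A. \<exists>xs. set xs \<subseteq> carrier K \<and> E = ring.Span K A xs}"

definition colon :: "('a, 'm) ring_scheme \<Rightarrow> 'a set \<Rightarrow> 'a set \<Rightarrow> 'a set" where
  "colon K A E = {x \<in> carrier K. \<forall>e\<in>E. x \<otimes>\<^bsub>K\<^esub> e \<in> A}"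

definition v_operation :: "('a, 'm) ring_scheme \<Rightarrow> 'a set \<Rightarrow> 'a set \<Rightarrow> 'a set" where
  "v_operation K A E = colon K A (colon K A E)"

text \<open>
  A star operation is a total function on sets of which only the values on \<^const>\<open>frac_ideals\<close>
  are constrained, and only these values are ever used.
\<close>

definition star_operation ::
    "('a, 'm) ring_scheme \<Rightarrow> 'a set \<Rightarrow> ('a set \<Rightarrow> 'a set) \<Rightarrow> bool" where
  "star_operation K A s \<longleftrightarrow>
     s \<in> frac_ideals K A \<rightarrow> frac_ideals K A \<and>
     (\<forall>x\<in>carrier K - {\<zero>\<^bsub>K\<^esub>}. s (x <#\<^bsub>K\<^esub> A) = x <#\<^bsub>K\<^esub> A) \<and>
     (\<forall>x\<in>carrier K - {\<zero>\<^bsub>K\<^esub>}. \<forall>E\<in>frac_ideals K A. s (x <#\<^bsub>K\<^esub> E) = x <#\<^bsub>K\<^esub> s E) \<and>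
     (\<forall>E\<in>frac_ideals K A. \<forall>F\<in>frac_ideals K A. E \<subseteq> F \<longrightarrow> s E \<subseteq> s F) \<and>
     (\<forall>E\<in>frac_ideals K A. E \<subseteq> s E \<and> s (s E) = s E)"

definition star_f ::
    "('a, 'm) ring_scheme \<Rightarrow> 'a set \<Rightarrow> ('a set \<Rightarrow> 'a set) \<Rightarrow> 'a set \<Rightarrow> 'a set" where
  "star_f K A s E = \<Union>{s F | F. F \<in> fg_frac_ideals K A \<and> F \<subseteq> E}"

definition finite_type ::
    "('a, 'm) ring_scheme \<Rightarrow> 'a set \<Rightarrow> ('a set \<Rightarrow> 'a set) \<Rightarrow> bool" where
  "finite_type K A s \<longleftrightarrow> (\<forall>E\<in>frac_ideals K A. s E = star_f K A s E)"


subsection \<open>Class groups\<close>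

text \<open>
  \<^const>\<open>ideal_prod\<close> \<open>K I J\<close> is the set of finite sums of products \<open>i \<otimes> j\<close>, hence the usual product of
  the fractional ideals \<open>I\<close> and \<open>J\<close>; it also expresses the extension \<open>HT\<close>.
\<close>

definition Inv_group ::
    "('a, 'm) ring_scheme \<Rightarrow> 'a set \<Rightarrow> ('a set \<Rightarrow> 'a set) \<Rightarrow> 'a set monoid" where
  "Inv_group K A s =
     \<lparr>carrier = {E \<in> frac_ideals K A. s E = E \<and> s (ideal_prod K E (colon K A E)) = A},
      monoid.mult = (\<lambda>I J. s (ideal_prod K I J)),
      monoid.one = A\<rparr>"

definition Prin :: "('a, 'm) ring_scheme \<Rightarrow> 'a set \<Rightarrow> 'a set set" where
  "Prin K A = {x <#\<^bsub>K\<^esub> A | x. x \<in> carrier K - {\<zero>\<^bsub>K\<^esub>}}"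

definition Cl_group ::
    "('a, 'm) ring_scheme \<Rightarrow> 'a set \<Rightarrow> ('a set \<Rightarrow> 'a set) \<Rightarrow> 'a set set monoid" where
  "Cl_group K A s = Inv_group K A s Mod Prin K A"

definition ideal_class ::
    "('a, 'm) ring_scheme \<Rightarrow> 'a set \<Rightarrow> ('a set \<Rightarrow> 'a set) \<Rightarrow> 'a set \<Rightarrow> 'a set set" where
  "ideal_class K A s E = Prin K A #>\<^bsub>Inv_group K A s\<^esub> E"


subsection \<open>The pullback construction\<close>

definition residue_field :: "('a, 'm) ring_scheme \<Rightarrow> 'a set \<Rightarrow> 'a set \<Rightarrow> 'a set ring" where
  "residue_field K T M = K\<lparr>carrier := T\<rparr> Quot M"

definition residue_map :: "('a, 'm) ring_scheme \<Rightarrow> 'a set \<Rightarrow> 'a set \<Rightarrow> 'a \<Rightarrow> 'a set" where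
  "residue_map K T M x = M +>\<^bsub>K\<lparr>carrier := T\<rparr>\<^esub> x"

definition residue_preimage ::
    "('a, 'm) ring_scheme \<Rightarrow> 'a set \<Rightarrow> 'a set \<Rightarrow> 'a set set \<Rightarrow> 'a set" where
  "residue_preimage K T M S = {x \<in> T. residue_map K T M x \<in> S}"

text \<open>
  The induced star operations on \<open>D\<close> and on \<open>T\<close>. In the first one the condition \<open>F \<subseteq> yD\<close> forces
  \<open>y \<noteq> 0\<close> as \<open>F \<noteq> 0\<close>, so that \<open>y\<^sup>-\<^sup>1 F\<close> makes sense.
\<close>

definition star_proj ::
    "('a, 'm) ring_scheme \<Rightarrow> 'a set \<Rightarrow> 'a set \<Rightarrow> 'a set set \<Rightarrow> ('a set \<Rightarrow> 'a set)
      \<Rightarrow> 'a set set \<Rightarrow> 'a set set" where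
  "star_proj K T M D s F =
     (let k = residue_field K T M in
      \<Inter>{y <#\<^bsub>k\<^esub> residue_map K T M ` s (residue_preimage K T M (inv\<^bsub>k\<^esub> y <#\<^bsub>k\<^esub> F)) | y.
          y \<in> carrier k \<and> F \<subseteq> y <#\<^bsub>k\<^esub> D})"

definition star_ext ::
    "('a, 'm) ring_scheme \<Rightarrow> 'a set \<Rightarrow> ('a set \<Rightarrow> 'a set) \<Rightarrow> 'a set \<Rightarrow> 'a set" where
  "star_ext K T s E = s E \<inter> v_operation K T E"

text \<open>
  The maps \<open>[J] \<mapsto> [\<phi>\<^sup>-\<^sup>1(J)]\<close> and \<open>[H] \<mapsto> [HT]\<close> on classes. A class is a coset, i.e. the set of its
  representatives; \<^const>\<open>the_elem\<close> picks the common value on all of them.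
\<close>

definition alpha_bar ::
    "('a, 'm) ring_scheme \<Rightarrow> 'a set \<Rightarrow> 'a set \<Rightarrow> 'a set set \<Rightarrow> ('a set \<Rightarrow> 'a set)
      \<Rightarrow> 'a set set set \<Rightarrow> 'a set set" where
  "alpha_bar K T M D s S =
     the_elem ((\<lambda>J. ideal_class K (residue_preimage K T M D) s (residue_preimage K T M J)) ` S)"

definition beta_bar ::
    "('a, 'm) ring_scheme \<Rightarrow> 'a set \<Rightarrow> ('a set \<Rightarrow> 'a set) \<Rightarrow> 'a set set \<Rightarrow> 'a set set" where
  "beta_bar K T s S =
     the_elem ((\<lambda>H. ideal_class K T (star_ext K T s) (ideal_prod K H T)) ` S)"


subsection \<open>Split exact sequences\<close>

text \<open>
  Split exactness of \<open>0 \<rightarrow> A \<rightarrow> B \<rightarrow> C \<rightarrow> 0\<close> for abelian groups. The library's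
  \<^const>\<open>short_exact_sequence\<close> requires the three groups to have elements of the same type, which is
  not the case for class groups of a ring and of its residue ring.
\<close>

definition split_exact_sequence ::
    "('a, 'm) monoid_scheme \<Rightarrow> ('b, 'n) monoid_scheme \<Rightarrow> ('c, 'o) monoid_scheme
      \<Rightarrow> ('a \<Rightarrow> 'b) \<Rightarrow> ('b \<Rightarrow> 'c) \<Rightarrow> bool" where
  "split_exact_sequence A B C f g \<longleftrightarrow>
     comm_group A \<and> comm_group B \<and> comm_group C \<and>
     f \<in> mon A B \<and> g \<in> epi B C \<and> kernel B C g = f ` carrier A \<and>
     (\<exists>h\<in>hom C B. \<forall>c\<in>carrier C. g (h c) = c)"

end

theory Submission
  imports Defs
begin

text \<open>
  Surjectivity of \<open>\<phi>\<close> on units modulo \<open>U(D)\<close> has two consequences. First, every principal ideal of \<open>D\<close>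
  in \<open>k\<close> is generated by the residue of a unit of \<open>T\<close>, so that the projected star operation is
  \<open>F \<mapsto> \<phi>((\<phi>\<^sup>-\<^sup>1 F)\<^sup>*)\<close> and \<open>\<phi>\<^sup>-\<^sup>1\<close> identifies the fractional ideals of \<open>D\<close> with those fractional ideals \<open>E\<close>
  of \<open>R\<close> for which \<open>u \<in> E \<subseteq> w\<^sup>-\<^sup>1 R\<close> with units \<open>u\<close>, \<open>w\<close> of \<open>T\<close>. Second, \<open>T\<close> is the localization
  of \<open>R\<close> at \<open>U(T) \<inter> R\<close>. Together with finite type this yields that \<open>HT\<close> is an invertible star ideal
  for every invertible star ideal \<open>H\<close> of \<open>R\<close>, and that \<open>HT = T\<close> forces \<open>H\<close> to come from \<open>D\<close>.
  The sequence is split by the ideals \<open>H \<subseteq> R\<close> containing an element of residue \<open>1\<close>: such an ideal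
  satisfies \<open>H = HT \<inter> R\<close>, and every invertible star ideal of \<open>T\<close> is, up to a principal factor, the
  extension of one of them.
\<close>

section \<open>Fractional ideals and star operations\<close>

text \<open>The obstacle to comparing \<open>R\<close> and \<open>T\<close> is that a star closure
  could a priori involve infinitely many denominators from \<open>U(T)\<close>. Finite type removes
  it: membership of y in \<open>star E\<close> is certified by a finite subset of E, finitely many
  elements of \<open>T\<close> have a common denominator s, and division by s leads back to
  \<open>T\<close>. This argument runs three times: to compare \<open>star E\<close> with the
  closure of \<open>ET\<close>, to show that \<open>HT\<close> is closed, and to show that
  contractions to \<open>R\<close> are invertible. The splitting has another obstacle: lifts of
  classes of \<open>T\<close> are unique only up to classes coming from \<open>D\<close>, and
  arbitrary choices are not multiplicative. On the ideals with H + M = R, however, the class of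
  \<open>HT\<close> determines the class of H: a scalar carrying \<open>IT\<close> to
  \<open>HT\<close> can be corrected by a unit of \<open>T\<close> until it acts on residues as a
  unit of \<open>D\<close>, and then it respects membership in \<open>R\<close>. These ideals are
  closed under products and their classes map bijectively onto a group, which is enough to make the
  choice of representatives a homomorphism. Properness of \<open>D\<close> enters when ideals of
  \<open>T\<close> are scaled: it excludes R = T, and hence an invertible E with E E^-1 inside
  M.\<close>

lemma l_coset_iff: "y \<in> x <#\<^bsub>K\<^esub> E \<longleftrightarrow> (\<exists>e\<in>E. y = x \<otimes>\<^bsub>K\<^esub> e)"
  by (auto simp: l_coset_def)

lemma ideal_prod_least:
  assumes "\<And>x y. x \<in> V \<Longrightarrow> y \<in> V \<Longrightarrow> x \<oplus>\<^bsub>K\<^esub> y \<in> V"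
    and "\<And>e f. e \<in> E \<Longrightarrow> f \<in> F \<Longrightarrow> e \<otimes>\<^bsub>K\<^esub> f \<in> V"
  shows "ideal_prod K E F \<subseteq> V"
proof
  fix x assume "x \<in> ideal_prod K E F"
  then show "x \<in> V"
    by induction (auto intro: assms)
qed

lemma ideal_prod_mono:
  assumes "E \<subseteq> E'" "F \<subseteq> F'"
  shows "ideal_prod K E F \<subseteq> ideal_prod K E' F'"
  using assms by (intro ideal_prod_least) (auto intro: ideal_prod.intros)

text \<open>A subring of a field is a domain, so \<open>subring\<close> together with
  \<open>fractions\<close> describes a domain and its quotient field. The instances are
  \<open>T\<close> and \<open>R\<close> in \<open>K\<close>, and \<open>D\<close> in
  \<open>k\<close>.\<close>

locale domain_in_field = field K for K (structure) +
  fixes A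
  assumes subring_A: "subring A K"
    and fractions: "x \<in> carrier K \<Longrightarrow> \<exists>a\<in>A. \<exists>b\<in>A - {\<zero>}. x = a \<otimes> inv b"

section \<open>Inverses and products of subsets of a field\<close>

context field
begin

lemma inv_simps:
  assumes "x \<in> carrier R" "x \<noteq> \<zero>"
  shows "inv x \<in> carrier R" "inv x \<noteq> \<zero>" "x \<otimes> inv x = \<one>" "inv x \<otimes> x = \<one>"
    "y \<in> carrier R \<Longrightarrow> x \<otimes> (inv x \<otimes> y) = y" "y \<in> carrier R \<Longrightarrow> inv x \<otimes> (x \<otimes> y) = y"
proof -
  have u: "x \<in> Units R"
    using assms by (simp add: field_Units)
  show i: "inv x \<in> carrier R" "x \<otimes> inv x = \<one>" "inv x \<otimes> x = \<one>"
    using u by auto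
  show "inv x \<noteq> \<zero>"
    using i assms by (metis r_null one_not_zero)
  show "y \<in> carrier R \<Longrightarrow> x \<otimes> (inv x \<otimes> y) = y" "y \<in> carrier R \<Longrightarrow> inv x \<otimes> (x \<otimes> y) = y"
    using i assms by (simp_all add: m_assoc[symmetric])
qed

lemma ideal_prod_closed:
  assumes "E \<subseteq> carrier R" "F \<subseteq> carrier R"
  shows "ideal_prod R E F \<subseteq> carrier R"
  using assms by (intro ideal_prod_least) auto

lemma ideal_prod_comm:
  assumes "E \<subseteq> carrier R" "F \<subseteq> carrier R"
  shows "ideal_prod R E F = ideal_prod R F E"
proof -
  have "ideal_prod R E F \<subseteq> ideal_prod R F E" if "E \<subseteq> carrier R" "F \<subseteq> carrier R" for E F
  proof (rule ideal_prod_least)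
    fix e f assume "e \<in> E" "f \<in> F"
    then show "e \<otimes> f \<in> ideal_prod R F E"
      using that ideal_prod.prod[of f F e E R] by (simp add: subset_iff m_comm)
  qed (rule ideal_prod.sum)
  then show ?thesis
    using assms by blast
qed

lemma ideal_prod_assoc:
  assumes "E \<subseteq> carrier R" "F \<subseteq> carrier R" "G \<subseteq> carrier R"
  shows "ideal_prod R (ideal_prod R E F) G = ideal_prod R E (ideal_prod R F G)"
proof -
  have *: "ideal_prod R (ideal_prod R E F) G \<subseteq> ideal_prod R E (ideal_prod R F G)"
    if "E \<subseteq> carrier R" "F \<subseteq> carrier R" "G \<subseteq> carrier R" for E F G
  proof (rule ideal_prod_least)
    fix x g assume x: "x \<in> ideal_prod R E F" and g: "g \<in> G"
    from x show "x \<otimes> g \<in> ideal_prod R E (ideal_prod R F G)"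
    proof induction
      case (prod e f)
      then show ?case
        using that g by (auto intro!: ideal_prod.prod simp: subset_iff m_assoc)
    next
      case (sum x y)
      then have "(x \<oplus> y) \<otimes> g = x \<otimes> g \<oplus> y \<otimes> g"
        using that g ideal_prod_closed[of E F] by (intro l_distr) auto
      then show ?case
        using sum by (simp add: ideal_prod.sum)
    qed
  qed (auto intro: ideal_prod.sum)
  \<comment> \<open>The reverse inclusion is \<open>*\<close> for the factors in the opposite order,
    by commutativity.\<close>
  have "ideal_prod R E (ideal_prod R F G) = ideal_prod R (ideal_prod R G F) E"
    using assms ideal_prod_closed by (simp add: ideal_prod_comm)
  also have "\<dots> \<subseteq> ideal_prod R G (ideal_prod R F E)"
    using * assms by blast
  also have "\<dots> = ideal_prod R (ideal_prod R E F) G"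
    using assms ideal_prod_closed by (simp add: ideal_prod_comm)
  finally show ?thesis
    using * assms by blast
qed

text \<open>Used for inverses of products, and with \<open>G = H = T\<close> for the
  multiplicativity of extension to \<open>T\<close>.\<close>

lemma ideal_prod_interchange:
  assumes "E \<subseteq> carrier R" "F \<subseteq> carrier R" "G \<subseteq> carrier R" "H \<subseteq> carrier R"
  shows "ideal_prod R (ideal_prod R E F) (ideal_prod R G H)
    = ideal_prod R (ideal_prod R E G) (ideal_prod R F H)"
proof -
  have "ideal_prod R F (ideal_prod R G H) = ideal_prod R G (ideal_prod R F H)"
    using assms ideal_prod_assoc ideal_prod_comm by metis
  then show ?thesis
    using assms ideal_prod_closed by (simp add: ideal_prod_assoc)
qed

lemma ideal_prod_l_coset:
  assumes x: "x \<in> carrier R" and E: "E \<subseteq> carrier R" and F: "F \<subseteq> carrier R"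
  shows "ideal_prod R (x <#\<^bsub>R\<^esub> E) F = x <#\<^bsub>R\<^esub> ideal_prod R E F"
proof
  note EF = ideal_prod_closed[OF E F]
  show "ideal_prod R (x <#\<^bsub>R\<^esub> E) F \<subseteq> x <#\<^bsub>R\<^esub> ideal_prod R E F"
  proof (rule ideal_prod_least)
    fix y f assume "y \<in> x <#\<^bsub>R\<^esub> E" "f \<in> F"
    then obtain e where "e \<in> E" "y \<otimes> f = x \<otimes> (e \<otimes> f)"
      using x E F by (auto simp: l_coset_iff m_assoc subset_iff)
    then show "y \<otimes> f \<in> x <#\<^bsub>R\<^esub> ideal_prod R E F"
      using \<open>f \<in> F\<close> by (auto simp: l_coset_iff intro: ideal_prod.prod)
  next
    fix y z assume "y \<in> x <#\<^bsub>R\<^esub> ideal_prod R E F" "z \<in> x <#\<^bsub>R\<^esub> ideal_prod R E F"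
    then obtain y' z' where "y' \<in> ideal_prod R E F" "z' \<in> ideal_prod R E F"
      "y = x \<otimes> y'" "z = x \<otimes> z'"
      by (auto simp: l_coset_iff)
    then have "y' \<oplus> z' \<in> ideal_prod R E F" "y \<oplus> z = x \<otimes> (y' \<oplus> z')"
      using EF x by (auto intro: ideal_prod.sum simp: r_distr subset_iff)
    then show "y \<oplus> z \<in> x <#\<^bsub>R\<^esub> ideal_prod R E F"
      by (auto simp: l_coset_iff)
  qed
  have "x \<otimes> z \<in> ideal_prod R (x <#\<^bsub>R\<^esub> E) F" if "z \<in> ideal_prod R E F" for z
    using that
  proof induction
    case (prod e f)
    then have "x \<otimes> (e \<otimes> f) = (x \<otimes> e) \<otimes> f" "x \<otimes> e \<in> x <#\<^bsub>R\<^esub> E"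
      using x E F by (auto simp: l_coset_iff m_assoc subset_iff)
    then show ?case
      using prod by (simp add: ideal_prod.prod)
  next
    case (sum y z)
    then show ?case
      using x EF by (auto simp: r_distr subset_iff intro: ideal_prod.sum)
  qed
  then show "x <#\<^bsub>R\<^esub> ideal_prod R E F \<subseteq> ideal_prod R (x <#\<^bsub>R\<^esub> E) F"
    by (auto simp: l_coset_iff)
qed

end

section \<open>Fractional ideals of a domain\<close>

context domain_in_field
begin

lemma A_closed [simp, intro]:
  "x \<in> A \<Longrightarrow> x \<in> carrier K" "\<zero> \<in> A" "\<one> \<in> A" "x \<in> A \<Longrightarrow> \<ominus> x \<in> A"
  "x \<in> A \<Longrightarrow> y \<in> A \<Longrightarrow> x \<otimes> y \<in> A" "x \<in> A \<Longrightarrow> y \<in> A \<Longrightarrow> x \<oplus> y \<in> A"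
  "A \<subseteq> carrier K"
  using subringE[OF subring_A] by auto

lemma frac_idealsI:
  assumes "E \<subseteq> carrier K" "\<And>x y. x \<in> E \<Longrightarrow> y \<in> E \<Longrightarrow> x \<oplus> y \<in> E"
    and smult: "\<And>a x. a \<in> A \<Longrightarrow> x \<in> E \<Longrightarrow> a \<otimes> x \<in> E"
    and e: "e \<in> E" "e \<noteq> \<zero>" and "d \<in> A" "d \<noteq> \<zero>" "\<And>x. x \<in> E \<Longrightarrow> d \<otimes> x \<in> A"
  shows "E \<in> frac_ideals K A"
proof -
  have neg: "\<ominus> x \<in> E" if "x \<in> E" for x
  proof -
    have "\<ominus> x = \<ominus> \<one> \<otimes> x"
      using that assms(1) by (simp add: l_minus subset_iff)
    then show ?thesis
      using smult[of "\<ominus> \<one>" x] that by simp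
  qed
  have "subgroup E (add_monoid K)"
    using assms(1,2) e neg by (intro add.subgroupI) (auto simp: a_inv_def[symmetric])
  then show ?thesis
    using assms unfolding frac_ideals_def
    by (auto simp: l_coset_iff intro!: additive_subgroup.intro bexI[of _ d])
qed

lemma frac_idealsD:
  assumes "E \<in> frac_ideals K A"
  shows "E \<subseteq> carrier K" "x \<in> E \<Longrightarrow> x \<in> carrier K" "\<zero> \<in> E"
    "x \<in> E \<Longrightarrow> y \<in> E \<Longrightarrow> x \<oplus> y \<in> E" "a \<in> A \<Longrightarrow> x \<in> E \<Longrightarrow> a \<otimes> x \<in> E"
proof -
  have a: "additive_subgroup E K" and s: "\<forall>a\<in>A. \<forall>x\<in>E. a \<otimes> x \<in> E"
    using assms unfolding frac_ideals_def by auto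
  show "E \<subseteq> carrier K"
    by (rule additive_subgroup.a_subset[OF a])
  then show "x \<in> E \<Longrightarrow> x \<in> carrier K"
    by blast
  show "\<zero> \<in> E" "x \<in> E \<Longrightarrow> y \<in> E \<Longrightarrow> x \<oplus> y \<in> E"
    using additive_subgroup.zero_closed[OF a] additive_subgroup.a_closed[OF a] by auto
  show "a \<in> A \<Longrightarrow> x \<in> E \<Longrightarrow> a \<otimes> x \<in> E"
    using s by blast
qed

lemma frac_ideals_denom:
  assumes "E \<in> frac_ideals K A"
  obtains d where "d \<in> A" "d \<noteq> \<zero>" "\<And>x. x \<in> E \<Longrightarrow> d \<otimes> x \<in> A"
proof -
  obtain d where "d \<in> A" "d \<noteq> \<zero>" "d <#\<^bsub>K\<^esub> E \<subseteq> A"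
    using assms unfolding frac_ideals_def by blast
  then show thesis
    by (intro that) (auto simp: l_coset_def)
qed

lemma frac_ideals_nonzero:
  assumes "E \<in> frac_ideals K A"
  obtains e where "e \<in> E" "e \<noteq> \<zero>" "e \<in> carrier K"
  using assms frac_idealsD(2,3)[OF assms] unfolding frac_ideals_def by blast

lemma A_frac: "A \<in> frac_ideals K A"
  by (rule frac_idealsI[of _ \<one> \<one>]) auto

lemma l_coset_frac:
  assumes x: "x \<in> carrier K" "x \<noteq> \<zero>" and E: "E \<in> frac_ideals K A"
  shows "x <#\<^bsub>K\<^esub> E \<in> frac_ideals K A"
proof -
  obtain a b where ab: "a \<in> A" "b \<in> A" "b \<noteq> \<zero>" "x = a \<otimes> inv b"
    using fractions[OF x(1)] by auto
  obtain d where d: "d \<in> A" "d \<noteq> \<zero>" "\<And>x. x \<in> E \<Longrightarrow> d \<otimes> x \<in> A"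
    using frac_ideals_denom[OF E] by blast
  obtain e where e: "e \<in> E" "e \<noteq> \<zero>" "e \<in> carrier K"
    using frac_ideals_nonzero[OF E] by blast
  note [simp] = frac_idealsD(2)[OF E]
  show ?thesis
  \<comment> \<open>With x = a/b and d a denominator of E, the product b d is a denominator of x E,
    because (b d)(x z) = a (d z).\<close>
  proof (rule frac_idealsI[of _ "x \<otimes> e" "b \<otimes> d"])
    fix y z assume "y \<in> x <#\<^bsub>K\<^esub> E" "z \<in> x <#\<^bsub>K\<^esub> E"
    then show "y \<oplus> z \<in> x <#\<^bsub>K\<^esub> E"
      using x frac_idealsD(4)[OF E] by (auto simp: l_coset_iff r_distr[symmetric])
  next
    fix c y assume "c \<in> A" "y \<in> x <#\<^bsub>K\<^esub> E"
    then show "c \<otimes> y \<in> x <#\<^bsub>K\<^esub> E"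
      using x frac_idealsD(5)[OF E] m_lcomm[of c x] by (fastforce simp: l_coset_iff)
  next
    fix y assume "y \<in> x <#\<^bsub>K\<^esub> E"
    then obtain z where z: "z \<in> E" "y = x \<otimes> z"
      by (auto simp: l_coset_iff)
    have "b \<otimes> d \<otimes> y = a \<otimes> (d \<otimes> z) \<otimes> (b \<otimes> inv b)"
      using z d(1) ab x by (simp add: inv_simps del: inv_simps(3) add: m_ac)
    also have "\<dots> = a \<otimes> (d \<otimes> z)"
      using z d(1) ab by (simp add: inv_simps)
    finally show "b \<otimes> d \<otimes> y \<in> A"
      using d(3) z ab by simp
  qed (use x e d ab in \<open>auto simp: l_coset_iff integral_iff\<close>)
qed

lemma l_coset_A:
  assumes x: "x \<in> carrier K"
  shows "x \<in> x <#\<^bsub>K\<^esub> A"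
  using x by (auto simp: l_coset_iff intro!: bexI[of _ \<one>])

lemma prod_frac:
  assumes E: "E \<in> frac_ideals K A" and F: "F \<in> frac_ideals K A"
  shows "ideal_prod K E F \<in> frac_ideals K A"
proof -
  obtain d where d: "d \<in> A" "d \<noteq> \<zero>" "\<And>x. x \<in> E \<Longrightarrow> d \<otimes> x \<in> A"
    using frac_ideals_denom[OF E] by blast
  obtain d' where d': "d' \<in> A" "d' \<noteq> \<zero>" "\<And>x. x \<in> F \<Longrightarrow> d' \<otimes> x \<in> A"
    using frac_ideals_denom[OF F] by blast
  obtain e where e: "e \<in> E" "e \<noteq> \<zero>" "e \<in> carrier K"
    using frac_ideals_nonzero[OF E] by blast
  obtain f where f: "f \<in> F" "f \<noteq> \<zero>" "f \<in> carrier K"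
    using frac_ideals_nonzero[OF F] by blast
  note [simp] = frac_idealsD(2)[OF E] frac_idealsD(2)[OF F]
  have sub: "ideal_prod K E F \<subseteq> carrier K"
    by (intro ideal_prod_closed) auto
  show ?thesis
  proof (rule frac_idealsI[of _ "e \<otimes> f" "d \<otimes> d'"])
    fix a x assume a: "a \<in> A" and x: "x \<in> ideal_prod K E F"
    from x show "a \<otimes> x \<in> ideal_prod K E F"
    proof induction
      case (prod y z)
      then have "a \<otimes> (y \<otimes> z) = (a \<otimes> y) \<otimes> z"
        using a by (simp add: m_assoc)
      then show ?case
        using prod a frac_idealsD(5)[OF E] by (auto intro: ideal_prod.prod)
    next
      case (sum y z)
      then show ?case
        using a sub by (auto simp: r_distr subset_iff intro: ideal_prod.sum)
    qed
  next
    fix x assume x: "x \<in> ideal_prod K E F"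
    from x show "d \<otimes> d' \<otimes> x \<in> A"
    proof induction
      case (prod y z)
      then have "d \<otimes> d' \<otimes> (y \<otimes> z) = (d \<otimes> y) \<otimes> (d' \<otimes> z)"
        using d(1) d'(1) by (simp add: m_ac)
      then show ?case
        using prod d(3) d'(3) by auto
    next
      case (sum y z)
      then show ?case
        using d(1) d'(1) sub by (auto simp: r_distr subset_iff)
    qed
  qed (use sub e f d d' in \<open>auto simp: integral_iff intro: ideal_prod.intros\<close>)
qed

lemma prod_A:
  assumes E: "E \<in> frac_ideals K A"
  shows "ideal_prod K A E = E"
proof
  show "ideal_prod K A E \<subseteq> E"
    using frac_idealsD(4,5)[OF E] by (intro ideal_prod_least) auto
  show "E \<subseteq> ideal_prod K A E"
  proof
    fix x assume x: "x \<in> E"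
    then have "\<one> \<otimes> x \<in> ideal_prod K A E"
      by (intro ideal_prod.prod) auto
    then show "x \<in> ideal_prod K A E"
      using frac_idealsD(2)[OF E x] by simp
  qed
qed

lemma prod_l_coset_A:
  assumes x: "x \<in> carrier K" and E: "E \<in> frac_ideals K A"
  shows "ideal_prod K (x <#\<^bsub>K\<^esub> A) E = x <#\<^bsub>K\<^esub> E"
  using ideal_prod_l_coset[OF x A_closed(7) frac_idealsD(1)[OF E]] prod_A[OF E] by simp

lemma l_coset_l_coset:
  assumes "x \<in> carrier K" "y \<in> carrier K" "E \<subseteq> carrier K"
  shows "x <#\<^bsub>K\<^esub> (y <#\<^bsub>K\<^esub> E) = (x \<otimes> y) <#\<^bsub>K\<^esub> E"
  using assms by (force simp: l_coset_iff m_assoc subset_iff)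

lemma l_coset_one:
  assumes "E \<subseteq> carrier K"
  shows "\<one> <#\<^bsub>K\<^esub> E = E"
  using assms by (force simp: l_coset_iff)

lemma colon_frac:
  assumes E: "E \<in> frac_ideals K A"
  shows "colon K A E \<in> frac_ideals K A"
proof -
  note [simp] = frac_idealsD(2)[OF E]
  obtain d where d: "d \<in> A" "d \<noteq> \<zero>" "\<And>x. x \<in> E \<Longrightarrow> d \<otimes> x \<in> A"
    using frac_ideals_denom[OF E] by blast
  obtain e where e: "e \<in> E" "e \<noteq> \<zero>" "e \<in> carrier K"
    using frac_ideals_nonzero[OF E] by blast
  show ?thesis
  \<comment> \<open>The denominator d of E is a nonzero element of the colon ideal. Conversely d e
    is a denominator of the colon ideal: (d e) x = d (x e), and x e lies in
    \<open>A\<close>.\<close>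
  proof (rule frac_idealsI[of _ d "d \<otimes> e"])
    fix x assume "x \<in> colon K A E"
    then have "d \<otimes> (x \<otimes> e) \<in> A" "x \<in> carrier K"
      using d e by (auto simp: colon_def)
    then show "d \<otimes> e \<otimes> x \<in> A"
      using d(1) e by (simp add: m_ac)
  qed (use d e in \<open>auto simp: colon_def integral_iff l_distr m_assoc\<close>)
qed

lemma colon_antimono: "E \<subseteq> F \<Longrightarrow> colon K A F \<subseteq> colon K A E"
  by (auto simp: colon_def)

lemma prod_colon_le: "ideal_prod K E (colon K A E) \<subseteq> A" if "E \<in> frac_ideals K A"
  using frac_idealsD(2)[OF that] by (intro ideal_prod_least) (auto simp: colon_def m_comm)

lemma frac_eq_A:
  assumes "E \<in> frac_ideals K A" "E \<subseteq> A" "\<one> \<in> E"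
  shows "E = A"
proof -
  have "a \<in> E" if "a \<in> A" for a
    using frac_idealsD(5)[OF assms(1) that assms(3)] that by simp
  with assms(2) show ?thesis
    by blast
qed

end

section \<open>Star operations and the group of invertible star ideals\<close>

locale star_domain = domain_in_field +
  fixes s
  assumes star_op: "star_operation K A s"
begin

lemma star_frac: "E \<in> frac_ideals K A \<Longrightarrow> s E \<in> frac_ideals K A"
  and star_l_coset: "x \<in> carrier K \<Longrightarrow> x \<noteq> \<zero> \<Longrightarrow> E \<in> frac_ideals K A \<Longrightarrow>
    s (x <#\<^bsub>K\<^esub> E) = x <#\<^bsub>K\<^esub> s E"
  and star_l_coset_A: "x \<in> carrier K \<Longrightarrow> x \<noteq> \<zero> \<Longrightarrow> s (x <#\<^bsub>K\<^esub> A) = x <#\<^bsub>K\<^esub> A"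
  and star_mono: "E \<in> frac_ideals K A \<Longrightarrow> F \<in> frac_ideals K A \<Longrightarrow> E \<subseteq> F \<Longrightarrow> s E \<subseteq> s F"
  and star_ext: "E \<in> frac_ideals K A \<Longrightarrow> E \<subseteq> s E"
  and star_idem: "E \<in> frac_ideals K A \<Longrightarrow> s (s E) = s E"
  using star_op unfolding star_operation_def by (auto simp del: funcset_mem)

lemma star_A: "s A = A"
  using star_l_coset_A[of \<one>] by (simp add: l_coset_one)

text \<open>Homogeneity and monotonicity turn x E \<subseteq> F into x (\<open>star E\<close>)
  \<subseteq> \<open>star F\<close>. Multiplication of closures by units, denominators and elements
  of inverse ideals all goes through this form; x = 0 is separate because homogeneity concerns
  nonzero scalars.\<close>

lemma star_mult_le:
  assumes E: "E \<in> frac_ideals K A" and F: "F \<in> frac_ideals K A" and x: "x \<in> carrier K"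
    and *: "\<And>e. e \<in> E \<Longrightarrow> x \<otimes> e \<in> F" and y: "y \<in> s E"
  shows "x \<otimes> y \<in> s F"
proof (cases "x = \<zero>")
  case True
  then show ?thesis
    using frac_idealsD(2)[OF star_frac[OF E] y] frac_idealsD(3)[OF star_frac[OF F]] by simp
next
  case False
  have "s (x <#\<^bsub>K\<^esub> E) \<subseteq> s F"
    using * by (intro star_mono l_coset_frac False x E F) (auto simp: l_coset_iff)
  then show ?thesis
    using y star_l_coset[OF x False E] by (auto simp: l_coset_iff subset_iff)
qed

text \<open>For every f in F one has f E \<subseteq> E F, so \<open>star_mult_le\<close> puts f
  (\<open>star E\<close>) into the closure of E F.\<close>

lemma star_prod_star:
  assumes E: "E \<in> frac_ideals K A" and F: "F \<in> frac_ideals K A"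
  shows "s (ideal_prod K (s E) F) = s (ideal_prod K E F)"
proof
  note [simp] = frac_idealsD(2)[OF E] frac_idealsD(2)[OF F] frac_idealsD(2)[OF star_frac[OF E]]
  have EF: "s (ideal_prod K E F) \<in> frac_ideals K A"
    by (intro star_frac prod_frac E F)
  have "ideal_prod K (s E) F \<subseteq> s (ideal_prod K E F)"
  proof (rule ideal_prod_least)
    fix e f assume e: "e \<in> s E" and f: "f \<in> F"
    have "f \<otimes> e \<in> s (ideal_prod K E F)"
      using e f by (intro star_mult_le[OF E prod_frac[OF E F] _ _ e])
        (auto simp: m_comm intro: ideal_prod.prod)
    then show "e \<otimes> f \<in> s (ideal_prod K E F)"
      using e f by (simp add: m_comm)
  qed (rule frac_idealsD(4)[OF EF])
  from star_mono[OF _ _ this] show "s (ideal_prod K (s E) F) \<subseteq> s (ideal_prod K E F)"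
    using star_idem EF prod_frac star_frac E F by auto
  show "s (ideal_prod K E F) \<subseteq> s (ideal_prod K (s E) F)"
    using star_ext E F by (intro star_mono prod_frac star_frac ideal_prod_mono) auto
qed

lemma star_prod_star_right:
  assumes E: "E \<in> frac_ideals K A" and F: "F \<in> frac_ideals K A"
  shows "s (ideal_prod K E (s F)) = s (ideal_prod K E F)"
  using star_prod_star[OF F E] E F star_frac frac_idealsD(1) by (simp add: ideal_prod_comm)

abbreviation "Inv \<equiv> Inv_group K A s"

lemma InvD:
  assumes "E \<in> carrier Inv"
  shows "E \<in> frac_ideals K A" "s E = E" "s (ideal_prod K E (colon K A E)) = A"
  using assms by (auto simp: Inv_group_def)

text \<open>A set F with E F \<subseteq> A lies in the colon ideal, so F can replace the exact
  inverse as a witness. Later witnesses are products, extensions or contractions of inverses, whose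
  equality with the colon ideal would be a detour.\<close>

lemma InvI:
  assumes E: "E \<in> frac_ideals K A" "s E = E" and F: "F \<in> frac_ideals K A"
    and EF: "ideal_prod K E F \<subseteq> A" and 1: "\<one> \<in> s (ideal_prod K E F)"
  shows "E \<in> carrier Inv"
proof -
  note [simp] = frac_idealsD(2)[OF E(1)] frac_idealsD(2)[OF F]
  have "F \<subseteq> colon K A E"
  proof
    fix f assume f: "f \<in> F"
    have "f \<otimes> e \<in> A" if e: "e \<in> E" for e
      using ideal_prod.prod[OF e f, of K] EF e f by (auto simp: m_comm)
    with f show "f \<in> colon K A E"
      by (simp add: colon_def)
  qed
  then have "s (ideal_prod K E F) \<subseteq> s (ideal_prod K E (colon K A E))"
    by (intro star_mono prod_frac colon_frac E F ideal_prod_mono) auto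
  with 1 have "\<one> \<in> s (ideal_prod K E (colon K A E))"
    by blast
  moreover have "s (ideal_prod K E (colon K A E)) \<subseteq> A"
    using star_mono[OF prod_frac[OF E(1) colon_frac[OF E(1)]] A_frac prod_colon_le[OF E(1)]]
    by (simp add: star_A)
  ultimately have "s (ideal_prod K E (colon K A E)) = A"
    by (intro frac_eq_A star_frac prod_frac colon_frac E)
  then show ?thesis
    using E by (simp add: Inv_group_def)
qed

lemma A_Inv: "A \<in> carrier Inv"
  by (rule InvI[of _ A]) (simp_all add: A_frac star_A prod_A)

text \<open>Each e in E multiplies the colon ideal into \<open>A\<close>, hence also its closure
  into the closure of \<open>A\<close>, which is \<open>A\<close>.\<close>

lemma star_colon:
  assumes E: "E \<in> frac_ideals K A"
  shows "s (colon K A E) = colon K A E"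
proof
  note [simp] = frac_idealsD(2)[OF E] frac_idealsD(2)[OF star_frac[OF colon_frac[OF E]]]
  show "s (colon K A E) \<subseteq> colon K A E"
  proof
    fix x assume x: "x \<in> s (colon K A E)"
    have "x \<otimes> e \<in> A" if e: "e \<in> E" for e
    proof -
      have "e \<otimes> x \<in> s A"
        using x e by (intro star_mult_le[OF colon_frac[OF E] A_frac]) (auto simp: colon_def m_comm)
      then show ?thesis
        using x e by (simp add: star_A m_comm)
    qed
    with x show "x \<in> colon K A E"
      by (simp add: colon_def)
  qed
qed (rule star_ext[OF colon_frac[OF E]])

lemma colon_Inv:
  assumes E: "E \<in> carrier Inv"
  shows "colon K A E \<in> carrier Inv"
proof (rule InvI[of _ E])
  note E' = InvD[OF E]
  have "ideal_prod K (colon K A E) E = ideal_prod K E (colon K A E)"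
    using colon_frac E' frac_idealsD(1) ideal_prod_comm by metis
  then show "ideal_prod K (colon K A E) E \<subseteq> A" "\<one> \<in> s (ideal_prod K (colon K A E) E)"
    using prod_colon_le E' by auto
qed (use InvD[OF E] colon_frac star_colon in auto)

lemma prod_Inv:
  assumes E: "E \<in> carrier Inv" and F: "F \<in> carrier Inv"
  shows "s (ideal_prod K E F) \<in> carrier Inv"
proof (rule InvI)
  note E' = InvD[OF E] and F' = InvD[OF F]
  let ?E = "colon K A E" and ?F = "colon K A F"
  have fr: "?E \<in> frac_ideals K A" "?F \<in> frac_ideals K A"
    using E' F' colon_frac by auto
  note c = frac_idealsD(1)[OF fr(1)] frac_idealsD(1)[OF fr(2)]
    frac_idealsD(1)[OF E'(1)] frac_idealsD(1)[OF F'(1)]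
  show 1: "s (ideal_prod K E F) \<in> frac_ideals K A" "s (s (ideal_prod K E F)) = s (ideal_prod K E F)"
    using star_frac star_idem prod_frac E' F' by auto
  show 2: "ideal_prod K ?E ?F \<in> frac_ideals K A"
    using prod_frac fr by auto
  have "ideal_prod K (ideal_prod K E F) (ideal_prod K ?E ?F)
      = ideal_prod K (ideal_prod K E ?E) (ideal_prod K F ?F)"
    using c by (intro ideal_prod_interchange)
  then have "s (ideal_prod K (s (ideal_prod K E F)) (ideal_prod K ?E ?F))
      = s (ideal_prod K (s (ideal_prod K E ?E)) (ideal_prod K F ?F))"
    by (simp only: star_prod_star prod_frac fr E'(1) F'(1))
  also have "\<dots> = A"
    using E' F' prod_frac fr by (simp add: prod_A)
  finally have *: "s (ideal_prod K (s (ideal_prod K E F)) (ideal_prod K ?E ?F)) = A" .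
  then show "\<one> \<in> s (ideal_prod K (s (ideal_prod K E F)) (ideal_prod K ?E ?F))"
    by simp
  show "ideal_prod K (s (ideal_prod K E F)) (ideal_prod K ?E ?F) \<subseteq> A"
    using star_ext[OF prod_frac[OF 1(1) 2]] * by simp
qed

lemma Inv_simps: "x \<otimes>\<^bsub>Inv\<^esub> y = s (ideal_prod K x y)" "\<one>\<^bsub>Inv\<^esub> = A"
  by (simp_all add: Inv_group_def)

lemma comm_group_Inv: "comm_group Inv"
proof (rule comm_groupI)
  fix E F G assume "E \<in> carrier Inv" "F \<in> carrier Inv" "G \<in> carrier Inv"
  then have fr: "E \<in> frac_ideals K A" "F \<in> frac_ideals K A" "G \<in> frac_ideals K A"
    using InvD by auto
  note c = fr[THEN frac_idealsD(1)]
  show "E \<otimes>\<^bsub>Inv\<^esub> F \<otimes>\<^bsub>Inv\<^esub> G = E \<otimes>\<^bsub>Inv\<^esub> (F \<otimes>\<^bsub>Inv\<^esub> G)"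
    using fr prod_frac c by (simp add: Inv_simps star_prod_star star_prod_star_right ideal_prod_assoc)
next
  fix E F assume "E \<in> carrier Inv" "F \<in> carrier Inv"
  then show "E \<otimes>\<^bsub>Inv\<^esub> F = F \<otimes>\<^bsub>Inv\<^esub> E"
    using InvD frac_idealsD(1) ideal_prod_comm by (metis Inv_simps(1))
next
  fix E assume E: "E \<in> carrier Inv"
  then show "\<exists>F\<in>carrier Inv. F \<otimes>\<^bsub>Inv\<^esub> E = \<one>\<^bsub>Inv\<^esub>"
    using InvD[OF E] colon_frac frac_idealsD(1)
    by (intro bexI[of _ "colon K A E"] colon_Inv) (simp_all add: Inv_simps ideal_prod_comm)
qed (auto simp: Inv_simps A_Inv prod_Inv prod_A InvD)

lemma l_coset_Inv:
  assumes x: "x \<in> carrier K" "x \<noteq> \<zero>" and E: "E \<in> carrier Inv"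
  shows "x <#\<^bsub>K\<^esub> E \<in> carrier Inv" "(x <#\<^bsub>K\<^esub> A) \<otimes>\<^bsub>Inv\<^esub> E = x <#\<^bsub>K\<^esub> E"
proof -
  note E' = InvD[OF E]
  have P: "y <#\<^bsub>K\<^esub> A \<in> carrier Inv" if "y \<in> carrier K" "y \<noteq> \<zero>" for y
  proof (rule InvI[of _ "inv y <#\<^bsub>K\<^esub> A"])
    have eq: "ideal_prod K (y <#\<^bsub>K\<^esub> A) (inv y <#\<^bsub>K\<^esub> A) = A"
      using that A_frac frac_idealsD(1)[OF A_frac]
      by (simp add: prod_l_coset_A l_coset_frac l_coset_l_coset inv_simps l_coset_one)
    show "ideal_prod K (y <#\<^bsub>K\<^esub> A) (inv y <#\<^bsub>K\<^esub> A) \<subseteq> A"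
      "\<one> \<in> s (ideal_prod K (y <#\<^bsub>K\<^esub> A) (inv y <#\<^bsub>K\<^esub> A))"
      by (simp_all add: eq star_A)
  qed (use that A_frac in \<open>auto simp: l_coset_frac star_l_coset_A inv_simps\<close>)
  show eq: "(x <#\<^bsub>K\<^esub> A) \<otimes>\<^bsub>Inv\<^esub> E = x <#\<^bsub>K\<^esub> E"
    using E' x by (simp add: Inv_simps prod_l_coset_A star_l_coset)
  show "x <#\<^bsub>K\<^esub> E \<in> carrier Inv"
    using comm_groupE(1)[OF comm_group_Inv P[OF x] E] by (simp add: eq)
qed

lemma Prin_subgroup: "subgroup (Prin K A) Inv"
proof -
  interpret I: comm_group Inv
    by (rule comm_group_Inv)
  have P: "x <#\<^bsub>K\<^esub> A \<in> carrier Inv" if "x \<in> carrier K" "x \<noteq> \<zero>" for x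
    using l_coset_Inv(1)[OF that A_Inv] .
  have mult: "(x <#\<^bsub>K\<^esub> A) \<otimes>\<^bsub>Inv\<^esub> (y <#\<^bsub>K\<^esub> A) = (x \<otimes> y) <#\<^bsub>K\<^esub> A"
    if "x \<in> carrier K" "x \<noteq> \<zero>" "y \<in> carrier K" "y \<noteq> \<zero>" for x y
    using that l_coset_Inv(2)[OF that(1,2) P[OF that(3,4)]] frac_idealsD(1)[OF A_frac]
    by (simp add: l_coset_l_coset)
  show ?thesis
  proof (rule I.subgroupI)
    show "Prin K A \<subseteq> carrier Inv" "Prin K A \<noteq> {}"
      using P one_not_zero by (auto simp: Prin_def)
    fix E assume "E \<in> Prin K A"
    then obtain x where x: "x \<in> carrier K" "x \<noteq> \<zero>" "E = x <#\<^bsub>K\<^esub> A"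
      by (auto simp: Prin_def)
    have "inv\<^bsub>Inv\<^esub> E = inv x <#\<^bsub>K\<^esub> A"
      using x P mult[of "inv x" x] frac_idealsD(1)[OF A_frac]
      by (intro I.inv_equality) (auto simp: inv_simps l_coset_one Inv_simps(2))
    then show "inv\<^bsub>Inv\<^esub> E \<in> Prin K A"
      using x by (auto simp: Prin_def inv_simps)
  next
    fix E F assume "E \<in> Prin K A" "F \<in> Prin K A"
    then show "E \<otimes>\<^bsub>Inv\<^esub> F \<in> Prin K A"
      using mult by (auto simp: Prin_def integral_iff)
  qed
qed

lemma ideal_class_eq:
  assumes "E \<in> carrier Inv"
  shows "ideal_class K A s E = {x <#\<^bsub>K\<^esub> E | x. x \<in> carrier K - {\<zero>}}"
  using l_coset_Inv(2)[OF _ _ assms] unfolding ideal_class_def Prin_def r_coset_def by force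

text \<open>A class consists of the nonzero scalings of a representative. Exactness and splitting
  are therefore decided by finding scalars.\<close>

lemma ideal_class_eq_iff:
  assumes E: "E \<in> carrier Inv" and F: "F \<in> carrier Inv"
  shows "ideal_class K A s E = ideal_class K A s F \<longleftrightarrow> (\<exists>x\<in>carrier K - {\<zero>}. E = x <#\<^bsub>K\<^esub> F)"
proof
  interpret I: comm_group Inv
    by (rule comm_group_Inv)
  assume "ideal_class K A s E = ideal_class K A s F"
  then have "E \<in> ideal_class K A s F"
    using I.rcos_self[OF E Prin_subgroup] by (simp add: ideal_class_def)
  then show "\<exists>x\<in>carrier K - {\<zero>}. E = x <#\<^bsub>K\<^esub> F"
    by (auto simp: ideal_class_eq[OF F])
next
  interpret I: comm_group Inv
    by (rule comm_group_Inv)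
  assume "\<exists>x\<in>carrier K - {\<zero>}. E = x <#\<^bsub>K\<^esub> F"
  then have "E \<in> ideal_class K A s F"
    by (auto simp: ideal_class_eq[OF F])
  then show "ideal_class K A s E = ideal_class K A s F"
    using I.repr_independence[OF _ F Prin_subgroup] by (simp add: ideal_class_def)
qed

end

section \<open>Finite generation and finite type\<close>

context domain_in_field
begin

lemma subset_Span:
  assumes "set xs \<subseteq> carrier K"
  shows "set xs \<subseteq> Span A xs \<and> Span A xs \<subseteq> carrier K \<and> \<zero> \<in> Span A xs"
  using assms
proof (induction xs)
  case (Cons x xs)
  then have IH: "set xs \<subseteq> Span A xs" "Span A xs \<subseteq> carrier K" "\<zero> \<in> Span A xs" and x: "x \<in> carrier K"
    by auto
  have *: "\<exists>a\<in>A. \<exists>v\<in>Span A xs. y = a \<otimes> x \<oplus> v" if "y \<in> Span A xs" for y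
    using that x IH(2) by (intro bexI[of _ \<zero>] bexI[of _ y]) auto
  have "\<exists>a\<in>A. \<exists>v\<in>Span A xs. x = a \<otimes> x \<oplus> v"
    using x IH(3) by (intro bexI[of _ \<one>] bexI[of _ \<zero>]) auto
  moreover have "line_extension A x (Span A xs) \<subseteq> carrier K"
  proof
    fix y assume "y \<in> line_extension A x (Span A xs)"
    then obtain a v where "a \<in> A" "v \<in> Span A xs" "y = a \<otimes> x \<oplus> v"
      unfolding line_extension_mem_iff by blast
    then show "y \<in> carrier K"
      using x subsetD[OF IH(2), of v] by simp
  qed
  ultimately show ?case
    using * IH by (auto simp: line_extension_mem_iff)
qed simp

lemma Span_mult_closed:
  assumes F: "F \<in> frac_ideals K A" and x: "x \<in> carrier K" and xs: "set xs \<subseteq> carrier K"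
    and "\<And>z. z \<in> set xs \<Longrightarrow> x \<otimes> z \<in> F" "y \<in> Span A xs"
  shows "x \<otimes> y \<in> F"
  using assms(3-)
proof (induction xs arbitrary: y)
  case Nil
  then show ?case
    using x frac_idealsD(3)[OF F] by simp
next
  case (Cons z zs)
  then obtain a v where av: "a \<in> A" "v \<in> Span A zs" "y = a \<otimes> z \<oplus> v"
    by (auto simp: line_extension_mem_iff)
  moreover have "v \<in> carrier K"
    using av subset_Span[of zs] Cons.prems by auto
  ultimately have "x \<otimes> y = a \<otimes> (x \<otimes> z) \<oplus> x \<otimes> v"
    using x Cons.prems by (simp add: r_distr m_lcomm)
  moreover have "x \<otimes> v \<in> F" "x \<otimes> z \<in> F"
    using Cons av by auto
  ultimately show ?case
    using av frac_idealsD(4,5)[OF F] by simp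
qed

end

text \<open>W is a generating set of a finitely generated ideal whose closure already contains y.
  Multiplication by x is \<open>A\<close>-linear, so testing x on W controls x on that ideal, and
  then on y by \<open>star_mult_le\<close>. This is the form in which finite type is
  applied.\<close>

lemma (in star_domain) finite_type_witness:
  assumes "finite_type K A s" and E: "E \<in> frac_ideals K A" and y: "y \<in> s E"
  obtains W where "finite W" "W \<subseteq> E"
    "\<And>x F. F \<in> frac_ideals K A \<Longrightarrow> x \<in> carrier K \<Longrightarrow> (\<And>z. z \<in> W \<Longrightarrow> x \<otimes> z \<in> F) \<Longrightarrow> x \<otimes> y \<in> s F"
proof -
  obtain L where L: "L \<in> fg_frac_ideals K A" "L \<subseteq> E" "y \<in> s L"
    using assms unfolding finite_type_def star_f_def by blast
  then obtain xs where xs: "set xs \<subseteq> carrier K" "L = Span A xs" "L \<in> frac_ideals K A"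
    unfolding fg_frac_ideals_def by blast
  show thesis
  proof (rule that[of "set xs"])
    fix x F assume "F \<in> frac_ideals K A" "x \<in> carrier K" "\<And>z. z \<in> set xs \<Longrightarrow> x \<otimes> z \<in> F"
    then show "x \<otimes> y \<in> s F"
      using Span_mult_closed[of F x xs] xs L(3) by (intro star_mult_le[of L]) auto
  qed (use L(2) xs subset_Span[OF xs(1)] in auto)
qed

section \<open>Induced maps on quotient groups\<close>

text \<open>All elements of N a have images in one coset of L, since f N \<subseteq> L. The image
  set is thus a singleton and \<open>the_elem\<close> returns its element: this is the
  well-definedness of the maps on classes.\<close>

lemma the_elem_induced:
  assumes "group G" "group H" and N: "subgroup N G" and L: "subgroup L H"
    and f: "f \<in> hom G H" "f ` N \<subseteq> L" and a: "a \<in> carrier G"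
  shows "the_elem ((\<lambda>x. L #>\<^bsub>H\<^esub> f x) ` (N #>\<^bsub>G\<^esub> a)) = L #>\<^bsub>H\<^esub> f a"
proof -
  interpret G: group G by fact
  interpret H: group H by fact
  have "L #>\<^bsub>H\<^esub> f x = L #>\<^bsub>H\<^esub> f a" if x: "x \<in> N #>\<^bsub>G\<^esub> a" for x
  proof -
    obtain n where n: "n \<in> N" "x = n \<otimes>\<^bsub>G\<^esub> a"
      using x by (auto simp: r_coset_def)
    have c: "f n \<in> L" "f n \<in> carrier H" "f a \<in> carrier H"
      using n f a subgroup.mem_carrier[OF N] by (auto simp: hom_def)
    have "f x = f n \<otimes>\<^bsub>H\<^esub> f a"
      using n a f(1) subgroup.mem_carrier[OF N] by (auto simp: hom_def)
    then have "f x \<in> L #>\<^bsub>H\<^esub> f a"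
      using c by (auto simp: r_coset_def)
    then show ?thesis
      using H.repr_independence[OF _ c(3) L] by simp
  qed
  moreover have "a \<in> N #>\<^bsub>G\<^esub> a"
    using G.rcos_self[OF a N] .
  ultimately have "(\<lambda>x. L #>\<^bsub>H\<^esub> f x) ` (N #>\<^bsub>G\<^esub> a) = {L #>\<^bsub>H\<^esub> f a}"
    by blast
  then show ?thesis
    by simp
qed

lemma hom_induced:
  assumes "comm_group G" "comm_group H" and N: "subgroup N G" and L: "subgroup L H"
    and f: "f \<in> hom G H" "f ` N \<subseteq> L"
  shows "(\<lambda>S. the_elem ((\<lambda>x. L #>\<^bsub>H\<^esub> f x) ` S)) \<in> hom (G Mod N) (H Mod L)"
proof -
  interpret G: comm_group G by fact
  interpret H: comm_group H by fact
  note [simp] = the_elem_induced[OF G.is_group H.is_group N L f]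
  have N': "N \<lhd> G" and L': "L \<lhd> H"
    using N L G.subgroup_imp_normal H.subgroup_imp_normal by auto
  have fc: "f x \<in> carrier H" "f (x \<otimes>\<^bsub>G\<^esub> y) = f x \<otimes>\<^bsub>H\<^esub> f y" if "x \<in> carrier G" "y \<in> carrier G" for x y
    using f that by (auto simp: hom_def)
  show ?thesis
    by (rule homI)
      (auto simp: carrier_FactGroup FactGroup_def RCOSETS_def normal.rcos_sum[OF N'] normal.rcos_sum[OF L'] fc)
qed

text \<open>The set \<open>P\<close> represents a complement of the kernel: its classes map bijectively onto the
  quotient, and inverting this bijection splits the sequence.\<close>

lemma split_exact_sequence_quotients:
  fixes A :: "('a, 'm) monoid_scheme" and B :: "('b, 'n) monoid_scheme"
    and C :: "('c, 'o) monoid_scheme"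
  assumes groups: "comm_group A" "comm_group B" "comm_group C"
    and N: "subgroup NA A" "subgroup NB B" "subgroup NC C"
    and f: "f \<in> hom A B" and g: "g \<in> hom B C"
    and inj: "\<And>a. a \<in> carrier A \<Longrightarrow> f a \<in> NB \<longleftrightarrow> a \<in> NA"
    and exact: "\<And>b. b \<in> carrier B \<Longrightarrow>
      g b \<in> NC \<longleftrightarrow> (\<exists>a\<in>carrier A. NB #>\<^bsub>B\<^esub> b = NB #>\<^bsub>B\<^esub> f a)"
    and P: "P \<subseteq> carrier B" "\<And>p q. p \<in> P \<Longrightarrow> q \<in> P \<Longrightarrow> p \<otimes>\<^bsub>B\<^esub> q \<in> P"
    and P_surj: "\<And>c. c \<in> carrier C \<Longrightarrow> \<exists>p\<in>P. NC #>\<^bsub>C\<^esub> g p = NC #>\<^bsub>C\<^esub> c"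
    and P_inj: "\<And>p q. p \<in> P \<Longrightarrow> q \<in> P \<Longrightarrow> NC #>\<^bsub>C\<^esub> g p = NC #>\<^bsub>C\<^esub> g q \<Longrightarrow>
      NB #>\<^bsub>B\<^esub> p = NB #>\<^bsub>B\<^esub> q"
  shows "split_exact_sequence (A Mod NA) (B Mod NB) (C Mod NC)
    (\<lambda>S. the_elem ((\<lambda>a. NB #>\<^bsub>B\<^esub> f a) ` S)) (\<lambda>S. the_elem ((\<lambda>b. NC #>\<^bsub>C\<^esub> g b) ` S))"
proof -
  interpret A: comm_group A by fact
  interpret B: comm_group B by fact
  interpret C: comm_group C by fact
  let ?f = "\<lambda>S. the_elem ((\<lambda>a. NB #>\<^bsub>B\<^esub> f a) ` S)"
  let ?g = "\<lambda>S. the_elem ((\<lambda>b. NC #>\<^bsub>C\<^esub> g b) ` S)"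
  have fc: "f a \<in> carrier B" if "a \<in> carrier A" for a
    using f that by (auto simp: hom_def)
  have gc: "g b \<in> carrier C" if "b \<in> carrier B" for b
    using g that by (auto simp: hom_def)
  have coset_iff: "NA #>\<^bsub>A\<^esub> a = NA \<longleftrightarrow> a \<in> NA" "NB #>\<^bsub>B\<^esub> b = NB \<longleftrightarrow> b \<in> NB"
    "NC #>\<^bsub>C\<^esub> c = NC \<longleftrightarrow> c \<in> NC"
    if "a \<in> carrier A" "b \<in> carrier B" "c \<in> carrier C" for a b c
    using that N A.coset_join1 A.coset_join2 B.coset_join1 B.coset_join2 C.coset_join1 C.coset_join2
    by (metis subgroup.subset)+
  have fN: "f ` NA \<subseteq> NB"
    using inj subgroup.mem_carrier[OF N(1)] by blast
  have gN: "g ` NB \<subseteq> NC"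
  proof
    fix c assume "c \<in> g ` NB"
    then obtain b where b: "b \<in> NB" "c = g b" "b \<in> carrier B"
      using subgroup.mem_carrier[OF N(2)] by blast
    \<comment> \<open>The inclusion follows from exactness: b in \<open>NB\<close> has the same
      coset as the image of the unit of A, which makes it an instance of the right-hand side of
      \<open>exact\<close>.\<close>
    have "f \<one>\<^bsub>A\<^esub> \<in> NB"
      using inj[of "\<one>\<^bsub>A\<^esub>"] subgroup.one_closed[OF N(1)] by simp
    then have "NB #>\<^bsub>B\<^esub> b = NB #>\<^bsub>B\<^esub> f \<one>\<^bsub>A\<^esub>"
      using coset_iff(2) b fc by (metis A.one_closed C.one_closed)
    then show "c \<in> NC"
      using exact b by blast
  qed
  note f_coset = the_elem_induced[OF A.is_group B.is_group N(1,2) f fN]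
  note g_coset = the_elem_induced[OF B.is_group C.is_group N(2,3) g gN]
  note fhom = hom_induced[OF groups(1,2) N(1,2) f fN]
  note ghom = hom_induced[OF groups(2,3) N(2,3) g gN]
  have CG: "comm_group (A Mod NA)" "comm_group (B Mod NB)" "comm_group (C Mod NC)"
    using N A.abelian_FactGroup B.abelian_FactGroup C.abelian_FactGroup by auto
  then have mon: "?f \<in> mon (A Mod NA) (B Mod NB)"
  proof (subst mon_iff_hom_one)
    have "NA #>\<^bsub>A\<^esub> a = NA" if "a \<in> carrier A" "NB #>\<^bsub>B\<^esub> f a = NB" for a
      using that coset_iff(1)[OF _ B.one_closed C.one_closed]
        coset_iff(2)[OF A.one_closed fc C.one_closed] inj by blast
    then show "?f \<in> hom (A Mod NA) (B Mod NB) \<and>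
      (\<forall>S. S \<in> carrier (A Mod NA) \<and> ?f S = \<one>\<^bsub>B Mod NB\<^esub> \<longrightarrow> S = \<one>\<^bsub>A Mod NA\<^esub>)"
      using fhom f_coset unfolding carrier_FactGroup[of A NA] by fastforce
  qed (use CG in \<open>simp_all add: comm_group_def\<close>)
  have epi: "?g \<in> epi (B Mod NB) (C Mod NC)"
  proof -
    have "?g ` carrier (B Mod NB) = carrier (C Mod NC)"
    proof
      show "?g ` carrier (B Mod NB) \<subseteq> carrier (C Mod NC)"
        using ghom by (auto simp: hom_def)
      show "carrier (C Mod NC) \<subseteq> ?g ` carrier (B Mod NB)"
      proof
        fix S assume "S \<in> carrier (C Mod NC)"
        then obtain c where c: "c \<in> carrier C" "S = NC #>\<^bsub>C\<^esub> c"
          by (auto simp: carrier_FactGroup)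
        then obtain p where "p \<in> P" "NC #>\<^bsub>C\<^esub> g p = S"
          using P_surj by blast
        then show "S \<in> ?g ` carrier (B Mod NB)"
          using g_coset[of p] P(1) by (auto simp: carrier_FactGroup intro!: image_eqI[of _ _ "NB #>\<^bsub>B\<^esub> p"])
      qed
    qed
    with ghom show ?thesis
      by (simp add: epi_def)
  qed
  have kernel: "kernel (B Mod NB) (C Mod NC) ?g = ?f ` carrier (A Mod NA)"
  proof -
    have *: "NB #>\<^bsub>B\<^esub> b \<in> kernel (B Mod NB) (C Mod NC) ?g \<longleftrightarrow> NB #>\<^bsub>B\<^esub> b \<in> ?f ` carrier (A Mod NA)"
      if "b \<in> carrier B" for b
    proof -
      have *: "NB #>\<^bsub>B\<^esub> b \<in> kernel (B Mod NB) (C Mod NC) ?g \<longleftrightarrow> g b \<in> NC"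
      proof -
        have "NB #>\<^bsub>B\<^esub> b \<in> carrier (B Mod NB)"
          using that by (simp add: carrier_FactGroup)
        then show ?thesis
          using g_coset[OF that] coset_iff(3)[OF A.one_closed that gc[OF that]]
          by (simp add: kernel_def)
      qed
      also have "\<dots> \<longleftrightarrow> NB #>\<^bsub>B\<^esub> b \<in> ?f ` carrier (A Mod NA)"
        using f_coset by (simp add: exact[OF that] carrier_FactGroup image_iff)
      finally show ?thesis .
    qed
    have k: "kernel (B Mod NB) (C Mod NC) ?g \<subseteq> carrier (B Mod NB)"
      by (auto simp: kernel_def)
    have i: "?f ` carrier (A Mod NA) \<subseteq> carrier (B Mod NB)"
      using fhom by (auto simp: hom_def)
    show ?thesis
    proof (rule Set.set_eqI)
      fix S
      show "S \<in> kernel (B Mod NB) (C Mod NC) ?g \<longleftrightarrow> S \<in> ?f ` carrier (A Mod NA)"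
      proof (cases "S \<in> carrier (B Mod NB)")
        case True
        then obtain b where "b \<in> carrier B" "S = NB #>\<^bsub>B\<^esub> b"
          unfolding carrier_FactGroup[of B] by blast
        then show ?thesis
          using * by simp
      next
        case False
        with k i show ?thesis
          by blast
      qed
    qed
  qed
  \<comment> \<open>The choice depends only on the coset c, so no independence of representatives
    has to be proved.\<close>
  define sec where "sec c = (SOME p. p \<in> P \<and> NC #>\<^bsub>C\<^esub> g p = c)" for c
  have sec: "sec (NC #>\<^bsub>C\<^esub> c) \<in> P" "NC #>\<^bsub>C\<^esub> g (sec (NC #>\<^bsub>C\<^esub> c)) = NC #>\<^bsub>C\<^esub> c"
    "sec (NC #>\<^bsub>C\<^esub> c) \<in> carrier B"
    if "c \<in> carrier C" for c
    using someI_ex[of "\<lambda>p. p \<in> P \<and> NC #>\<^bsub>C\<^esub> g p = NC #>\<^bsub>C\<^esub> c"] P_surj[OF that] P(1)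
    unfolding sec_def by auto
  define h where "h c = NB #>\<^bsub>B\<^esub> sec c" for c
  have normal: "NB \<lhd> B" "NC \<lhd> C"
    using N B.subgroup_imp_normal C.subgroup_imp_normal by auto
  have "h \<in> hom (C Mod NC) (B Mod NB)"
  proof (rule homI)
    fix c assume "c \<in> carrier (C Mod NC)"
    then show "h c \<in> carrier (B Mod NB)"
      using sec(3) by (auto simp: carrier_FactGroup h_def)
  next
    fix S S' assume "S \<in> carrier (C Mod NC)" "S' \<in> carrier (C Mod NC)"
    then obtain c c' where c: "c \<in> carrier C" "c' \<in> carrier C" "S = NC #>\<^bsub>C\<^esub> c" "S' = NC #>\<^bsub>C\<^esub> c'"
      by (auto simp: carrier_FactGroup)
    have SS': "S \<otimes>\<^bsub>C Mod NC\<^esub> S' = NC #>\<^bsub>C\<^esub> (c \<otimes>\<^bsub>C\<^esub> c')"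
      using c normal.rcos_sum[OF normal(2)] by (simp add: FactGroup_def)
    have s: "sec S \<in> P" "sec S' \<in> P" "sec (S \<otimes>\<^bsub>C Mod NC\<^esub> S') \<in> P" "sec S \<in> carrier B" "sec S' \<in> carrier B"
      unfolding SS' using c sec by simp_all
    \<comment> \<open>The product of the two chosen elements and the element chosen for the product
      both lie in P and have the same image class. \<open>P_inj\<close> then identifies their
      classes, which is multiplicativity of the section.\<close>
    have "g (sec S \<otimes>\<^bsub>B\<^esub> sec S') = g (sec S) \<otimes>\<^bsub>C\<^esub> g (sec S')"
      using g s by (auto simp: hom_def)
    then have "NC #>\<^bsub>C\<^esub> g (sec S \<otimes>\<^bsub>B\<^esub> sec S') = (NC #>\<^bsub>C\<^esub> g (sec S)) <#>\<^bsub>C\<^esub> (NC #>\<^bsub>C\<^esub> g (sec S'))"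
      using normal.rcos_sum[OF normal(2)] gc s by simp
    also have "\<dots> = NC #>\<^bsub>C\<^esub> g (sec (S \<otimes>\<^bsub>C Mod NC\<^esub> S'))"
      using SS' sec(2) c by (simp add: FactGroup_def)
    finally have "NB #>\<^bsub>B\<^esub> (sec S \<otimes>\<^bsub>B\<^esub> sec S') = NB #>\<^bsub>B\<^esub> sec (S \<otimes>\<^bsub>C Mod NC\<^esub> S')"
      using P_inj P(2) s by blast
    then show "h (S \<otimes>\<^bsub>C Mod NC\<^esub> S') = h S \<otimes>\<^bsub>B Mod NB\<^esub> h S'"
      using normal.rcos_sum[OF normal(1)] s by (simp add: h_def FactGroup_def)
  qed
  moreover have "\<forall>c\<in>carrier (C Mod NC). ?g (h c) = c"
    using g_coset sec by (auto simp: carrier_FactGroup h_def)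
  ultimately show ?thesis
    unfolding split_exact_sequence_def using CG mon epi kernel by blast
qed

lemma (in ring) add_minus_cancel: "x \<in> carrier R \<Longrightarrow> y \<in> carrier R \<Longrightarrow> x \<oplus> (y \<ominus> x) = y"
  using a_lcomm[of x y "\<ominus> x"] by (simp add: a_minus_def r_neg)

section \<open>The pullback\<close>

text \<open>The ideal M occurs only as the kernel of \<phi>, and \<open>phi_kernel\<close> says that
  it is nonzero. In \<open>units_surj\<close>, v and d' are the inverses that make u a unit of
  \<open>T\<close> and d a unit of \<open>D\<close>.\<close>

locale pullback = T?: domain_in_field K T + D: domain_in_field k D
  for K :: "('a, 'm) ring_scheme" (structure) and T and k :: "('c, 'n) ring_scheme" and D +
  fixes \<phi> :: "'a \<Rightarrow> 'c"
  assumes phi_closed [simp, intro]: "x \<in> T \<Longrightarrow> \<phi> x \<in> carrier k"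
    and phi_add [simp]: "x \<in> T \<Longrightarrow> y \<in> T \<Longrightarrow> \<phi> (x \<oplus> y) = \<phi> x \<oplus>\<^bsub>k\<^esub> \<phi> y"
    and phi_mult [simp]: "x \<in> T \<Longrightarrow> y \<in> T \<Longrightarrow> \<phi> (x \<otimes> y) = \<phi> x \<otimes>\<^bsub>k\<^esub> \<phi> y"
    and phi_one [simp]: "\<phi> \<one> = \<one>\<^bsub>k\<^esub>"
    and phi_surj: "z \<in> carrier k \<Longrightarrow> \<exists>x\<in>T. \<phi> x = z"
    and phi_kernel: "\<exists>m\<in>T. m \<noteq> \<zero> \<and> \<phi> m = \<zero>\<^bsub>k\<^esub>"
    and D_proper: "D \<noteq> carrier k"
    and units_surj: "z \<in> carrier k \<Longrightarrow> z \<noteq> \<zero>\<^bsub>k\<^esub> \<Longrightarrow>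
      \<exists>u\<in>T. \<exists>v\<in>T. \<exists>d\<in>D. \<exists>d'\<in>D. u \<otimes> v = \<one> \<and> d \<otimes>\<^bsub>k\<^esub> d' = \<one>\<^bsub>k\<^esub> \<and> z = d \<otimes>\<^bsub>k\<^esub> \<phi> u"
begin

definition pre :: "'c set \<Rightarrow> 'a set" where
  "pre F = {x \<in> T. \<phi> x \<in> F}"

abbreviation "R \<equiv> pre D"

definition U :: "'a set" where
  "U = {u \<in> T. u \<noteq> \<zero> \<and> inv u \<in> T}"

lemma preI: "x \<in> T \<Longrightarrow> \<phi> x \<in> F \<Longrightarrow> x \<in> pre F"
  by (simp add: pre_def)

lemma preD: "x \<in> pre F \<Longrightarrow> x \<in> T" "x \<in> pre F \<Longrightarrow> \<phi> x \<in> F"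
  by (simp_all add: pre_def)

lemma phi_zero [simp]: "\<phi> \<zero> = \<zero>\<^bsub>k\<^esub>"
  using phi_add[of \<zero> \<zero>] by (simp del: phi_add)

lemma phi_minus [simp]: "x \<in> T \<Longrightarrow> \<phi> (\<ominus> x) = \<ominus>\<^bsub>k\<^esub> \<phi> x"
  using phi_add[of "\<ominus> x" x] by (intro D.minus_equality[symmetric]) (auto simp del: phi_add simp: l_neg)

lemma unitD:
  assumes "u \<in> U"
  shows "u \<in> T" "inv u \<in> T" "u \<in> carrier K" "u \<noteq> \<zero>" "inv u \<in> U" "u \<otimes> inv u = \<one>" "inv u \<otimes> u = \<one>"
    "\<phi> u \<noteq> \<zero>\<^bsub>k\<^esub>" "\<phi> (inv u) = inv\<^bsub>k\<^esub> \<phi> u" "inv\<^bsub>k\<^esub> \<phi> u \<in> carrier k"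
proof -
  show u: "u \<in> T" "inv u \<in> T" "u \<noteq> \<zero>" "u \<in> carrier K"
    using assms by (auto simp: U_def)
  note i = inv_simps[OF u(4,3)]
  show "u \<otimes> inv u = \<one>" "inv u \<otimes> u = \<one>"
    using i by auto
  have "inv (inv u) = u"
    using u i by (simp add: field_Units)
  then show "inv u \<in> U"
    using u i by (simp add: U_def)
  have e: "\<phi> u \<otimes>\<^bsub>k\<^esub> \<phi> (inv u) = \<one>\<^bsub>k\<^esub>"
    using phi_mult[OF u(1,2)] i by simp
  then show "\<phi> u \<noteq> \<zero>\<^bsub>k\<^esub>"
    using u by (metis D.l_null D.one_not_zero phi_closed)
  show *: "\<phi> (inv u) = inv\<^bsub>k\<^esub> \<phi> u"
    using D.comm_inv_char[OF _ _ e] u by simp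
  then show "inv\<^bsub>k\<^esub> \<phi> u \<in> carrier k"
    using phi_closed[OF u(2)] by simp
qed

lemma unitI: "u \<in> T \<Longrightarrow> v \<in> T \<Longrightarrow> u \<otimes> v = \<one> \<Longrightarrow> u \<in> U"
  unfolding U_def using comm_inv_char[of u v] by (metis (mono_tags, lifting) A_closed(1) l_null mem_Collect_eq one_not_zero)

lemma unit_mult: "u \<in> U \<Longrightarrow> v \<in> U \<Longrightarrow> u \<otimes> v \<in> U"
  by (rule unitI[of _ "inv v \<otimes> inv u"]) (auto simp: unitD m_assoc inv_simps)

lemma units_lift:
  assumes "y \<in> carrier k" "y \<noteq> \<zero>\<^bsub>k\<^esub>"
  obtains u d d' where "u \<in> U" "d \<in> D" "d' \<in> D" "d \<otimes>\<^bsub>k\<^esub> d' = \<one>\<^bsub>k\<^esub>" "d' \<otimes>\<^bsub>k\<^esub> d = \<one>\<^bsub>k\<^esub>"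
    "y = d \<otimes>\<^bsub>k\<^esub> \<phi> u" "\<phi> u = d' \<otimes>\<^bsub>k\<^esub> y"
proof -
  obtain u v d d' where *: "u \<in> T" "v \<in> T" "u \<otimes> v = \<one>" "d \<in> D" "d' \<in> D"
    "d \<otimes>\<^bsub>k\<^esub> d' = \<one>\<^bsub>k\<^esub>" "y = d \<otimes>\<^bsub>k\<^esub> \<phi> u"
    using units_surj[OF assms] by blast
  then have c: "d' \<otimes>\<^bsub>k\<^esub> d = \<one>\<^bsub>k\<^esub>"
    by (simp add: D.m_comm)
  then have "\<phi> u = d' \<otimes>\<^bsub>k\<^esub> y"
    using * by (simp add: D.m_assoc[symmetric])
  with * c unitI[of u v] show thesis
    using that by blast
qed

lemma R_subring: "subring R K"
  by (rule subringI) (auto simp: pre_def)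

text \<open>This is M \<subseteq> R, the source of elements that multiply \<open>T\<close> into
  \<open>R\<close>.\<close>

lemma kernel_R: "x \<in> T \<Longrightarrow> \<phi> x = \<zero>\<^bsub>k\<^esub> \<Longrightarrow> x \<in> R"
  by (simp add: pre_def)

sublocale R: domain_in_field K R
proof (intro domain_in_field.intro domain_in_field_axioms.intro field_axioms R_subring)
  fix x assume x: "x \<in> carrier K"
  obtain a b where ab: "a \<in> T" "b \<in> T" "b \<noteq> \<zero>" "x = a \<otimes> inv b"
    using fractions[OF x] by auto
  obtain m where m: "m \<in> T" "m \<noteq> \<zero>" "\<phi> m = \<zero>\<^bsub>k\<^esub>"
    using phi_kernel by blast
  \<comment> \<open>Expanding the fraction by a nonzero m in M moves numerator and denominator into
    M, hence into \<open>R\<close>.\<close>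
  have "x = (a \<otimes> m) \<otimes> inv (b \<otimes> m)"
  proof -
    have bm: "b \<otimes> m \<in> carrier K" "b \<otimes> m \<noteq> \<zero>"
      using ab m by (auto simp: integral_iff)
    have "a \<otimes> m = x \<otimes> (b \<otimes> m)"
      using ab m by (simp add: m_assoc inv_simps)
    then show ?thesis
      using bm x by (simp add: m_assoc inv_simps)
  qed
  moreover have "a \<otimes> m \<in> R" "b \<otimes> m \<in> R - {\<zero>}"
    using ab m by (auto simp: integral_iff intro!: kernel_R)
  ultimately show "\<exists>a\<in>R. \<exists>b\<in>R - {\<zero>}. x = a \<otimes> inv b"
    by blast
qed

lemma R_T: "x \<in> R \<Longrightarrow> x \<in> T"
  by (simp add: pre_def)

text \<open>Write \<phi>(t) = a/b with a, b in \<open>D\<close>. Up to a unit of \<open>D\<close>, b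
  is the residue of a unit u of \<open>T\<close>; then both u and u t have residues in
  \<open>D\<close>.\<close>

lemma denom_T:
  assumes t: "t \<in> T"
  shows "\<exists>s\<in>U \<inter> R. s \<otimes> t \<in> R"
proof -
  obtain a b where ab: "a \<in> D" "b \<in> D" "b \<noteq> \<zero>\<^bsub>k\<^esub>" "\<phi> t = a \<otimes>\<^bsub>k\<^esub> inv\<^bsub>k\<^esub> b"
    using D.fractions[of "\<phi> t"] t by auto
  obtain u d d' where u: "u \<in> U" "d \<in> D" "d' \<in> D" "d \<otimes>\<^bsub>k\<^esub> d' = \<one>\<^bsub>k\<^esub>" "\<phi> u = d' \<otimes>\<^bsub>k\<^esub> b"
    using units_lift[of b] ab D.A_closed(1)[OF ab(2)] by metis
  have uT: "u \<in> T"
    using unitD u by blast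
  have "b \<otimes>\<^bsub>k\<^esub> \<phi> t = a"
    using ab D.m_lcomm[of b a "inv\<^bsub>k\<^esub> b"] D.inv_simps[of b] by simp
  moreover have "\<phi> (u \<otimes> t) = d' \<otimes>\<^bsub>k\<^esub> (b \<otimes>\<^bsub>k\<^esub> \<phi> t)"
    using u uT t ab(2) phi_closed[OF t] by (simp add: D.m_assoc)
  ultimately have "\<phi> (u \<otimes> t) = d' \<otimes>\<^bsub>k\<^esub> a"
    by simp
  then have "u \<otimes> t \<in> R"
    using u uT t ab by (intro preI) auto
  moreover have "u \<in> R"
    using u uT ab by (intro preI) auto
  ultimately show ?thesis
    using u by blast
qed

text \<open>A summand e t inherits the denominator of t, and sums are handled by multiplying
  denominators. Together with \<open>inv_U_mult_ext\<close> this describes E T as the set of x with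
  s x in E for some s in U \<inter> R.\<close>

lemma denom_ext:
  assumes E: "E \<in> frac_ideals K R" and y: "y \<in> ideal_prod K E T"
  shows "\<exists>s\<in>U \<inter> R. s \<otimes> y \<in> E"
  using y
proof induction
  case (prod e t)
  then obtain s where s: "s \<in> U" "s \<in> R" "s \<otimes> t \<in> R"
    using denom_T by blast
  have "s \<otimes> (e \<otimes> t) = (s \<otimes> t) \<otimes> e"
    using s prod R.frac_idealsD(2)[OF E] by (simp add: m_ac)
  also have "\<dots> \<in> E"
    using s prod R.frac_idealsD(5)[OF E] by blast
  finally show ?case
    using s by blast
next
  case (sum y z)
  then obtain s s' where s: "s \<in> U" "s \<in> R" "s \<otimes> y \<in> E" "s' \<in> U" "s' \<in> R" "s' \<otimes> z \<in> E"
    by blast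
  have yz: "y \<in> carrier K" "z \<in> carrier K"
    using sum ideal_prod_closed[of E T] R.frac_idealsD(1)[OF E] by auto
  have "(s \<otimes> s') \<otimes> (y \<oplus> z) = s' \<otimes> (s \<otimes> y) \<oplus> s \<otimes> (s' \<otimes> z)"
    using s yz by (simp add: r_distr m_ac)
  also have "\<dots> \<in> E"
    using s R.frac_idealsD(4,5)[OF E] by auto
  finally show ?case
    using s unit_mult by (intro bexI[of _ "s \<otimes> s'"]) auto
qed

lemma common_denom:
  assumes "finite W" and E: "E \<in> frac_ideals K R" and "W \<subseteq> carrier K"
    and "\<And>x. x \<in> W \<Longrightarrow> \<exists>s\<in>U \<inter> R. s \<otimes> x \<in> E"
  shows "\<exists>s\<in>U \<inter> R. \<forall>x\<in>W. s \<otimes> x \<in> E"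
  using assms(1,3-)
proof induction
  case empty
  have "\<one> \<in> U \<inter> R"
    using unitI[of \<one> \<one>] by auto
  then show ?case
    by blast
next
  case (insert x W)
  then obtain s s' where s: "s \<in> U" "s \<in> R" "\<forall>x\<in>W. s \<otimes> x \<in> E" "s' \<in> U" "s' \<in> R" "s' \<otimes> x \<in> E"
    by (metis IntE insertCI insert_subset)
  have "(s \<otimes> s') \<otimes> y \<in> E" if y: "y \<in> insert x W" for y
  proof -
    have "y \<in> carrier K"
      using insert.prems y by auto
    then have "(s \<otimes> s') \<otimes> y = s \<otimes> (s' \<otimes> y)" "(s \<otimes> s') \<otimes> y = s' \<otimes> (s \<otimes> y)"
      using s by (simp_all add: m_ac)
    then show ?thesis
      using y s R.frac_idealsD(5)[OF E] by (metis insertE)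
  qed
  then show ?case
    using s unit_mult by (intro bexI[of _ "s \<otimes> s'"]) auto
qed

text \<open>A nonzero m in M satisfies m T \<subseteq> M \<subseteq> R, so it turns a denominator d
  over \<open>T\<close> into a denominator m d over \<open>R\<close>. This allows
  \<open>star\<close> to be applied to ideals of \<open>T\<close>.\<close>

lemma frac_T_R:
  assumes E: "E \<in> frac_ideals K T"
  shows "E \<in> frac_ideals K R"
proof -
  obtain d where d: "d \<in> T" "d \<noteq> \<zero>" "\<And>x. x \<in> E \<Longrightarrow> d \<otimes> x \<in> T"
    using frac_ideals_denom[OF E] by blast
  obtain e where e: "e \<in> E" "e \<noteq> \<zero>" "e \<in> carrier K"
    using frac_ideals_nonzero[OF E] by blast
  obtain m where m: "m \<in> T" "m \<noteq> \<zero>" "\<phi> m = \<zero>\<^bsub>k\<^esub>"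
    using phi_kernel by blast
  show ?thesis
  proof (rule R.frac_idealsI[of _ e "m \<otimes> d"])
    fix x assume x: "x \<in> E"
    then have "m \<otimes> d \<otimes> x = m \<otimes> (d \<otimes> x)"
      using m d(1) frac_idealsD(2)[OF E] by (simp add: m_assoc)
    moreover have "m \<otimes> (d \<otimes> x) \<in> R"
      using m d(3)[OF x] by (intro kernel_R) auto
    ultimately show "m \<otimes> d \<otimes> x \<in> R"
      by simp
  qed (use m d e frac_idealsD[OF E] R_T in \<open>auto simp: integral_iff intro!: kernel_R\<close>)
qed

lemma R_frac_T: "T \<in> frac_ideals K R"
  by (rule frac_T_R[OF A_frac])

lemma ext_frac:
  assumes E: "E \<in> frac_ideals K R"
  shows "ideal_prod K E T \<in> frac_ideals K T" "E \<subseteq> ideal_prod K E T"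
proof -
  note [simp] = R.frac_idealsD(2)[OF E]
  have sub: "ideal_prod K E T \<subseteq> carrier K"
    by (intro ideal_prod_closed) auto
  show E_sub: "E \<subseteq> ideal_prod K E T"
  proof
    fix e assume "e \<in> E"
    then have "e \<otimes> \<one> \<in> ideal_prod K E T"
      by (intro ideal_prod.prod) auto
    then show "e \<in> ideal_prod K E T"
      using \<open>e \<in> E\<close> by simp
  qed
  obtain d where d: "d \<in> R" "d \<noteq> \<zero>" "\<And>x. x \<in> E \<Longrightarrow> d \<otimes> x \<in> R"
    using R.frac_ideals_denom[OF E] by blast
  obtain e where e: "e \<in> E" "e \<noteq> \<zero>"
    using R.frac_ideals_nonzero[OF E] by blast
  show "ideal_prod K E T \<in> frac_ideals K T"
  proof (rule frac_idealsI[of _ e d])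
    fix a x assume a: "a \<in> T" and x: "x \<in> ideal_prod K E T"
    from x show "a \<otimes> x \<in> ideal_prod K E T"
    proof induction
      case (prod y z)
      then have "a \<otimes> (y \<otimes> z) = y \<otimes> (a \<otimes> z)"
        using a by (simp add: m_lcomm)
      then show ?case
        using prod a by (auto intro: ideal_prod.prod)
    next
      case (sum y z)
      then show ?case
        using a sub by (auto simp: r_distr subset_iff intro: ideal_prod.sum)
    qed
  next
    fix x assume x: "x \<in> ideal_prod K E T"
    from x show "d \<otimes> x \<in> T"
    proof induction
      case (prod y z)
      then have "d \<otimes> (y \<otimes> z) = (d \<otimes> y) \<otimes> z" "d \<otimes> y \<in> T"
        using d R_T by (auto simp: m_assoc)
      then show ?case
        using prod by auto
    next
      case (sum y z)
      then show ?case
        using d(1) R_T sub by (auto simp: r_distr subset_iff)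
    qed
  qed (use sub e d R_T E_sub in \<open>auto intro: ideal_prod.sum\<close>)
qed

text \<open>The elements \<open>e\<close> and \<open>s\<close> generate the unit ideal of \<open>R\<close>: as \<open>1 - e \<in> M = sM\<close>, we have
  \<open>1 = e + s n\<close> for some \<open>n \<in> M\<close>.\<close>

lemma comaximal_mem:
  assumes E: "E \<in> frac_ideals K R" and m: "m \<in> carrier K"
    and e: "e \<in> R" "\<phi> e = \<one>\<^bsub>k\<^esub>" "e \<otimes> m \<in> E" and s: "s \<in> U" "s \<in> R" "s \<otimes> m \<in> E"
  shows "m \<in> E"
proof -
  define n where "n = inv s \<otimes> (\<one> \<ominus> e)"
  note c = unitD[OF s(1)] R_T[OF e(1)]
  have n: "n \<in> R" "n \<in> carrier K"
  proof -
    have "\<phi> (\<one> \<ominus> e) = \<zero>\<^bsub>k\<^esub>"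
      using c e by (simp add: a_minus_def D.r_neg)
    moreover have "\<one> \<ominus> e \<in> T"
      using c by (simp add: a_minus_def)
    ultimately show "n \<in> R" "n \<in> carrier K"
      unfolding n_def using c by (auto intro!: kernel_R)
  qed
  have "n \<otimes> s = \<one> \<ominus> e"
    using c unfolding n_def by (simp add: m_ac inv_simps a_minus_def)
  then have "e \<oplus> n \<otimes> s = \<one>"
    using c by (simp add: add_minus_cancel)
  then have "m = (e \<oplus> n \<otimes> s) \<otimes> m"
    using m by simp
  also have "\<dots> = e \<otimes> m \<oplus> n \<otimes> (s \<otimes> m)"
    using m c n by (simp add: l_distr m_assoc)
  also have "\<dots> \<in> E"
    using R.frac_idealsD(4,5)[OF E] e s n by auto
  finally show ?thesis .
qed

text \<open>Both multipliers of \<open>comaximal_mem\<close> are available: e y lies in E because y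
  is in \<open>R\<close>, and s y lies in E for a denominator s because y is in E T.\<close>

lemma contract_ext:
  assumes E: "E \<in> frac_ideals K R" and e: "e \<in> E" "e \<in> R" "\<phi> e = \<one>\<^bsub>k\<^esub>"
    and y: "y \<in> ideal_prod K E T" "y \<in> R"
  shows "y \<in> E"
proof -
  obtain s where s: "s \<in> U" "s \<in> R" "s \<otimes> y \<in> E"
    using denom_ext[OF E y(1)] by blast
  have "e \<otimes> y \<in> E"
    using R.frac_idealsD(5)[OF E y(2) e(1)] e y by (simp add: m_comm)
  then show ?thesis
    using comaximal_mem[OF E _ e(2,3) _ s] y by auto
qed


subsection \<open>Inverse images of ideals of the residue ring\<close>

text \<open>The fractional ideals of \<open>R\<close> that are inverse images of fractional ideals of \<open>D\<close>.\<close>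

definition sandwiched :: "'a set \<Rightarrow> bool" where
  "sandwiched E \<longleftrightarrow> E \<in> frac_ideals K R \<and> (\<exists>u\<in>U. u \<in> E) \<and> (\<exists>w\<in>U. \<forall>x\<in>E. w \<otimes> x \<in> R)"

text \<open>From w E \<subseteq> R one gets E \<subseteq> T, as w is a unit of \<open>T\<close>.
  From u in E one gets M = (M u^-1) u \<subseteq> R u \<subseteq> E. So E lies between M and
  \<open>T\<close>.\<close>

lemma sandwichedD:
  assumes "sandwiched E"
  shows "E \<in> frac_ideals K R" "E \<subseteq> T" "x \<in> E \<Longrightarrow> x \<in> T" "x \<in> T \<Longrightarrow> \<phi> x = \<zero>\<^bsub>k\<^esub> \<Longrightarrow> x \<in> E"
proof -
  show E: "E \<in> frac_ideals K R"
    using assms by (simp add: sandwiched_def)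
  obtain u w where u: "u \<in> U" "u \<in> E" and w: "w \<in> U" "\<And>x. x \<in> E \<Longrightarrow> w \<otimes> x \<in> R"
    using assms unfolding sandwiched_def by blast
  have *: "x \<in> T" if "x \<in> E" for x
  proof -
    have "x = inv w \<otimes> (w \<otimes> x)"
      using R.frac_idealsD(2)[OF E that] unitD[OF w(1)] by (simp add: inv_simps)
    moreover have "inv w \<otimes> (w \<otimes> x) \<in> T"
      using unitD[OF w(1)] R_T[OF w(2)[OF that]] by simp
    ultimately show ?thesis
      by simp
  qed
  then show "E \<subseteq> T" "x \<in> E \<Longrightarrow> x \<in> T"
    by auto
  assume x: "x \<in> T" "\<phi> x = \<zero>\<^bsub>k\<^esub>"
  have "x \<otimes> inv u \<in> R"
    using x unitD[OF u(1)] by (intro kernel_R) auto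
  then have "x \<otimes> inv u \<otimes> u \<in> E"
    using R.frac_idealsD(5)[OF E] u by blast
  then show "x \<in> E"
    using x unitD[OF u(1)] by (simp add: m_assoc)
qed

text \<open>E contains the kernel M, so it is a union of cosets of M and is recovered from its
  residues.\<close>

lemma pre_image:
  assumes "sandwiched E"
  shows "pre (\<phi> ` E) = E"
proof
  note E = sandwichedD[OF assms]
  show "E \<subseteq> pre (\<phi> ` E)"
    using E by (auto intro: preI)
  show "pre (\<phi> ` E) \<subseteq> E"
  proof
    fix x assume "x \<in> pre (\<phi> ` E)"
    then obtain e where e: "e \<in> E" "x \<in> T" "\<phi> x = \<phi> e"
      by (auto simp: pre_def)
    have eT: "e \<in> T"
      using E(3) e by blast
    have "x \<ominus> e \<in> E"
      using e eT by (intro E(4)) (auto simp: a_minus_def D.r_neg)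
    then have "e \<oplus> (x \<ominus> e) \<in> E"
      using e R.frac_idealsD(4)[OF E(1)] by blast
    then show "x \<in> E"
      using e eT by (simp add: add_minus_cancel)
  qed
qed

lemma image_pre: "F \<subseteq> carrier k \<Longrightarrow> \<phi> ` pre F = F"
  using phi_surj unfolding pre_def by blast

lemma image_frac:
  assumes "sandwiched E"
  shows "\<phi> ` E \<in> frac_ideals k D"
proof -
  note E = sandwichedD[OF assms]
  obtain u w where u: "u \<in> U" "u \<in> E" and w: "w \<in> U" "\<And>x. x \<in> E \<Longrightarrow> w \<otimes> x \<in> R"
    using assms unfolding sandwiched_def by blast
  obtain a b where ab: "a \<in> D" "b \<in> D" "b \<noteq> \<zero>\<^bsub>k\<^esub>" "\<phi> w = a \<otimes>\<^bsub>k\<^esub> inv\<^bsub>k\<^esub> b"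
    using D.fractions[of "\<phi> w"] unitD(1)[OF w(1)] by auto
  \<comment> \<open>The denominator of the image comes from w: if \<phi>(w) = a/b, then a \<phi>(e)
    = b \<phi>(w e), which lies in \<open>D\<close>.\<close>
  have a: "a = b \<otimes>\<^bsub>k\<^esub> \<phi> w"
    using ab D.m_lcomm[of b a "inv\<^bsub>k\<^esub> b"] D.inv_simps[of b] by simp
  show ?thesis
  proof (rule D.frac_idealsI[of _ "\<phi> u" a])
    show "\<phi> ` E \<subseteq> carrier k"
      using E by auto
    fix x y assume "x \<in> \<phi> ` E" "y \<in> \<phi> ` E"
    then obtain x' y' where xy: "x' \<in> E" "y' \<in> E" "x = \<phi> x'" "y = \<phi> y'"
      by auto
    then have "x \<oplus>\<^bsub>k\<^esub> y = \<phi> (x' \<oplus> y')"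
      using E(3) by simp
    then show "x \<oplus>\<^bsub>k\<^esub> y \<in> \<phi> ` E"
      using R.frac_idealsD(4)[OF E(1)] xy by blast
  next
    fix d x assume "d \<in> D" "x \<in> \<phi> ` E"
    then obtain r e where re: "r \<in> T" "d = \<phi> r" "x = \<phi> e" "e \<in> E"
      using phi_surj[of d] by auto
    then have "r \<in> R" "d \<otimes>\<^bsub>k\<^esub> x = \<phi> (r \<otimes> e)"
      using \<open>d \<in> D\<close> E(3) by (auto intro: preI)
    then show "d \<otimes>\<^bsub>k\<^esub> x \<in> \<phi> ` E"
      using re R.frac_idealsD(5)[OF E(1)] by blast
  next
    show "\<phi> u \<in> \<phi> ` E" "\<phi> u \<noteq> \<zero>\<^bsub>k\<^esub>"
      using u unitD by auto
    show "a \<in> D"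
      by (rule ab(1))
    show "a \<noteq> \<zero>\<^bsub>k\<^esub>"
      unfolding a using ab(2,3) unitD[OF w(1)] by (simp add: D.integral_iff)
    fix x assume "x \<in> \<phi> ` E"
    then obtain e where e: "e \<in> E" "x = \<phi> e"
      by auto
    have "a \<otimes>\<^bsub>k\<^esub> x = b \<otimes>\<^bsub>k\<^esub> \<phi> (w \<otimes> e)"
      using e a ab(2) unitD[OF w(1)] E(3) by (simp add: D.m_assoc)
    then show "a \<otimes>\<^bsub>k\<^esub> x \<in> D"
      using preD(2)[OF w(2)[OF e(1)]] ab by simp
  qed
qed

lemma pre_sandwiched:
  assumes F: "F \<in> frac_ideals k D"
  shows "sandwiched (pre F)"
proof -
  note [simp] = D.frac_idealsD(2)[OF F]
  obtain f where f: "f \<in> F" "f \<noteq> \<zero>\<^bsub>k\<^esub>" "f \<in> carrier k"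
    using D.frac_ideals_nonzero[OF F] by blast
  \<comment> \<open>A nonzero element of F is changed by a factor from \<open>D\<close> into the
    residue of a unit of \<open>T\<close>; it stays in F. The denominator c of F below is treated in
    the same way and gives w.\<close>
  obtain u d where u: "u \<in> U" "d \<in> D" "\<phi> u = d \<otimes>\<^bsub>k\<^esub> f"
    using units_lift[OF f(3,2)] by metis
  have uF: "u \<in> pre F"
    using u f unitD(1)[OF u(1)] D.frac_idealsD(5)[OF F] by (intro preI) auto
  obtain c where c: "c \<in> D" "c \<noteq> \<zero>\<^bsub>k\<^esub>" "\<And>x. x \<in> F \<Longrightarrow> c \<otimes>\<^bsub>k\<^esub> x \<in> D"
    using D.frac_ideals_denom[OF F] by blast
  obtain w d' where w: "w \<in> U" "d' \<in> D" "\<phi> w = d' \<otimes>\<^bsub>k\<^esub> c"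
    using units_lift[of c] c by (metis D.A_closed(1))
  have wF: "w \<otimes> x \<in> R" if "x \<in> pre F" for x
  proof (rule preI)
    have x: "x \<in> T" "\<phi> x \<in> F"
      using that by (auto simp: pre_def)
    then have "\<phi> (w \<otimes> x) = d' \<otimes>\<^bsub>k\<^esub> (c \<otimes>\<^bsub>k\<^esub> \<phi> x)"
      using w unitD(1)[OF w(1)] c by (simp add: D.m_assoc)
    then show "\<phi> (w \<otimes> x) \<in> D"
      using c(3)[OF x(2)] w by simp
    show "w \<otimes> x \<in> T"
      using x unitD(1)[OF w(1)] by simp
  qed
  obtain s where s: "s \<in> U" "s \<in> R" "s \<otimes> w \<in> R"
    using denom_T unitD(1)[OF w(1)] by blast
  have "pre F \<in> frac_ideals K R"
  proof (rule R.frac_idealsI[of _ u "s \<otimes> w"])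
    show "s \<otimes> w \<noteq> \<zero>"
      using s w unitD by (simp add: integral_iff)
    fix x assume "x \<in> pre F"
    then show "s \<otimes> w \<otimes> x \<in> R"
      using wF[of x] s w unitD by (simp add: m_assoc pre_def)
  qed (use uF unitD[OF u(1)] s D.frac_idealsD(4,5)[OF F] in \<open>auto simp: pre_def\<close>)
  then show ?thesis
    unfolding sandwiched_def using u uF w wF by blast
qed

lemma sandwiched_prod:
  assumes "sandwiched E" "sandwiched F"
  shows "sandwiched (ideal_prod K E F)" "\<phi> ` ideal_prod K E F = ideal_prod k (\<phi> ` E) (\<phi> ` F)"
proof -
  note E = sandwichedD[OF assms(1)] and F = sandwichedD[OF assms(2)]
  obtain u w where u: "u \<in> U" "u \<in> E" and w: "w \<in> U" "\<And>x. x \<in> E \<Longrightarrow> w \<otimes> x \<in> R"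
    using assms(1) unfolding sandwiched_def by blast
  obtain u' w' where u': "u' \<in> U" "u' \<in> F" and w': "w' \<in> U" "\<And>x. x \<in> F \<Longrightarrow> w' \<otimes> x \<in> R"
    using assms(2) unfolding sandwiched_def by blast
  have "w \<otimes> w' \<otimes> z \<in> R" if "z \<in> ideal_prod K E F" for z
    using that
  proof induction
    case (prod e f)
    then have "w \<otimes> w' \<otimes> (e \<otimes> f) = (w \<otimes> e) \<otimes> (w' \<otimes> f)"
      using E(3) F(3) unitD[OF w(1)] unitD[OF w'(1)] by (simp add: m_ac)
    then show ?case
      using prod w(2) w'(2) by simp
  next
    case (sum y z)
    moreover have "y \<in> carrier K" "z \<in> carrier K"
      using sum ideal_prod_closed[of E F] E(2) F(2) T.A_closed(7) by blast+
    ultimately show ?case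
      using unitD[OF w(1)] unitD[OF w'(1)] by (simp add: r_distr)
  qed
  then show "sandwiched (ideal_prod K E F)"
    unfolding sandwiched_def using R.prod_frac[OF E(1) F(1)] unit_mult[OF u(1) u'(1)] unit_mult[OF w(1) w'(1)]
      ideal_prod.prod[OF u(2) u'(2), of K] by blast
  then have T: "ideal_prod K E F \<subseteq> T"
    by (rule sandwichedD)
  show "\<phi> ` ideal_prod K E F = ideal_prod k (\<phi> ` E) (\<phi> ` F)"
  proof
    have "\<phi> z \<in> ideal_prod k (\<phi> ` E) (\<phi> ` F)" if "z \<in> ideal_prod K E F" for z
      using that
    proof induction
      case (prod e f)
      then show ?case
        using E(3) F(3) by (auto intro!: ideal_prod.prod)
    next
      case (sum y z)
      then show ?case
        using T by (auto simp: subset_iff intro: ideal_prod.sum)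
    qed
    then show "\<phi> ` ideal_prod K E F \<subseteq> ideal_prod k (\<phi> ` E) (\<phi> ` F)"
      by blast
    show "ideal_prod k (\<phi> ` E) (\<phi> ` F) \<subseteq> \<phi> ` ideal_prod K E F"
    proof (rule ideal_prod_least)
      fix x y assume "x \<in> \<phi> ` ideal_prod K E F" "y \<in> \<phi> ` ideal_prod K E F"
      then obtain x' y' where xy: "x' \<in> ideal_prod K E F" "y' \<in> ideal_prod K E F" "x = \<phi> x'" "y = \<phi> y'"
        by auto
      then have "x \<oplus>\<^bsub>k\<^esub> y = \<phi> (x' \<oplus> y')"
        using T by (simp add: subset_iff)
      then show "x \<oplus>\<^bsub>k\<^esub> y \<in> \<phi> ` ideal_prod K E F"
        by (rule image_eqI) (rule ideal_prod.sum[OF xy(1,2)])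
    next
      fix x y assume "x \<in> \<phi> ` E" "y \<in> \<phi> ` F"
      then obtain x' y' where xy: "x' \<in> E" "y' \<in> F" "x = \<phi> x'" "y = \<phi> y'"
        by auto
      then have "x \<otimes>\<^bsub>k\<^esub> y = \<phi> (x' \<otimes> y')"
        using E(3) F(3) by simp
      then show "x \<otimes>\<^bsub>k\<^esub> y \<in> \<phi> ` ideal_prod K E F"
        using ideal_prod.prod[OF xy(1,2)] by blast
    qed
  qed
qed

text \<open>The units u and w exchange their roles: w lies in the colon ideal, and u multiplies the
  colon ideal into \<open>R\<close>.\<close>

lemma sandwiched_colon:
  assumes "sandwiched E"
  shows "sandwiched (colon K R E)" "\<phi> ` colon K R E = colon k D (\<phi> ` E)"
proof -
  note E = sandwichedD[OF assms]
  obtain u w where u: "u \<in> U" "u \<in> E" and w: "w \<in> U" "\<And>x. x \<in> E \<Longrightarrow> w \<otimes> x \<in> R"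
    using assms unfolding sandwiched_def by blast
  have uc: "u \<otimes> x \<in> R" if "x \<in> colon K R E" for x
    using that u unitD(3)[OF u(1)] by (auto simp: colon_def m_comm)
  moreover have "w \<in> colon K R E"
    using w unitD by (simp add: colon_def)
  ultimately show g: "sandwiched (colon K R E)"
    unfolding sandwiched_def using R.colon_frac[OF E(1)] u(1) w(1) by blast
  show "\<phi> ` colon K R E = colon k D (\<phi> ` E)"
  proof
    show "\<phi> ` colon K R E \<subseteq> colon k D (\<phi> ` E)"
    proof (clarsimp simp: colon_def[of k])
      fix x assume x: "x \<in> colon K R E"
      then have xT: "x \<in> T"
        using sandwichedD(3)[OF g] by blast
      have "\<phi> x \<otimes>\<^bsub>k\<^esub> \<phi> e \<in> D" if "e \<in> E" for e
        using x xT E(3)[OF that] that preD(2)[of "x \<otimes> e" D] by (simp add: colon_def)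
      with xT show "\<phi> x \<in> carrier k \<and> (\<forall>e\<in>E. \<phi> x \<otimes>\<^bsub>k\<^esub> \<phi> e \<in> D)"
        by simp
    qed
    show "colon k D (\<phi> ` E) \<subseteq> \<phi> ` colon K R E"
    proof
      fix y assume y: "y \<in> colon k D (\<phi> ` E)"
      then obtain x where x: "x \<in> T" "\<phi> x = y"
        using phi_surj by (auto simp: colon_def)
      have "x \<otimes> e \<in> R" if "e \<in> E" for e
        using x y E(3)[OF that] that by (intro preI) (auto simp: colon_def)
      with x show "y \<in> \<phi> ` colon K R E"
        by (auto simp: colon_def)
    qed
  qed
qed

lemma sandwiched_R: "sandwiched R"
  by (rule pre_sandwiched[OF D.A_frac])

lemma phi_R: "\<phi> ` R = D"
  using image_pre[of D] by simp

lemma image_eq_iff: "sandwiched E \<Longrightarrow> sandwiched F \<Longrightarrow> \<phi> ` E = \<phi> ` F \<longleftrightarrow> E = F"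
  using pre_image by metis

lemma image_l_coset:
  assumes "E \<subseteq> T" "x \<in> T"
  shows "\<phi> ` (x <#\<^bsub>K\<^esub> E) = \<phi> x <#\<^bsub>k\<^esub> \<phi> ` E"
  using assms by (force simp: l_coset_iff image_iff subset_iff)

lemma pre_l_coset:
  assumes u: "u \<in> U" and F: "F \<subseteq> carrier k"
  shows "pre (\<phi> u <#\<^bsub>k\<^esub> F) = u <#\<^bsub>K\<^esub> pre F"
proof
  note u' = unitD[OF u]
  show "pre (\<phi> u <#\<^bsub>k\<^esub> F) \<subseteq> u <#\<^bsub>K\<^esub> pre F"
  proof
    fix x assume "x \<in> pre (\<phi> u <#\<^bsub>k\<^esub> F)"
    then obtain f where f: "x \<in> T" "f \<in> F" "\<phi> x = \<phi> u \<otimes>\<^bsub>k\<^esub> f"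
      by (auto simp: pre_def l_coset_iff)
    then have "\<phi> (inv u \<otimes> x) = f"
      using u' F D.inv_simps[of "\<phi> u"] by (simp add: subset_iff)
    then have "inv u \<otimes> x \<in> pre F" "x = u \<otimes> (inv u \<otimes> x)"
      using u' f by (auto intro: preI simp: inv_simps)
    then show "x \<in> u <#\<^bsub>K\<^esub> pre F"
      by (auto simp: l_coset_iff)
  qed
  show "u <#\<^bsub>K\<^esub> pre F \<subseteq> pre (\<phi> u <#\<^bsub>k\<^esub> F)"
    using u' by (fastforce simp: pre_def l_coset_iff)
qed

lemma l_coset_unit:
  assumes F: "F \<in> frac_ideals k D" and d: "d \<in> D" "d' \<in> D" "d \<otimes>\<^bsub>k\<^esub> d' = \<one>\<^bsub>k\<^esub>"
    and y: "y \<in> carrier k"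
  shows "(d \<otimes>\<^bsub>k\<^esub> y) <#\<^bsub>k\<^esub> F = y <#\<^bsub>k\<^esub> F"
proof
  note [simp] = D.frac_idealsD(2)[OF F]
  show "(d \<otimes>\<^bsub>k\<^esub> y) <#\<^bsub>k\<^esub> F \<subseteq> y <#\<^bsub>k\<^esub> F"
  proof
    fix x assume "x \<in> (d \<otimes>\<^bsub>k\<^esub> y) <#\<^bsub>k\<^esub> F"
    then obtain f where "f \<in> F" "x = y \<otimes>\<^bsub>k\<^esub> (d \<otimes>\<^bsub>k\<^esub> f)"
      using d y by (auto simp: l_coset_iff D.m_ac)
    then show "x \<in> y <#\<^bsub>k\<^esub> F"
      using D.frac_idealsD(5)[OF F d(1)] by (auto simp: l_coset_iff)
  qed
  show "y <#\<^bsub>k\<^esub> F \<subseteq> (d \<otimes>\<^bsub>k\<^esub> y) <#\<^bsub>k\<^esub> F"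
  proof
    fix x assume "x \<in> y <#\<^bsub>k\<^esub> F"
    then obtain f where f: "f \<in> F" "x = y \<otimes>\<^bsub>k\<^esub> f"
      by (auto simp: l_coset_iff)
    have "(d \<otimes>\<^bsub>k\<^esub> y) \<otimes>\<^bsub>k\<^esub> (d' \<otimes>\<^bsub>k\<^esub> f) = (d \<otimes>\<^bsub>k\<^esub> d') \<otimes>\<^bsub>k\<^esub> (y \<otimes>\<^bsub>k\<^esub> f)"
      using d(1,2) y f by (simp add: D.m_ac)
    then have "x = (d \<otimes>\<^bsub>k\<^esub> y) \<otimes>\<^bsub>k\<^esub> (d' \<otimes>\<^bsub>k\<^esub> f)"
      using d y f by simp
    then show "x \<in> (d \<otimes>\<^bsub>k\<^esub> y) <#\<^bsub>k\<^esub> F"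
      using D.frac_idealsD(5)[OF F d(2) f(1)] by (auto simp: l_coset_iff)
  qed
qed

end

section \<open>Star operations on the pullback\<close>

lemma Collect_image_const:
  assumes "\<exists>y. P y" "\<And>y. P y \<Longrightarrow> g y = c"
  shows "{g y | y. P y} = {c}"
  using assms by auto

locale pullback_star = pullback +
  fixes star
  assumes star_operation_R: "star_operation K R star"
    and finite_type_R: "finite_type K R star"
begin

sublocale R: star_domain K R star
  by unfold_locales (rule star_operation_R)

subsection \<open>The induced star operation on the residue ring\<close>

definition proj :: "'c set \<Rightarrow> 'c set" where
  "proj F = \<Inter>{y <#\<^bsub>k\<^esub> \<phi> ` star (pre (inv\<^bsub>k\<^esub> y <#\<^bsub>k\<^esub> F)) | y.
    y \<in> carrier k \<and> F \<subseteq> y <#\<^bsub>k\<^esub> D}"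

text \<open>The same units work for the closure: w E \<subseteq> R survives because \<open>R\<close>
  is closed, and u stays in the larger set.\<close>

lemma sandwiched_star:
  assumes "sandwiched E"
  shows "sandwiched (star E)"
proof -
  note E = sandwichedD(1)[OF assms]
  obtain u w where u: "u \<in> U" "u \<in> E" and w: "w \<in> U" "\<And>x. x \<in> E \<Longrightarrow> w \<otimes> x \<in> R"
    using assms unfolding sandwiched_def by blast
  have "w \<otimes> x \<in> R" if "x \<in> star E" for x
    using R.star_mult_le[OF E R.A_frac unitD(3)[OF w(1)] w(2) that] by (simp add: R.star_A)
  moreover have "u \<in> star E"
    using R.star_ext[OF E] u by blast
  ultimately show ?thesis
    unfolding sandwiched_def using R.star_frac[OF E] u(1) w(1) by blast
qed

text \<open>All members of the intersection coincide. For y = d \<phi>(u) the unit d of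
  \<open>D\<close> acts trivially on fractional ideals, so the preimage of y^-1 \<phi>(E) is u^-1 E.
  Its closure is u^-1 (\<open>star E\<close>), and multiplication by y undoes the scaling.\<close>

lemma proj_image:
  assumes "sandwiched E"
  shows "proj (\<phi> ` E) = \<phi> ` star E"
proof -
  note E = sandwichedD(1)[OF assms]
  let ?F = "\<phi> ` E"
  have F: "?F \<in> frac_ideals k D" and G: "\<phi> ` star E \<in> frac_ideals k D"
    using image_frac assms sandwiched_star by auto
  have *: "y <#\<^bsub>k\<^esub> \<phi> ` star (pre (inv\<^bsub>k\<^esub> y <#\<^bsub>k\<^esub> ?F)) = \<phi> ` star E"
    if y: "y \<in> carrier k" "y \<noteq> \<zero>\<^bsub>k\<^esub>" for y
  proof -
    obtain u d d' where u: "u \<in> U" "d \<in> D" "d' \<in> D" "d \<otimes>\<^bsub>k\<^esub> d' = \<one>\<^bsub>k\<^esub>" "d' \<otimes>\<^bsub>k\<^esub> d = \<one>\<^bsub>k\<^esub>"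
      "y = d \<otimes>\<^bsub>k\<^esub> \<phi> u"
      using units_lift[OF y] by metis
    note u' = unitD[OF u(1)]
    have "y \<otimes>\<^bsub>k\<^esub> (d' \<otimes>\<^bsub>k\<^esub> inv\<^bsub>k\<^esub> \<phi> u) = (d \<otimes>\<^bsub>k\<^esub> d') \<otimes>\<^bsub>k\<^esub> (\<phi> u \<otimes>\<^bsub>k\<^esub> inv\<^bsub>k\<^esub> \<phi> u)"
      unfolding u(6) using u(2,3) u' phi_closed[OF u'(1)] by (simp add: D.m_ac)
    also have "\<dots> = \<one>\<^bsub>k\<^esub>"
      using u u' D.inv_simps(3)[of "\<phi> u"] by simp
    finally have inv_y: "inv\<^bsub>k\<^esub> y = d' \<otimes>\<^bsub>k\<^esub> inv\<^bsub>k\<^esub> \<phi> u"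
      using y u(3) u' by (intro D.comm_inv_char) auto
    have "inv\<^bsub>k\<^esub> y <#\<^bsub>k\<^esub> ?F = \<phi> (inv u) <#\<^bsub>k\<^esub> ?F"
      unfolding inv_y u'(9) by (rule l_coset_unit[OF F u(3,2,5) u'(10)])
    then have "pre (inv\<^bsub>k\<^esub> y <#\<^bsub>k\<^esub> ?F) = inv u <#\<^bsub>K\<^esub> E"
      using pre_l_coset[OF u'(5) D.frac_idealsD(1)[OF F]] pre_image[OF assms] by simp
    then have "star (pre (inv\<^bsub>k\<^esub> y <#\<^bsub>k\<^esub> ?F)) = inv u <#\<^bsub>K\<^esub> star E"
      using R.star_l_coset[OF _ _ E] unitD(3,4)[OF u'(5)] by simp
    then have "\<phi> ` star (pre (inv\<^bsub>k\<^esub> y <#\<^bsub>k\<^esub> ?F)) = \<phi> (inv u) <#\<^bsub>k\<^esub> \<phi> ` star E"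
      using image_l_coset[OF sandwichedD(2)[OF sandwiched_star[OF assms]] u'(2)] by simp
    then have "y <#\<^bsub>k\<^esub> \<phi> ` star (pre (inv\<^bsub>k\<^esub> y <#\<^bsub>k\<^esub> ?F))
        = (d \<otimes>\<^bsub>k\<^esub> \<phi> u) <#\<^bsub>k\<^esub> (\<phi> (inv u) <#\<^bsub>k\<^esub> \<phi> ` star E)"
      using u by simp
    also have "\<dots> = \<phi> u <#\<^bsub>k\<^esub> (\<phi> (inv u) <#\<^bsub>k\<^esub> \<phi> ` star E)"
      using u' by (intro l_coset_unit[OF D.l_coset_frac[OF _ _ G] u(2,3,4)] phi_closed)
        (auto simp: unitD(8)[OF u'(5)] simp del: u'(9))
    also have "\<dots> = (\<phi> u \<otimes>\<^bsub>k\<^esub> inv\<^bsub>k\<^esub> \<phi> u) <#\<^bsub>k\<^esub> \<phi> ` star E"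
      using D.l_coset_l_coset[OF _ _ D.frac_idealsD(1)[OF G]] u' by simp
    also have "\<dots> = \<phi> ` star E"
      using D.inv_simps(3)[of "\<phi> u"] u' D.l_coset_one[OF D.frac_idealsD(1)[OF G]] by simp
    finally show ?thesis .
  qed
  \<comment> \<open>The value of \<open>inv\<close> at zero never enters: y = 0 would put \<phi>(E)
    into the zero ideal.\<close>
  have nz: "y \<noteq> \<zero>\<^bsub>k\<^esub>" if "?F \<subseteq> y <#\<^bsub>k\<^esub> D" for y
  proof
    assume "y = \<zero>\<^bsub>k\<^esub>"
    then have "?F \<subseteq> {\<zero>\<^bsub>k\<^esub>}"
      using that by (auto simp: l_coset_iff subset_iff)
    then show False
      using D.frac_ideals_nonzero[OF F] by blast
  qed
  obtain d where d: "d \<in> D" "d \<noteq> \<zero>\<^bsub>k\<^esub>" "\<And>x. x \<in> ?F \<Longrightarrow> d \<otimes>\<^bsub>k\<^esub> x \<in> D"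
    using D.frac_ideals_denom[OF F] by blast
  \<comment> \<open>The inverse of a denominator is an admissible y. The family has to be nonempty,
    since an empty intersection would be the whole type.\<close>
  have "?F \<subseteq> inv\<^bsub>k\<^esub> d <#\<^bsub>k\<^esub> D"
  proof
    fix x assume x: "x \<in> ?F"
    then have "x = inv\<^bsub>k\<^esub> d \<otimes>\<^bsub>k\<^esub> (d \<otimes>\<^bsub>k\<^esub> x)"
      using d(1,2) D.frac_idealsD(2)[OF F x] by (simp add: D.inv_simps)
    with d(3)[OF x] show "x \<in> inv\<^bsub>k\<^esub> d <#\<^bsub>k\<^esub> D"
      unfolding l_coset_iff by blast
  qed
  then have "\<exists>y\<in>carrier k. ?F \<subseteq> y <#\<^bsub>k\<^esub> D"
    using D.inv_simps(1)[of d] d by blast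
  then have "{y <#\<^bsub>k\<^esub> \<phi> ` star (pre (inv\<^bsub>k\<^esub> y <#\<^bsub>k\<^esub> ?F)) | y. y \<in> carrier k \<and> ?F \<subseteq> y <#\<^bsub>k\<^esub> D}
      = {\<phi> ` star E}"
    using * nz by (intro Collect_image_const) auto
  then show ?thesis
    by (simp add: proj_def)
qed

lemma pre_proj:
  assumes "F \<in> frac_ideals k D"
  shows "pre (proj F) = star (pre F)" "proj F \<in> frac_ideals k D"
proof -
  note g = pre_sandwiched[OF assms]
  have "proj F = \<phi> ` star (pre F)"
    using proj_image[OF g] image_pre[OF D.frac_idealsD(1)[OF assms]] by simp
  then show "pre (proj F) = star (pre F)" "proj F \<in> frac_ideals k D"
    using sandwiched_star[OF g] pre_image image_frac by auto
qed

lemma pre_le_iff: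
  assumes "E \<subseteq> carrier k"
  shows "pre E \<subseteq> pre F \<longleftrightarrow> E \<subseteq> F"
proof
  assume "pre E \<subseteq> pre F"
  then have "\<phi> ` pre E \<subseteq> F"
    by (auto simp: pre_def)
  then show "E \<subseteq> F"
    using image_pre[OF assms] by simp
qed (auto simp: pre_def)

lemma pre_eq_iff:
  assumes "E \<subseteq> carrier k" "F \<subseteq> carrier k"
  shows "pre E = pre F \<longleftrightarrow> E = F"
  using image_pre assms by metis

text \<open>One unit u serves all F at once, so F and \<open>proj F\<close> are scaled by the same
  element when homogeneity is verified.\<close>

lemma l_coset_lift:
  assumes y: "y \<in> carrier k" "y \<noteq> \<zero>\<^bsub>k\<^esub>"
  obtains u where "u \<in> U"
    "\<And>F. F \<in> frac_ideals k D \<Longrightarrow> pre (y <#\<^bsub>k\<^esub> F) = u <#\<^bsub>K\<^esub> pre F"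
proof -
  obtain u d d' where u: "u \<in> U" "d \<in> D" "d' \<in> D" "d \<otimes>\<^bsub>k\<^esub> d' = \<one>\<^bsub>k\<^esub>" "y = d \<otimes>\<^bsub>k\<^esub> \<phi> u"
    using units_lift[OF y] by metis
  then have *: "y <#\<^bsub>k\<^esub> F = \<phi> u <#\<^bsub>k\<^esub> F" if "F \<in> frac_ideals k D" for F
    using l_coset_unit[OF that u(2,3,4)] unitD(1)[OF u(1)] by simp
  show thesis
    by (rule that[OF u(1)]) (auto simp: * pre_l_coset[OF u(1)] D.frac_idealsD(1))
qed

text \<open>Each axiom is checked after applying \<open>pre\<close>, which is injective, reflects
  inclusion and turns \<open>proj\<close> into \<open>star\<close>; what remains is the
  corresponding axiom on \<open>R\<close>.\<close>

lemma star_operation_proj: "star_operation k D proj"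
  unfolding star_operation_def
proof (intro conjI ballI impI funcsetI)
  note pI = iffD1[OF pre_eq_iff]
  fix y F assume "y \<in> carrier k - {\<zero>\<^bsub>k\<^esub>}" and F: "F \<in> frac_ideals k D"
  then have y: "y \<in> carrier k" "y \<noteq> \<zero>\<^bsub>k\<^esub>"
    by auto
  obtain u where u: "u \<in> U" "\<And>F. F \<in> frac_ideals k D \<Longrightarrow> pre (y <#\<^bsub>k\<^esub> F) = u <#\<^bsub>K\<^esub> pre F"
    using l_coset_lift[OF y] by metis
  have "pre (proj (y <#\<^bsub>k\<^esub> F)) = pre (y <#\<^bsub>k\<^esub> proj F)"
    using u(2) F pre_proj D.l_coset_frac[OF y F] R.star_l_coset[OF unitD(3,4)[OF u(1)]]
      sandwichedD(1)[OF pre_sandwiched[OF F]] by simp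
  then show "proj (y <#\<^bsub>k\<^esub> F) = y <#\<^bsub>k\<^esub> proj F"
    using D.l_coset_frac[OF y] F pre_proj(2) by (intro pI) (auto intro!: D.frac_idealsD(1))
next
  fix y assume "y \<in> carrier k - {\<zero>\<^bsub>k\<^esub>}"
  then have y: "y \<in> carrier k" "y \<noteq> \<zero>\<^bsub>k\<^esub>"
    by auto
  obtain u where u: "u \<in> U" "\<And>F. F \<in> frac_ideals k D \<Longrightarrow> pre (y <#\<^bsub>k\<^esub> F) = u <#\<^bsub>K\<^esub> pre F"
    using l_coset_lift[OF y] by metis
  have "pre (proj (y <#\<^bsub>k\<^esub> D)) = pre (y <#\<^bsub>k\<^esub> D)"
    using u(2) D.A_frac pre_proj D.l_coset_frac[OF y D.A_frac] R.star_l_coset_A[OF unitD(3,4)[OF u(1)]]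
    by simp
  then show "proj (y <#\<^bsub>k\<^esub> D) = y <#\<^bsub>k\<^esub> D"
    using D.l_coset_frac[OF y] D.A_frac pre_proj(2)
    by (intro iffD1[OF pre_eq_iff]) (auto intro!: D.frac_idealsD(1))
next
  fix E F assume EF: "E \<in> frac_ideals k D" "F \<in> frac_ideals k D" "E \<subseteq> F"
  have "pre E \<subseteq> pre F"
    using EF by (auto simp: pre_def)
  then have "pre (proj E) \<subseteq> pre (proj F)"
    using EF pre_proj R.star_mono sandwichedD(1)[OF pre_sandwiched] by simp
  then show "proj E \<subseteq> proj F"
    using pre_le_iff[OF D.frac_idealsD(1)[OF pre_proj(2)[OF EF(1)]]] by simp
next
  fix E assume E: "E \<in> frac_ideals k D"
  note g = sandwichedD(1)[OF pre_sandwiched[OF E]]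
  show "E \<subseteq> proj E"
    using R.star_ext[OF g] pre_proj(1)[OF E] pre_le_iff[OF D.frac_idealsD(1)[OF E], of "proj E"] by simp
  have "pre (proj (proj E)) = pre (proj E)"
    using pre_proj E R.star_idem[OF g] by simp
  then show "proj (proj E) = proj E"
    using pre_proj(2) E by (intro iffD1[OF pre_eq_iff]) (auto intro!: D.frac_idealsD(1))
  show "proj E \<in> frac_ideals k D"
    by (rule pre_proj(2)[OF E])
qed

sublocale D: star_domain k D proj
  by unfold_locales (rule star_operation_proj)

text \<open>On sandwiched ideals \<phi> is injective and carries products, colon ideals and closures
  over \<open>R\<close> to those over \<open>D\<close>, so it carries the defining equations of
  invertibility to each other.\<close>

lemma image_Inv_iff:
  assumes "sandwiched E"
  shows "\<phi> ` E \<in> carrier D.Inv \<longleftrightarrow> E \<in> carrier R.Inv"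
proof -
  note E = sandwichedD(1)[OF assms]
  let ?P = "ideal_prod K E (colon K R E)"
  have gP: "sandwiched ?P" "\<phi> ` ?P = ideal_prod k (\<phi> ` E) (colon k D (\<phi> ` E))"
    using sandwiched_prod[OF assms sandwiched_colon(1)[OF assms]] sandwiched_colon(2)[OF assms] by simp_all
  have "proj (\<phi> ` E) = \<phi> ` E \<longleftrightarrow> star E = E"
    using proj_image[OF assms] image_eq_iff[OF sandwiched_star[OF assms] assms] by simp
  moreover have "proj (ideal_prod k (\<phi> ` E) (colon k D (\<phi> ` E))) = D \<longleftrightarrow> star ?P = R"
    using proj_image[OF gP(1)] gP(2) image_eq_iff[OF sandwiched_star[OF gP(1)] sandwiched_R] phi_R by simp
  ultimately show ?thesis
    using image_frac[OF assms] E by (simp add: Inv_group_def)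
qed

lemma pre_Inv_iff:
  assumes J: "J \<in> frac_ideals k D"
  shows "pre J \<in> carrier R.Inv \<longleftrightarrow> J \<in> carrier D.Inv"
  using image_Inv_iff[OF pre_sandwiched[OF J]] image_pre[OF D.frac_idealsD(1)[OF J]] by simp

lemma pre_hom: "pre \<in> hom D.Inv R.Inv"
proof (rule homI)
  fix J assume "J \<in> carrier D.Inv"
  then show "pre J \<in> carrier R.Inv"
    using pre_Inv_iff[OF D.InvD(1)] by simp
next
  fix I J assume "I \<in> carrier D.Inv" "J \<in> carrier D.Inv"
  then have fr: "I \<in> frac_ideals k D" "J \<in> frac_ideals k D"
    using D.InvD by auto
  note g = sandwiched_prod[OF fr[THEN pre_sandwiched]]
  have "proj (ideal_prod k I J) = \<phi> ` star (ideal_prod K (pre I) (pre J))"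
    using proj_image[OF g(1)] g(2) image_pre fr[THEN D.frac_idealsD(1)] by simp
  then show "pre (I \<otimes>\<^bsub>D.Inv\<^esub> J) = pre I \<otimes>\<^bsub>R.Inv\<^esub> pre J"
    using pre_image[OF sandwiched_star[OF g(1)]] by (simp add: D.Inv_simps R.Inv_simps)
qed

text \<open>If the preimage of J is x R, it contains a unit u = x r of \<open>T\<close>. Since x is
  in \<open>T\<close> as well, x is itself a unit, and J is generated by \<phi>(x).\<close>

lemma pre_Prin_iff:
  assumes J: "J \<in> carrier D.Inv"
  shows "pre J \<in> Prin K R \<longleftrightarrow> J \<in> Prin k D"
proof
  note Jf = D.InvD(1)[OF J]
  assume "pre J \<in> Prin K R"
  then obtain x where x: "x \<in> carrier K" "x \<noteq> \<zero>" "pre J = x <#\<^bsub>K\<^esub> R"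
    by (auto simp: Prin_def)
  obtain u where u: "u \<in> U" "u \<in> pre J"
    using pre_sandwiched[OF Jf] unfolding sandwiched_def by blast
  obtain r where r: "r \<in> R" "u = x \<otimes> r"
    using u x(3) by (auto simp: l_coset_iff)
  have xT: "x \<in> T"
    using R.l_coset_A[OF x(1)] x(3) preD(1) by blast
  then have "x \<otimes> (r \<otimes> inv u) = \<one>"
    using r(1) unitD[OF u(1)] R_T[OF r(1)] r(2) by (simp add: m_assoc[symmetric])
  then have "x \<in> U"
    using unitD[OF u(1)] R_T[OF r(1)] by (intro unitI[OF xT, of "r \<otimes> inv u"]) auto
  then have "\<phi> x \<noteq> \<zero>\<^bsub>k\<^esub>"
    by (rule unitD)
  moreover have "J = \<phi> x <#\<^bsub>k\<^esub> D"
    using image_l_coset[of R x] xT R_T phi_R x(3) image_pre[OF D.frac_idealsD(1)[OF Jf]] by auto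
  ultimately show "J \<in> Prin k D"
    using xT by (auto simp: Prin_def)
next
  assume "J \<in> Prin k D"
  then obtain y where y: "y \<in> carrier k" "y \<noteq> \<zero>\<^bsub>k\<^esub>" "J = y <#\<^bsub>k\<^esub> D"
    by (auto simp: Prin_def)
  obtain u where u: "u \<in> U" "\<And>F. F \<in> frac_ideals k D \<Longrightarrow> pre (y <#\<^bsub>k\<^esub> F) = u <#\<^bsub>K\<^esub> pre F"
    using l_coset_lift[OF y(1,2)] by metis
  then show "pre J \<in> Prin K R"
    using y(3) D.A_frac unitD(3,4)[OF u(1)] by (auto simp: Prin_def)
qed

end

subsection \<open>The \<open>v\<close>-operation\<close>

context domain_in_field
begin

lemma le_v: "E \<subseteq> carrier K \<Longrightarrow> E \<subseteq> v_operation K A E"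
  by (auto simp: v_operation_def colon_def m_comm subset_iff)

lemma v_mono: "E \<subseteq> F \<Longrightarrow> v_operation K A E \<subseteq> v_operation K A F"
  by (simp add: v_operation_def colon_antimono)

lemma v_idem: "v_operation K A (v_operation K A E) \<subseteq> v_operation K A E"
proof -
  have "colon K A E \<subseteq> v_operation K A (colon K A E)"
    by (rule le_v) (auto simp: colon_def)
  from colon_antimono[OF this] show ?thesis
    by (simp add: v_operation_def)
qed

lemma colon_l_coset:
  assumes x: "x \<in> carrier K" "x \<noteq> \<zero>" and E: "E \<subseteq> carrier K"
  shows "colon K A (x <#\<^bsub>K\<^esub> E) = inv x <#\<^bsub>K\<^esub> colon K A E"
proof
  note i = inv_simps[OF x]
  show "colon K A (x <#\<^bsub>K\<^esub> E) \<subseteq> inv x <#\<^bsub>K\<^esub> colon K A E"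
  proof
    fix y assume y: "y \<in> colon K A (x <#\<^bsub>K\<^esub> E)"
    have "x \<otimes> y \<otimes> e \<in> A" if "e \<in> E" for e
    proof -
      have "x \<otimes> e \<in> x <#\<^bsub>K\<^esub> E"
        using that by (auto simp: l_coset_iff)
      then have "y \<otimes> (x \<otimes> e) \<in> A" "y \<in> carrier K"
        using y by (auto simp: colon_def)
      then show ?thesis
        using x E that by (simp add: m_ac subset_iff)
    qed
    then have "x \<otimes> y \<in> colon K A E" "y = inv x \<otimes> (x \<otimes> y)"
      using y x i by (auto simp: colon_def)
    then show "y \<in> inv x <#\<^bsub>K\<^esub> colon K A E"
      unfolding l_coset_iff by blast
  qed
  show "inv x <#\<^bsub>K\<^esub> colon K A E \<subseteq> colon K A (x <#\<^bsub>K\<^esub> E)"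
  proof
    fix y assume "y \<in> inv x <#\<^bsub>K\<^esub> colon K A E"
    then obtain z where z: "z \<in> carrier K" "\<And>e. e \<in> E \<Longrightarrow> z \<otimes> e \<in> A" "y = inv x \<otimes> z"
      by (auto simp: l_coset_iff colon_def)
    have "y \<otimes> (x \<otimes> e) \<in> A" if "e \<in> E" for e
    proof -
      have "y \<otimes> (x \<otimes> e) = (inv x \<otimes> x) \<otimes> (z \<otimes> e)"
        using z(1,3) x i(1) E that by (simp add: m_ac subset_iff)
      also have "\<dots> = z \<otimes> e"
        using z(1) i x E that by (simp add: subset_iff)
      finally show ?thesis
        using z that by simp
    qed
    then show "y \<in> colon K A (x <#\<^bsub>K\<^esub> E)"
      using z i by (auto simp: colon_def l_coset_iff)
  qed
qed

lemma v_l_coset: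
  assumes x: "x \<in> carrier K" "x \<noteq> \<zero>" and E: "E \<subseteq> carrier K"
  shows "v_operation K A (x <#\<^bsub>K\<^esub> E) = x <#\<^bsub>K\<^esub> v_operation K A E"
proof -
  have "inv (inv x) = x"
    using x by (simp add: field_Units)
  moreover have "colon K A E \<subseteq> carrier K"
    by (auto simp: colon_def)
  ultimately show ?thesis
    unfolding v_operation_def colon_l_coset[OF x E]
    by (simp add: colon_l_coset[OF inv_simps(1,2)[OF x]])
qed

lemma colon_A: "colon K A A = A"
proof
  show "colon K A A \<subseteq> A"
  proof
    fix x assume "x \<in> colon K A A"
    then have "x \<otimes> \<one> \<in> A" "x \<in> carrier K"
      unfolding colon_def by blast+
    then show "x \<in> A"
      by simp
  qed
qed (auto simp: colon_def)

lemma v_frac: "E \<in> frac_ideals K A \<Longrightarrow> v_operation K A E \<in> frac_ideals K A"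
  by (simp add: v_operation_def colon_frac)

end

context pullback_star
begin

subsection \<open>The induced star operation on the overring\<close>

abbreviation "starT \<equiv> star_ext K T star"

text \<open>From t E \<subseteq> E the closure satisfies t (\<open>star E\<close>) \<subseteq>
  \<open>star E\<close>: the closure over \<open>R\<close> of an ideal of \<open>T\<close> remains a
  \<open>T\<close>-module.\<close>

lemma star_T_closed:
  assumes E: "E \<in> frac_ideals K T" and "t \<in> T" "x \<in> star E"
  shows "t \<otimes> x \<in> star E"
  using assms frac_idealsD(5)[OF E] R.star_mult_le[OF frac_T_R[OF E] frac_T_R[OF E]] by blast

lemma starT_frac:
  assumes E: "E \<in> frac_ideals K T"
  shows "starT E \<in> frac_ideals K T"
proof -
  note v = v_frac[OF E] and s = R.star_frac[OF frac_T_R[OF E]]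
  obtain e where e: "e \<in> E" "e \<noteq> \<zero>" "e \<in> carrier K"
    using frac_ideals_nonzero[OF E] by blast
  obtain d where d: "d \<in> T" "d \<noteq> \<zero>" "\<And>x. x \<in> v_operation K T E \<Longrightarrow> d \<otimes> x \<in> T"
    using frac_ideals_denom[OF v] by blast
  show ?thesis
  proof (rule frac_idealsI[of _ e d])
    show "e \<in> starT E"
      using e R.star_ext[OF frac_T_R[OF E]] le_v[OF frac_idealsD(1)[OF E]] by (auto simp: star_ext_def)
  qed (use e d frac_idealsD[OF v] R.frac_idealsD(4)[OF s] star_T_closed[OF E] in
      \<open>auto simp: star_ext_def\<close>)
qed

lemma star_operation_starT: "star_operation K T starT"
  unfolding star_operation_def
proof (intro conjI ballI impI funcsetI)
  fix x E assume "x \<in> carrier K - {\<zero>}" and E: "E \<in> frac_ideals K T"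
  then have x: "x \<in> carrier K" "x \<noteq> \<zero>"
    by auto
  have v: "v_operation K T E \<subseteq> carrier K" "star E \<subseteq> carrier K"
    using frac_idealsD(1)[OF v_frac[OF E]] R.frac_idealsD(1)[OF R.star_frac[OF frac_T_R[OF E]]] by auto
  have "(x <#\<^bsub>K\<^esub> star E) \<inter> (x <#\<^bsub>K\<^esub> v_operation K T E) = x <#\<^bsub>K\<^esub> (star E \<inter> v_operation K T E)"
  proof
    show "(x <#\<^bsub>K\<^esub> star E) \<inter> (x <#\<^bsub>K\<^esub> v_operation K T E) \<subseteq> x <#\<^bsub>K\<^esub> (star E \<inter> v_operation K T E)"
    proof
      fix y assume "y \<in> (x <#\<^bsub>K\<^esub> star E) \<inter> (x <#\<^bsub>K\<^esub> v_operation K T E)"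
      then obtain a b where ab: "a \<in> star E" "b \<in> v_operation K T E" "y = x \<otimes> a" "y = x \<otimes> b"
        by (auto simp: l_coset_iff)
      then have "a = b"
        using x v m_lcancel[of x a b] by (auto simp: subset_iff)
      then show "y \<in> x <#\<^bsub>K\<^esub> (star E \<inter> v_operation K T E)"
        using ab by (auto simp: l_coset_iff)
    qed
  qed (auto simp: l_coset_iff)
  then show "starT (x <#\<^bsub>K\<^esub> E) = x <#\<^bsub>K\<^esub> starT E"
    using x R.star_l_coset[OF x frac_T_R[OF E]] v_l_coset[OF x frac_idealsD(1)[OF E]]
    by (simp add: star_ext_def)
next
  fix x assume "x \<in> carrier K - {\<zero>}"
  then have x: "x \<in> carrier K" "x \<noteq> \<zero>"
    by auto
  \<comment> \<open>The v-closure of x T is x T, which bounds the intersection from above.\<close>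
  have "v_operation K T (x <#\<^bsub>K\<^esub> T) = x <#\<^bsub>K\<^esub> T"
    by (simp add: v_l_coset[OF x A_closed(7)]) (simp add: v_operation_def colon_A)
  then show "starT (x <#\<^bsub>K\<^esub> T) = x <#\<^bsub>K\<^esub> T"
    using R.star_ext[OF frac_T_R[OF l_coset_frac[OF x A_frac]]] by (auto simp: star_ext_def)
next
  fix E F assume EF: "E \<in> frac_ideals K T" "F \<in> frac_ideals K T" "E \<subseteq> F"
  then show "starT E \<subseteq> starT F"
    using R.star_mono[OF frac_T_R frac_T_R] v_mono[OF EF(3)] by (auto simp: star_ext_def)
next
  fix E assume E: "E \<in> frac_ideals K T"
  then show "starT E \<in> frac_ideals K T"
    by (rule starT_frac)
  have le: "F \<subseteq> starT F" if "F \<in> frac_ideals K T" for F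
    using R.star_ext[OF frac_T_R[OF that]] le_v[OF frac_idealsD(1)[OF that]] by (auto simp: star_ext_def)
  then show "E \<subseteq> starT E"
    using E by blast
  have "star (starT E) \<subseteq> star E"
    using R.star_mono[OF frac_T_R[OF starT_frac[OF E]] R.star_frac[OF frac_T_R[OF E]]]
      R.star_idem[OF frac_T_R[OF E]] by (auto simp: star_ext_def)
  moreover have "v_operation K T (starT E) \<subseteq> v_operation K T E"
    using v_mono[of "starT E" "v_operation K T E"] v_idem by (auto simp: star_ext_def)
  ultimately have "star (starT E) \<inter> v_operation K T (starT E) \<subseteq> star E \<inter> v_operation K T E"
    by blast
  then have "starT (starT E) \<subseteq> starT E"
    by (simp only: star_ext_def)
  then show "starT (starT E) = starT E"
    using le[OF starT_frac[OF E]] by blast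
qed

sublocale T: star_domain K T starT
  by unfold_locales (rule star_operation_starT)

lemma inv_U_mult_ext:
  assumes E: "E \<in> frac_ideals K R" and x: "x \<in> carrier K" and s: "s \<in> U" "s \<otimes> x \<in> E"
  shows "x \<in> ideal_prod K E T"
proof -
  have "(s \<otimes> x) \<otimes> inv s \<in> ideal_prod K E T"
    using s unitD[OF s(1)] by (intro ideal_prod.prod) auto
  moreover have "(s \<otimes> x) \<otimes> inv s = x"
    using unitD[OF s(1)] x m_comm[of "s \<otimes> x" "inv s"] by (simp add: inv_simps)
  ultimately show ?thesis
    by simp
qed

text \<open>Only the v-part needs work. Let x multiply E T into \<open>T\<close>, and let W
  \<subseteq> E be a finite witness for y. A common denominator s of x W gives (s x) W \<subseteq>
  R, hence s x y in \<open>R\<close>, and x y in \<open>T\<close> after division by the unit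
  s.\<close>

lemma star_le_starT_ext:
  assumes E: "E \<in> frac_ideals K R"
  shows "star E \<subseteq> starT (ideal_prod K E T)"
proof
  note ET = ext_frac[OF E]
  fix y assume y: "y \<in> star E"
  have yK: "y \<in> carrier K"
    using R.frac_idealsD(2)[OF R.star_frac[OF E] y] .
  obtain W where W: "finite W" "W \<subseteq> E" "\<And>x F. F \<in> frac_ideals K R \<Longrightarrow> x \<in> carrier K \<Longrightarrow>
      (\<And>z. z \<in> W \<Longrightarrow> x \<otimes> z \<in> F) \<Longrightarrow> x \<otimes> y \<in> star F"
    using R.finite_type_witness[OF finite_type_R E y] by blast
  have "y \<otimes> x \<in> T" if x: "x \<in> colon K T (ideal_prod K E T)" for x
  proof -
    have xK: "x \<in> carrier K"
      using x by (simp add: colon_def)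
    have WT: "x \<otimes> z \<in> T" if "z \<in> W" for z
      using that W(2) ET(2) x by (auto simp: colon_def)
    obtain s where s: "s \<in> U" "s \<in> R" "\<forall>z\<in>(\<lambda>z. x \<otimes> z) ` W. s \<otimes> z \<in> R"
      using common_denom[of "(\<lambda>z. x \<otimes> z) ` W" R] W(1) R.A_frac denom_T WT by blast
    have "(s \<otimes> x) \<otimes> z \<in> R" if "z \<in> W" for z
      using s that xK W(2) R.frac_idealsD(2)[OF E] unitD[OF s(1)] by (auto simp: m_assoc subset_iff)
    then have "(s \<otimes> x) \<otimes> y \<in> R"
      using W(3)[OF R.A_frac, of "s \<otimes> x"] xK s by (simp add: R.star_A)
    then have "inv s \<otimes> ((s \<otimes> x) \<otimes> y) \<in> T"
      using unitD[OF s(1)] R_T by blast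
    moreover have "inv s \<otimes> ((s \<otimes> x) \<otimes> y) = y \<otimes> x"
      using unitD[OF s(1)] xK yK m_comm[of x y] by (simp add: m_assoc inv_simps)
    ultimately show ?thesis
      by simp
  qed
  then have "y \<in> v_operation K T (ideal_prod K E T)"
    using yK by (simp add: v_operation_def colon_def)
  moreover have "y \<in> star (ideal_prod K E T)"
    using y R.star_mono[OF E frac_T_R[OF ET(1)] ET(2)] by blast
  ultimately show "y \<in> starT (ideal_prod K E T)"
    by (simp add: star_ext_def)
qed

lemma TT: "ideal_prod K T T = T"
  by (rule prod_A[OF A_frac])

lemma ext_prod:
  assumes "E \<subseteq> carrier K" "F \<subseteq> carrier K"
  shows "ideal_prod K (ideal_prod K E F) T = ideal_prod K (ideal_prod K E T) (ideal_prod K F T)"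
  using assms ideal_prod_interchange[of E F T T] TT by auto

lemma ext_mult_T:
  assumes E: "E \<in> frac_ideals K T"
  shows "ideal_prod K E T = E"
  using prod_A[OF E] ideal_prod_comm[OF frac_idealsD(1)[OF E] A_closed(7)] by simp

lemma starT_ext_star:
  assumes E: "E \<in> frac_ideals K R"
  shows "starT (ideal_prod K (star E) T) = starT (ideal_prod K E T)"
proof
  note ET = ext_frac[OF E] and sET = ext_frac[OF R.star_frac[OF E]]
  have "ideal_prod K (star E) T \<subseteq> ideal_prod K (starT (ideal_prod K E T)) T"
    using star_le_starT_ext[OF E] by (intro ideal_prod_mono) auto
  also have "\<dots> = starT (ideal_prod K E T)"
    using ext_mult_T[OF T.star_frac[OF ET(1)]] .
  finally show "starT (ideal_prod K (star E) T) \<subseteq> starT (ideal_prod K E T)"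
    using T.star_mono[OF sET(1) T.star_frac[OF ET(1)]] T.star_idem[OF ET(1)] by simp
  show "starT (ideal_prod K E T) \<subseteq> starT (ideal_prod K (star E) T)"
    using R.star_ext[OF E] by (intro T.star_mono ET sET ideal_prod_mono) auto
qed

text \<open>By finite type, \<open>1\<close> lies in the closure of finitely many elements of \<open>H H\<^sup>-\<^sup>1\<close>, which involve only
  finitely many \<open>g \<in> H\<^sup>-\<^sup>1\<close>; a common denominator of the \<open>x g\<close> moves \<open>x\<close> into \<open>H\<close>.\<close>

lemma Inv_denom:
  assumes H: "H \<in> carrier R.Inv" and x: "x \<in> carrier K"
    and xG: "\<And>g. g \<in> colon K R H \<Longrightarrow> x \<otimes> g \<in> T"
  shows "\<exists>s\<in>U \<inter> R. s \<otimes> x \<in> H"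
proof -
  let ?G = "colon K R H"
  note H' = R.InvD[OF H]
  have GK: "?G \<subseteq> carrier K"
    by (auto simp: colon_def)
  have factors: "\<exists>Y. finite Y \<and> Y \<subseteq> ?G \<and> (\<forall>y\<in>carrier K. (\<forall>g\<in>Y. y \<otimes> g \<in> R) \<longrightarrow> y \<otimes> z \<in> H)"
    if "z \<in> ideal_prod K H ?G" for z
    using that
  proof induction
    case (prod h g)
    \<comment> \<open>The product y g is absorbed into \<open>R\<close>, which leaves a multiple of
      h. Thus the finite set for the single product h g is the singleton of g, and sums take
      unions.\<close>
    have "y \<otimes> (h \<otimes> g) \<in> H" if "y \<in> carrier K" "y \<otimes> g \<in> R" for y
    proof -
      have "y \<otimes> (h \<otimes> g) = (y \<otimes> g) \<otimes> h"
        using that(1) prod GK R.frac_idealsD(2)[OF H'(1)] by (simp add: m_ac subset_iff)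
      then show ?thesis
        using R.frac_idealsD(5)[OF H'(1) that(2) prod(1)] by simp
    qed
    then show ?case
      using prod by (intro exI[of _ "{g}"]) auto
  next
    case (sum z z')
    then obtain Y Y' where Y: "finite Y" "Y \<subseteq> ?G"
      "\<And>y. y \<in> carrier K \<Longrightarrow> \<forall>g\<in>Y. y \<otimes> g \<in> R \<Longrightarrow> y \<otimes> z \<in> H"
      and Y': "finite Y'" "Y' \<subseteq> ?G"
      "\<And>y. y \<in> carrier K \<Longrightarrow> \<forall>g\<in>Y'. y \<otimes> g \<in> R \<Longrightarrow> y \<otimes> z' \<in> H"
      by metis
    have zK: "z \<in> carrier K" "z' \<in> carrier K"
      using sum ideal_prod_closed[OF R.frac_idealsD(1)[OF H'(1)] GK] by auto
    have "y \<otimes> (z \<oplus> z') \<in> H" if "y \<in> carrier K" "\<forall>g\<in>Y \<union> Y'. y \<otimes> g \<in> R" for y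
      using that Y(3)[of y] Y'(3)[of y] zK R.frac_idealsD(4)[OF H'(1)] by (simp add: r_distr)
    then show ?case
      using Y Y' by (intro exI[of _ "Y \<union> Y'"]) auto
  qed
  have fr: "ideal_prod K H ?G \<in> frac_ideals K R"
    using R.prod_frac R.colon_frac H' by blast
  have "\<one> \<in> star (ideal_prod K H ?G)"
    using H'(3) by simp
  from R.finite_type_witness[OF finite_type_R fr this]
  obtain W where W: "finite W" "W \<subseteq> ideal_prod K H ?G" "\<And>x F. F \<in> frac_ideals K R \<Longrightarrow>
      x \<in> carrier K \<Longrightarrow> (\<And>z. z \<in> W \<Longrightarrow> x \<otimes> z \<in> F) \<Longrightarrow> x \<otimes> \<one> \<in> star F"
    by metis
  obtain Y where Y: "\<And>z. z \<in> W \<Longrightarrow> finite (Y z) \<and> Y z \<subseteq> ?G \<and>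
      (\<forall>y\<in>carrier K. (\<forall>g\<in>Y z. y \<otimes> g \<in> R) \<longrightarrow> y \<otimes> z \<in> H)"
    using factors W(2) by (metis (no_types, lifting) subsetD)
  let ?V = "\<lambda>z. x \<otimes> z"
  have V: "finite (?V ` (\<Union>z\<in>W. Y z))" "\<And>v. v \<in> ?V ` (\<Union>z\<in>W. Y z) \<Longrightarrow> v \<in> T"
    using W(1) Y xG by blast+
  have "\<exists>s\<in>U \<inter> R. \<forall>v\<in>?V ` (\<Union>z\<in>W. Y z). s \<otimes> v \<in> R"
  proof (rule common_denom[OF V(1) R.A_frac])
    show "?V ` (\<Union>z\<in>W. Y z) \<subseteq> carrier K"
      by (intro subsetI T.A_closed(1) V(2))
  qed (rule denom_T[OF V(2)])
  then obtain s where s: "s \<in> U" "s \<in> R" "\<forall>v\<in>?V ` (\<Union>z\<in>W. Y z). s \<otimes> v \<in> R"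
    by blast
  have sx: "s \<otimes> x \<in> carrier K"
    using s x by simp
  have "(s \<otimes> x) \<otimes> z \<in> H" if z: "z \<in> W" for z
  proof -
    have "(s \<otimes> x) \<otimes> g \<in> R" if g: "g \<in> Y z" for g
    proof -
      have "g \<in> carrier K" "s \<otimes> (x \<otimes> g) \<in> R"
        using Y[OF z] g GK s(3) z by auto
      then show ?thesis
        using s(2) x by (simp add: m_assoc)
    qed
    then show ?thesis
      using Y[OF z] sx by blast
  qed
  then have "(s \<otimes> x) \<otimes> \<one> \<in> star H"
    using W(3)[OF H'(1) sx] by blast
  then show ?thesis
    using s sx H'(2) by auto
qed

text \<open>Put G = H^-1. Every g in G satisfies g H T \<subseteq> T, so it multiplies the closure
  of \<open>HT\<close> into \<open>T\<close>; \<open>Inv_denom\<close> then moves an element of the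
  closure into H by some s, and it lies in \<open>HT\<close>. The extension of G is the inverse,
  because the product of the two extensions is (H G) T and \<open>star_le_starT_ext\<close> puts 1
  into its closure.\<close>

lemma ext_Inv:
  assumes H: "H \<in> carrier R.Inv"
  shows "ideal_prod K H T \<in> carrier T.Inv"
proof (rule T.InvI)
  let ?G = "colon K R H"
  note H' = R.InvD[OF H]
  have G: "?G \<in> frac_ideals K R"
    using R.colon_frac H' by blast
  note HT = ext_frac[OF H'(1)]
  have HK: "H \<subseteq> carrier K" and GK: "?G \<subseteq> carrier K"
    using R.frac_idealsD(1) H' G by auto
  show "ideal_prod K H T \<in> frac_ideals K T"
    by (rule HT)
  show "starT (ideal_prod K H T) = ideal_prod K H T"
  proof
    show "starT (ideal_prod K H T) \<subseteq> ideal_prod K H T"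
    proof
      fix x assume x: "x \<in> starT (ideal_prod K H T)"
      have xK: "x \<in> carrier K"
        using frac_idealsD(2)[OF T.star_frac[OF HT(1)] x] .
      have "x \<otimes> g \<in> T" if g: "g \<in> ?G" for g
      proof -
        have "g \<otimes> z \<in> T" if "z \<in> ideal_prod K H T" for z
          using that
        proof induction
          case (prod h t)
          then have "g \<otimes> h \<in> T" "g \<otimes> (h \<otimes> t) = (g \<otimes> h) \<otimes> t"
            using g HK R_T by (auto simp: colon_def m_assoc)
          then show ?case
            using prod by simp
        next
          case (sum y z)
          moreover have "y \<in> carrier K" "z \<in> carrier K"
            using sum frac_idealsD(2)[OF HT(1)] by auto
          ultimately show ?case
            using g GK by (auto simp: r_distr)
        qed
        then have "g \<otimes> x \<in> starT T"
          using g GK by (intro T.star_mult_le[OF HT(1) A_frac _ _ x]) auto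
        then show ?thesis
          using g GK xK by (simp add: T.star_A m_comm subset_iff)
      qed
      then obtain s where "s \<in> U" "s \<otimes> x \<in> H"
        using Inv_denom[OF H xK] by blast
      then show "x \<in> ideal_prod K H T"
        using inv_U_mult_ext[OF H'(1) xK] by blast
    qed
  qed (rule T.star_ext[OF HT(1)])
  show "ideal_prod K ?G T \<in> frac_ideals K T"
    by (rule ext_frac[OF G])
  have eq: "ideal_prod K (ideal_prod K H T) (ideal_prod K ?G T) = ideal_prod K (ideal_prod K H ?G) T"
    using ext_prod[OF HK GK] by simp
  have "\<one> \<in> star (ideal_prod K H ?G)"
    using H'(3) by simp
  then show "\<one> \<in> starT (ideal_prod K (ideal_prod K H T) (ideal_prod K ?G T))"
    unfolding eq using star_le_starT_ext[OF R.prod_frac[OF H'(1) G]] by blast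
  have "ideal_prod K (ideal_prod K H ?G) T \<subseteq> ideal_prod K T T"
    using R.prod_colon_le[OF H'(1)] R_T by (intro ideal_prod_mono) auto
  then show "ideal_prod K (ideal_prod K H T) (ideal_prod K ?G T) \<subseteq> T"
    unfolding eq TT .
qed

text \<open>The extension of the closed product is already a star ideal by \<open>ext_Inv\<close>,
  so it equals its own closure, and \<open>starT_ext_star\<close> discards the inner
  closure.\<close>

lemma ext_hom: "(\<lambda>H. ideal_prod K H T) \<in> hom R.Inv T.Inv"
proof (rule homI)
  fix H I assume HI: "H \<in> carrier R.Inv" "I \<in> carrier R.Inv"
  note fr = R.InvD(1)[OF HI(1)] R.InvD(1)[OF HI(2)]
  have "ideal_prod K (star (ideal_prod K H I)) T = starT (ideal_prod K (star (ideal_prod K H I)) T)"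
    using T.InvD(2)[OF ext_Inv[OF R.prod_Inv[OF HI]]] by simp
  also have "\<dots> = starT (ideal_prod K (ideal_prod K H I) T)"
    by (rule starT_ext_star[OF R.prod_frac[OF fr]])
  finally show "ideal_prod K (H \<otimes>\<^bsub>R.Inv\<^esub> I) T = ideal_prod K H T \<otimes>\<^bsub>T.Inv\<^esub> ideal_prod K I T"
    using ext_prod[OF fr[THEN R.frac_idealsD(1)]] by (simp add: R.Inv_simps T.Inv_simps)
qed (rule ext_Inv)

subsection \<open>Exactness in the middle\<close>

lemma ext_pre:
  assumes J: "J \<in> frac_ideals k D"
  shows "ideal_prod K (pre J) T = T"
proof
  note g = pre_sandwiched[OF J]
  obtain u where u: "u \<in> U" "u \<in> pre J"
    using g unfolding sandwiched_def by blast
  have "ideal_prod K (pre J) T \<subseteq> ideal_prod K T T"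
    using sandwichedD(2)[OF g] by (intro ideal_prod_mono) auto
  then show "ideal_prod K (pre J) T \<subseteq> T"
    by (simp add: TT)
  show "T \<subseteq> ideal_prod K (pre J) T"
  proof
    fix t assume t: "t \<in> T"
    have "u \<otimes> (inv u \<otimes> t) \<in> ideal_prod K (pre J) T"
      using u unitD[OF u(1)] t by (intro ideal_prod.prod) auto
    then show "t \<in> ideal_prod K (pre J) T"
      using unitD[OF u(1)] t by (simp add: inv_simps)
  qed
qed

text \<open>With G = H^-1, the product (HT)(GT) is \<open>GT\<close>, which is closed, so 1 lies in
  \<open>GT\<close> as well as in \<open>HT\<close>. Denominators of 1 with respect to H and G are
  the two units required by \<open>sandwiched\<close>.\<close>

lemma sandwiched_of_ext_eq:
  assumes H: "H \<in> carrier R.Inv" and HT: "ideal_prod K H T = T"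
  shows "sandwiched H"
proof -
  let ?G = "colon K R H"
  note H' = R.InvD[OF H]
  note G = R.colon_Inv[OF H]
  have HK: "H \<subseteq> carrier K" and GK: "?G \<subseteq> carrier K"
    using R.frac_idealsD(1) H' R.InvD(1)[OF G] by auto
  have "\<one> \<in> star (ideal_prod K H ?G)"
    using H'(3) by simp
  then have "\<one> \<in> starT (ideal_prod K (ideal_prod K H T) (ideal_prod K ?G T))"
    using star_le_starT_ext[OF R.prod_frac[OF H'(1) R.InvD(1)[OF G]]] ext_prod[OF HK GK] by auto
  then have 1: "\<one> \<in> ideal_prod K ?G T"
    using HT prod_A[OF ext_frac(1)[OF R.InvD(1)[OF G]]] T.InvD(2)[OF ext_Inv[OF G]] by simp
  obtain w where "w \<in> U" "w \<in> ?G"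
    using denom_ext[OF R.InvD(1)[OF G] 1] unitD(3) by auto
  moreover obtain u where "u \<in> U" "u \<in> H"
    using denom_ext[OF H'(1), of \<one>] HT unitD(3) by auto
  ultimately show ?thesis
    using H'(1) unfolding sandwiched_def colon_def by blast
qed

text \<open>If \<open>HT\<close> = x T, the scaled ideal x^-1 H extends to \<open>T\<close> and is
  sandwiched; its image under \<phi> is the ideal J.\<close>

lemma ext_Prin_iff:
  assumes H: "H \<in> carrier R.Inv"
  shows "ideal_prod K H T \<in> Prin K T \<longleftrightarrow>
    (\<exists>J\<in>carrier D.Inv. ideal_class K R star H = ideal_class K R star (pre J))"
proof
  note H' = R.InvD[OF H]
  assume "ideal_prod K H T \<in> Prin K T"
  then obtain x where x: "x \<in> carrier K" "x \<noteq> \<zero>" "ideal_prod K H T = x <#\<^bsub>K\<^esub> T"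
    by (auto simp: Prin_def)
  note i = inv_simps[OF x(1,2)]
  let ?E = "inv x <#\<^bsub>K\<^esub> H"
  have E: "?E \<in> carrier R.Inv"
    by (rule R.l_coset_Inv(1)[OF i(1,2) H])
  have "ideal_prod K ?E T = inv x <#\<^bsub>K\<^esub> (x <#\<^bsub>K\<^esub> T)"
    using ideal_prod_l_coset[OF i(1) R.frac_idealsD(1)[OF H'(1)] A_closed(7)] x(3) by simp
  then have "ideal_prod K ?E T = T"
    using x i by (simp add: l_coset_l_coset l_coset_one)
  then have g: "sandwiched ?E"
    by (rule sandwiched_of_ext_eq[OF E])
  then have "\<phi> ` ?E \<in> carrier D.Inv"
    using image_Inv_iff E by simp
  moreover have "H = x <#\<^bsub>K\<^esub> pre (\<phi> ` ?E)"
    using pre_image[OF g] x i R.frac_idealsD(1)[OF H'(1)] by (simp add: l_coset_l_coset l_coset_one)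
  then have "ideal_class K R star H = ideal_class K R star (pre (\<phi> ` ?E))"
    using R.ideal_class_eq_iff[OF H, of "pre (\<phi> ` ?E)"] E x pre_image[OF g] by auto
  ultimately show "\<exists>J\<in>carrier D.Inv. ideal_class K R star H = ideal_class K R star (pre J)"
    by blast
next
  assume "\<exists>J\<in>carrier D.Inv. ideal_class K R star H = ideal_class K R star (pre J)"
  then obtain J where J: "J \<in> carrier D.Inv" "ideal_class K R star H = ideal_class K R star (pre J)"
    by blast
  have "pre J \<in> carrier R.Inv"
    using pre_hom J by (auto simp: hom_def)
  then obtain x where x: "x \<in> carrier K" "x \<noteq> \<zero>" "H = x <#\<^bsub>K\<^esub> pre J"
    using R.ideal_class_eq_iff[OF H] J(2) by auto
  have "pre J \<subseteq> carrier K"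
    by (auto simp: pre_def)
  then have "ideal_prod K H T = x <#\<^bsub>K\<^esub> T"
    using ideal_prod_l_coset[OF x(1) _ A_closed(7)] x(3) ext_pre[OF D.InvD(1)[OF J(1)]] by simp
  then show "ideal_prod K H T \<in> Prin K T"
    using x by (auto simp: Prin_def)
qed

subsection \<open>The splitting\<close>

text \<open>The residue condition says H + M = R, that is, \<phi>(H) = D.\<close>

definition complement_ideals :: "'a set set" where
  "complement_ideals = {H \<in> carrier R.Inv. H \<subseteq> R \<and> (\<exists>e\<in>H. \<phi> e = \<one>\<^bsub>k\<^esub>)}"

lemma complement_mult:
  assumes H: "H \<in> complement_ideals" and I: "I \<in> complement_ideals"
  shows "H \<otimes>\<^bsub>R.Inv\<^esub> I \<in> complement_ideals"
proof -
  have HI: "H \<in> carrier R.Inv" "I \<in> carrier R.Inv" "H \<subseteq> R" "I \<subseteq> R"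
    using assms by (auto simp: complement_ideals_def)
  obtain e f where ef: "e \<in> H" "f \<in> I" "\<phi> e = \<one>\<^bsub>k\<^esub>" "\<phi> f = \<one>\<^bsub>k\<^esub>"
    using assms by (auto simp: complement_ideals_def)
  have fr: "ideal_prod K H I \<in> frac_ideals K R"
    using R.prod_frac R.InvD HI by blast
  have "ideal_prod K H I \<subseteq> R"
    using HI by (intro ideal_prod_least) auto
  then have "star (ideal_prod K H I) \<subseteq> R"
    using R.star_mono[OF fr R.A_frac] R.star_A by simp
  moreover have "e \<otimes> f \<in> star (ideal_prod K H I)"
    using R.star_ext[OF fr] ideal_prod.prod[OF ef(1,2), of K] by blast
  moreover have "\<phi> (e \<otimes> f) = \<one>\<^bsub>k\<^esub>"
    using ef HI R_T by (simp add: subset_iff)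
  ultimately show ?thesis
    using R.prod_Inv[OF HI(1,2)] unfolding complement_ideals_def R.Inv_simps by blast
qed

text \<open>The scalar x is replaced by y = u^-1 x with \<phi>(y f) = d a unit of \<open>D\<close>.
  Then \<phi>(y z) = d \<phi>(z) whenever z and y z are in \<open>T\<close>, so z is in
  \<open>R\<close> exactly if y z is. Since H and I are the contractions of their extensions, this
  gives H = y I.\<close>

lemma complement_inj:
  assumes H: "H \<in> complement_ideals" and I: "I \<in> complement_ideals"
    and x: "x \<in> carrier K" "x \<noteq> \<zero>" "ideal_prod K H T = x <#\<^bsub>K\<^esub> ideal_prod K I T"
  shows "\<exists>y\<in>carrier K - {\<zero>}. H = y <#\<^bsub>K\<^esub> I"
proof -
  have HI: "H \<in> carrier R.Inv" "I \<in> carrier R.Inv" "H \<subseteq> R" "I \<subseteq> R"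
    using assms by (auto simp: complement_ideals_def)
  obtain e f where ef: "e \<in> H" "f \<in> I" "\<phi> e = \<one>\<^bsub>k\<^esub>" "\<phi> f = \<one>\<^bsub>k\<^esub>"
    using assms by (auto simp: complement_ideals_def)
  note Hf = R.InvD(1)[OF HI(1)] and If = R.InvD(1)[OF HI(2)]
  note HT = ext_frac[OF Hf] and IT = ext_frac[OF If]
  have le: "ideal_prod K H T \<subseteq> T" "ideal_prod K I T \<subseteq> T"
    using ideal_prod_mono[of H T T T K] ideal_prod_mono[of I T T T K] HI(3,4) R_T TT by auto
  have efT: "e \<in> T" "f \<in> T" "e \<in> R" "f \<in> R"
    using ef HI R_T by auto
  obtain t where t: "t \<in> ideal_prod K I T" "e = x \<otimes> t"
    using subsetD[OF HT(2) ef(1)] unfolding x(3) l_coset_iff by blast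
  have "x \<otimes> f \<in> ideal_prod K H T"
    using subsetD[OF IT(2) ef(2)] unfolding x(3) l_coset_iff by blast
  then have xf: "x \<otimes> f \<in> T"
    using le by blast
  have tT: "t \<in> T"
    using t le by blast
  \<comment> \<open>Since e = x t, the product (x f) t is e f, of residue 1. Hence x f has nonzero
    residue and \<open>units_lift\<close> applies to it.\<close>
  have "(x \<otimes> f) \<otimes> t = e \<otimes> f"
    unfolding t(2) using x(1) efT(2) tT by (simp add: m_ac)
  then have "\<phi> (x \<otimes> f) \<otimes>\<^bsub>k\<^esub> \<phi> t = \<one>\<^bsub>k\<^esub>"
    using phi_mult[OF xf tT] ef efT by simp
  then have nz: "\<phi> (x \<otimes> f) \<noteq> \<zero>\<^bsub>k\<^esub>"
    using tT by (metis D.l_null D.one_not_zero phi_closed)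
  obtain u d d' where u: "u \<in> U" "d \<in> D" "d' \<in> D" "d' \<otimes>\<^bsub>k\<^esub> d = \<one>\<^bsub>k\<^esub>" "\<phi> (x \<otimes> f) = d \<otimes>\<^bsub>k\<^esub> \<phi> u"
    using units_lift[OF phi_closed[OF xf] nz] by metis
  note u' = unitD[OF u(1)]
  define y where "y = inv u \<otimes> x"
  have y: "y \<in> carrier K" "y \<noteq> \<zero>"
    using u' unitD(3,4)[OF u'(5)] x by (auto simp: y_def integral_iff)
  have yf: "y \<otimes> f \<in> T" "\<phi> (y \<otimes> f) = d"
  proof -
    have *: "y \<otimes> f = inv u \<otimes> (x \<otimes> f)"
      using u' x(1) efT by (simp add: y_def m_assoc)
    show "y \<otimes> f \<in> T"
      unfolding * using u' xf by simp
    have "\<phi> (y \<otimes> f) = inv\<^bsub>k\<^esub> \<phi> u \<otimes>\<^bsub>k\<^esub> (d \<otimes>\<^bsub>k\<^esub> \<phi> u)"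
      unfolding * using phi_mult[OF u'(2) xf] u' u(5) by simp
    also have "\<dots> = d \<otimes>\<^bsub>k\<^esub> (inv\<^bsub>k\<^esub> \<phi> u \<otimes>\<^bsub>k\<^esub> \<phi> u)"
      using D.m_lcomm[of "inv\<^bsub>k\<^esub> \<phi> u" d "\<phi> u"] u(2) u' by simp
    finally show "\<phi> (y \<otimes> f) = d"
      using D.inv_simps(4)[of "\<phi> u"] u' u(2) by simp
  qed
  have "u <#\<^bsub>K\<^esub> ideal_prod K H T = ideal_prod K H T" if "u \<in> U" for u
  proof
    note u' = unitD[OF that]
    show "u <#\<^bsub>K\<^esub> ideal_prod K H T \<subseteq> ideal_prod K H T"
      using frac_idealsD(5)[OF HT(1)] u' by (auto simp: l_coset_iff)
    show "ideal_prod K H T \<subseteq> u <#\<^bsub>K\<^esub> ideal_prod K H T"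
    proof
      fix z assume z: "z \<in> ideal_prod K H T"
      then have "z = u \<otimes> (inv u \<otimes> z)" "inv u \<otimes> z \<in> ideal_prod K H T"
        using frac_idealsD(2,5)[OF HT(1)] u' by (auto simp: inv_simps)
      then show "z \<in> u <#\<^bsub>K\<^esub> ideal_prod K H T"
        unfolding l_coset_iff by blast
    qed
  qed
  from this[OF u'(5)] have HIT: "ideal_prod K H T = y <#\<^bsub>K\<^esub> ideal_prod K I T"
    unfolding y_def using x u' frac_idealsD(1)[OF IT(1)] by (simp add: l_coset_l_coset)
  \<comment> \<open>Although y may lie outside \<open>T\<close>, multiplying by f, of residue 1,
    replaces y by y f, whose residue is d.\<close>
  have residue: "\<phi> (y \<otimes> z) = d \<otimes>\<^bsub>k\<^esub> \<phi> z" if "z \<in> T" "y \<otimes> z \<in> T" for z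
  proof -
    have "\<phi> (y \<otimes> z) = \<phi> (y \<otimes> z) \<otimes>\<^bsub>k\<^esub> \<phi> f"
      using ef(4) that(2) phi_closed[OF that(2)] by simp
    also have "\<dots> = \<phi> ((y \<otimes> z) \<otimes> f)"
      using phi_mult[OF that(2) efT(2)] by simp
    also have "(y \<otimes> z) \<otimes> f = (y \<otimes> f) \<otimes> z"
      using y(1) that(1) efT(2) by (simp add: m_ac)
    also have "\<phi> \<dots> = d \<otimes>\<^bsub>k\<^esub> \<phi> z"
      using phi_mult[OF yf(1) that(1)] yf(2) by simp
    finally show ?thesis .
  qed
  have "H = y <#\<^bsub>K\<^esub> I"
  proof
    show "H \<subseteq> y <#\<^bsub>K\<^esub> I"
    proof
      fix h assume h: "h \<in> H"
      then obtain z where z: "z \<in> ideal_prod K I T" "h = y \<otimes> z"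
        using subsetD[OF HT(2) h] unfolding HIT l_coset_iff by blast
      have zT: "z \<in> T" "h \<in> R"
        using z le h HI by auto
      have "\<phi> h = d \<otimes>\<^bsub>k\<^esub> \<phi> z"
        using residue[OF zT(1)] z(2) R_T[OF zT(2)] by simp
      then have "d' \<otimes>\<^bsub>k\<^esub> \<phi> h = \<phi> z"
        using u(2,3,4) zT(1) by (simp add: D.m_assoc[symmetric])
      then have "\<phi> z \<in> D"
        using D.A_closed(5)[OF u(3) preD(2)[OF zT(2)]] by simp
      then have "z \<in> R"
        using zT(1) by (intro preI)
      then have "z \<in> I"
        using contract_ext[OF If ef(2) efT(4) ef(4) z(1)] by blast
      then show "h \<in> y <#\<^bsub>K\<^esub> I"
        using z by (auto simp: l_coset_iff)
    qed
    show "y <#\<^bsub>K\<^esub> I \<subseteq> H"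
    proof
      fix h assume "h \<in> y <#\<^bsub>K\<^esub> I"
      then obtain z where z: "z \<in> I" "h = y \<otimes> z"
        by (auto simp: l_coset_iff)
      have hHT: "h \<in> ideal_prod K H T"
        using z IT(2) unfolding HIT l_coset_iff by blast
      have zR: "z \<in> R" "h \<in> T"
        using z HI hHT le by auto
      have "\<phi> h = d \<otimes>\<^bsub>k\<^esub> \<phi> z"
        using residue[OF R_T[OF zR(1)]] z(2) zR(2) by simp
      then have "h \<in> R"
        using u(2) preD(2)[OF zR(1)] zR(2) by (intro preI) auto
      then show "h \<in> H"
        using contract_ext[OF Hf ef(1) efT(3) ef(3) hHT] by blast
    qed
  qed
  then show ?thesis
    using y by blast
qed

text \<open>As \<open>M\<close> contains no ideal with closure \<open>R\<close>, an invertible ideal may be scaled so that it is integral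
  and not contained in \<open>M\<close>.\<close>

lemma Inv_T_normalize:
  assumes E: "E \<in> carrier T.Inv"
  obtains x where "x \<in> carrier K" "x \<noteq> \<zero>" "x <#\<^bsub>K\<^esub> E \<subseteq> T" "\<exists>e\<in>x <#\<^bsub>K\<^esub> E. \<phi> e = \<one>\<^bsub>k\<^esub>"
proof -
  let ?G = "colon K T E"
  note E' = T.InvD[OF E]
  have G: "?G \<in> frac_ideals K T"
    using colon_frac[OF E'(1)] .
  note EG = prod_frac[OF E'(1) G]
  have "\<exists>e\<in>E. \<exists>g\<in>?G. \<phi> (g \<otimes> e) \<noteq> \<zero>\<^bsub>k\<^esub>"
  proof (rule ccontr)
    assume *: "\<not> ?thesis"
    have ker: "z \<in> T \<and> \<phi> z = \<zero>\<^bsub>k\<^esub>" if "z \<in> ideal_prod K E ?G" for z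
      using that
    proof induction
      case (prod e g)
      then have "e \<otimes> g = g \<otimes> e" "g \<otimes> e \<in> T"
        using frac_idealsD(2)[OF E'(1)] by (auto simp: colon_def m_comm)
      then show ?case
        using * prod by auto
    qed auto
    \<comment> \<open>If E E^-1 is contained in M, then t E E^-1 \<subseteq> M \<subseteq> R. As 1
      lies in the closure of E E^-1, t lies in the closure of \<open>R\<close>; this would give T =
      R.\<close>
    have "t \<in> R" if t: "t \<in> T" for t
    proof -
      have "t \<otimes> z \<in> R" if "z \<in> ideal_prod K E ?G" for z
        using ker[OF that] t by (intro kernel_R) auto
      moreover have "\<one> \<in> star (ideal_prod K E ?G)"
        using E'(3) A_closed(3) by (auto simp: star_ext_def)
      ultimately have "t \<otimes> \<one> \<in> star R"
        using R.star_mult_le[OF frac_T_R[OF EG] R.A_frac] t by blast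
      then show ?thesis
        using t by (simp add: R.star_A)
    qed
    then have "carrier k \<subseteq> D"
      using phi_surj preD(2) by blast
    then show False
      using D_proper D.A_closed(7) by blast
  qed
  then obtain e g where eg: "e \<in> E" "g \<in> ?G" "\<phi> (g \<otimes> e) \<noteq> \<zero>\<^bsub>k\<^esub>"
    by blast
  have gK: "g \<in> carrier K" and gE: "\<And>z. z \<in> E \<Longrightarrow> g \<otimes> z \<in> T"
    using eg by (auto simp: colon_def)
  have "\<phi> (g \<otimes> e) \<in> carrier k"
    using gE[OF eg(1)] by simp
  note i = D.inv_simps[OF this eg(3)]
  \<comment> \<open>Multiplying e by t keeps it in E and normalizes the residue of g e to 1.\<close>
  obtain t where t: "t \<in> T" "\<phi> t = inv\<^bsub>k\<^esub> \<phi> (g \<otimes> e)"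
    using phi_surj[OF i(1)] by blast
  have eK: "e \<in> carrier K"
    using frac_idealsD(2)[OF E'(1) eg(1)] .
  show thesis
  proof (rule that)
    show "g \<in> carrier K" "g <#\<^bsub>K\<^esub> E \<subseteq> T"
      using gK gE by (auto simp: l_coset_iff)
    show "g \<noteq> \<zero>"
      using eg(3) eK by auto
    have "t \<otimes> e \<in> E"
      using frac_idealsD(5)[OF E'(1) t(1) eg(1)] .
    then have "g \<otimes> (t \<otimes> e) \<in> g <#\<^bsub>K\<^esub> E"
      by (auto simp: l_coset_iff)
    moreover have "g \<otimes> (t \<otimes> e) = t \<otimes> (g \<otimes> e)"
      using gK t(1) eK by (simp add: m_lcomm)
    moreover have "\<phi> (t \<otimes> (g \<otimes> e)) = \<one>\<^bsub>k\<^esub>"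
      using phi_mult[OF t(1) gE[OF eg(1)]] t(2) i(4) by simp
    ultimately show "\<exists>e\<in>g <#\<^bsub>K\<^esub> E. \<phi> e = \<one>\<^bsub>k\<^esub>"
      by metis
  qed
qed

text \<open>An x in E is recovered from the contraction by a denominator: s x is in E \<inter> R for
  some s in U \<inter> R.\<close>

lemma contract_frac:
  assumes E: "E \<in> frac_ideals K T" and le: "E \<subseteq> T" and e: "e \<in> E" "\<phi> e = \<one>\<^bsub>k\<^esub>"
  shows "E \<inter> R \<in> frac_ideals K R" "ideal_prod K (E \<inter> R) T = E"
proof -
  have eR: "e \<in> R"
    using e le by (intro preI) auto
  have "e \<noteq> \<zero>"
    using e(2) by auto
  then show *: "E \<inter> R \<in> frac_ideals K R"
    using frac_idealsD[OF E] R_T eR e by (intro R.frac_idealsI[of _ e \<one>]) auto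
  show "ideal_prod K (E \<inter> R) T = E"
  proof
    have "ideal_prod K (E \<inter> R) T \<subseteq> ideal_prod K E T"
      by (intro ideal_prod_mono) auto
    then show "ideal_prod K (E \<inter> R) T \<subseteq> E"
      by (simp add: ext_mult_T[OF E])
    show "E \<subseteq> ideal_prod K (E \<inter> R) T"
    proof
      fix x assume x: "x \<in> E"
      obtain s where s: "s \<in> U" "s \<in> R" "s \<otimes> x \<in> R"
        using denom_T le x by blast
      then have "s \<otimes> x \<in> E \<inter> R"
        using frac_idealsD(5)[OF E R_T[OF s(2)] x] by blast
      then show "x \<in> ideal_prod K (E \<inter> R) T"
        using inv_U_mult_ext[OF * frac_idealsD(2)[OF E x] s(1)] by blast
    qed
  qed
qed

text \<open>The inverse of H = E \<inter> R is sought as e^-1 times the contraction of e E^-1. The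
  factor e makes E^-1 integral and gives it an element of residue 1, so that
  \<open>contract_frac\<close> applies to both factors. It then remains to show that e lies in the
  closure of their product N.\<close>

lemma contract_complement:
  assumes E: "E \<in> carrier T.Inv" and le: "E \<subseteq> T" and e: "e \<in> E" "\<phi> e = \<one>\<^bsub>k\<^esub>"
  shows "E \<inter> R \<in> complement_ideals"
proof -
  note E' = T.InvD[OF E]
  note H = contract_frac[OF E'(1) le e]
  let ?H = "E \<inter> R"
  have eT: "e \<in> T" "e \<in> R" "e \<noteq> \<zero>"
    using e le by (auto intro: preI)
  let ?G = "colon K T E"
  have G: "?G \<in> frac_ideals K T"
    using colon_frac[OF E'(1)] .
  let ?eG = "e <#\<^bsub>K\<^esub> ?G"
  have eG: "?eG \<in> frac_ideals K T"
    using l_coset_frac[OF _ eT(3) G] eT by auto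
  have eG_le: "?eG \<subseteq> T"
    using e(1) eT(1) by (auto simp: l_coset_iff colon_def m_comm)
  \<comment> \<open>Since E \<subseteq> T, the inverse of E contains 1, and e E^-1 contains
    e.\<close>
  have "e \<otimes> \<one> \<in> ?eG"
    using le unfolding l_coset_iff colon_def by (intro bexI[of _ \<one>]) auto
  then have e_eG: "e \<in> ?eG"
    using eT(1) by simp
  note H2 = contract_frac[OF eG eG_le e_eG e(2)]
  let ?H2 = "?eG \<inter> R"
  let ?N = "ideal_prod K ?H ?H2"
  have N: "?N \<in> frac_ideals K R"
    by (rule R.prod_frac[OF H(1) H2(1)])
  note EK = frac_idealsD(1)[OF E'(1)] and GK = frac_idealsD(1)[OF G] and eGK = frac_idealsD(1)[OF eG]
  have "ideal_prod K ?N T = ideal_prod K E ?eG"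
    using ext_prod[OF R.frac_idealsD(1)[OF H(1)] R.frac_idealsD(1)[OF H2(1)]] H(2) H2(2) by simp
  also have "\<dots> = e <#\<^bsub>K\<^esub> ideal_prod K E ?G"
    using ideal_prod_l_coset[OF _ GK EK, of e] eT(1) ideal_prod_comm[OF EK eGK]
      ideal_prod_comm[OF EK GK] by simp
  finally have NT: "ideal_prod K ?N T = e <#\<^bsub>K\<^esub> ideal_prod K E ?G" .
  have NT_le: "ideal_prod K ?N T \<subseteq> e <#\<^bsub>K\<^esub> T"
    unfolding NT using prod_colon_le[OF E'(1)] by (force simp: l_coset_iff)
  have e2: "e \<otimes> e \<in> ?N"
    using e e_eG eT by (intro ideal_prod.prod) auto
  have phi_e2: "\<phi> (e \<otimes> e) = \<one>\<^bsub>k\<^esub>" "e \<otimes> e \<in> R"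
    using e eT by simp_all
  \<comment> \<open>Finite type applied to 1 in the closure of E E^-1 gives s e in
    \<open>star ?N\<close> for some s in U \<inter> R. Also e e lies in N. As e has residue 1,
    \<open>comaximal_mem\<close> with m = e removes both multipliers.\<close>
  have e_star: "e \<in> star ?N"
  proof -
    have fr: "ideal_prod K E ?G \<in> frac_ideals K T"
      using prod_frac[OF E'(1) G] .
    have 1: "\<one> \<in> star (ideal_prod K E ?G)"
      using E'(3) A_closed(3) by (auto simp: star_ext_def)
    obtain W where W: "finite W" "W \<subseteq> ideal_prod K E ?G" "\<And>x F. F \<in> frac_ideals K R \<Longrightarrow>
        x \<in> carrier K \<Longrightarrow> (\<And>z. z \<in> W \<Longrightarrow> x \<otimes> z \<in> F) \<Longrightarrow> x \<otimes> \<one> \<in> star F"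
      using R.finite_type_witness[OF finite_type_R frac_T_R[OF fr] 1] by metis
    have WK: "W \<subseteq> carrier K"
      using W(2) frac_idealsD(1)[OF fr] by blast
    have *: "e \<otimes> z \<in> ideal_prod K ?N T" if "z \<in> W" for z
      unfolding NT l_coset_iff using W(2) that by blast
    then have eW: "\<forall>z\<in>(\<lambda>z. e \<otimes> z) ` W. \<exists>s\<in>U \<inter> R. s \<otimes> z \<in> ?N"
      using denom_ext[OF N] by blast
    have "(\<lambda>z. e \<otimes> z) ` W \<subseteq> carrier K"
      using WK eT(1) by auto
    then obtain s where s: "s \<in> U" "s \<in> R" "\<forall>z\<in>(\<lambda>z. e \<otimes> z) ` W. s \<otimes> z \<in> ?N"
      using common_denom[OF finite_imageI[OF W(1)] N, of "\<lambda>z. e \<otimes> z"] eW by blast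
    have "(s \<otimes> e) \<otimes> z \<in> ?N" if "z \<in> W" for z
      using s that WK eT(1) by (auto simp: m_assoc subset_iff)
    then have "(s \<otimes> e) \<otimes> \<one> \<in> star ?N"
      using W(3)[OF N, of "s \<otimes> e"] s eT by blast
    then have "s \<otimes> e \<in> star ?N"
      using s eT by simp
    moreover have "e \<otimes> e \<in> star ?N"
      using e2 R.star_ext[OF N] by blast
    ultimately show ?thesis
      using comaximal_mem[OF R.star_frac[OF N] _ eT(2) e(2) _ s(1,2)] eT by auto
  qed
  have ie: "inv e \<in> carrier K" "inv e \<noteq> \<zero>"
    using inv_simps[of e] eT by auto
  have "?H \<in> carrier R.Inv"
  proof (rule R.InvI[OF H(1), of "inv e <#\<^bsub>K\<^esub> ?H2"])
    have "star ?H \<subseteq> star R"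
      by (rule R.star_mono[OF H(1) R.A_frac]) auto
    \<comment> \<open>The closure of H lies in the closure of its extension E, which is closed; with
      \<open>star R = R\<close> this gives E \<inter> R.\<close>
    moreover have "star ?H \<subseteq> E"
      using star_le_starT_ext[OF H(1)] H(2) E'(2) by simp
    ultimately show "star ?H = ?H"
      using R.star_A R.star_ext[OF H(1)] by auto
    show "inv e <#\<^bsub>K\<^esub> ?H2 \<in> frac_ideals K R"
      by (rule R.l_coset_frac[OF ie H2(1)])
    have H2K: "?H2 \<subseteq> carrier K" "?H \<subseteq> carrier K"
      using EK eGK by auto
    have eq: "ideal_prod K ?H (inv e <#\<^bsub>K\<^esub> ?H2) = inv e <#\<^bsub>K\<^esub> ?N"
      using ideal_prod_l_coset[OF ie(1) H2K] ideal_prod_comm[of ?H] H2K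
        R.frac_idealsD(1)[OF R.l_coset_frac[OF ie H2(1)]] by simp
    show "ideal_prod K ?H (inv e <#\<^bsub>K\<^esub> ?H2) \<subseteq> R"
      unfolding eq
    proof
      fix z assume "z \<in> inv e <#\<^bsub>K\<^esub> ?N"
      then obtain n where n: "n \<in> ?N" "z = inv e \<otimes> n"
        by (auto simp: l_coset_iff)
      \<comment> \<open>Division by e is harmless: n = e t with t in \<open>T\<close>, and \<phi>(t)
        = \<phi>(n) lies in \<open>D\<close> because \<phi>(e) = 1.\<close>
      have "n \<in> e <#\<^bsub>K\<^esub> T"
        using n NT_le ext_frac(2)[OF N] by blast
      then obtain t where t: "t \<in> T" "n = e \<otimes> t"
        by (auto simp: l_coset_iff)
      have zt: "z = t"
        using n(2) t eT inv_simps[of e] by simp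
      have "?N \<subseteq> R"
        by (intro ideal_prod_least) auto
      then have "\<phi> n \<in> D"
        using n(1) preD(2) by blast
      moreover have "\<phi> n = \<phi> t"
        using t eT e(2) by simp
      ultimately show "z \<in> R"
        unfolding zt using t(1) by (intro preI) auto
    qed
    have "inv e \<otimes> e \<in> inv e <#\<^bsub>K\<^esub> star ?N"
      using e_star by (auto simp: l_coset_iff)
    then show "\<one> \<in> star (ideal_prod K ?H (inv e <#\<^bsub>K\<^esub> ?H2))"
      unfolding eq R.star_l_coset[OF ie N] using eT inv_simps[of e] by simp
  qed
  then show ?thesis
    using e eT by (auto simp: complement_ideals_def)
qed

lemma complement_surj:
  assumes E: "E \<in> carrier T.Inv"
  shows "\<exists>H\<in>complement_ideals. \<exists>x\<in>carrier K - {\<zero>}. ideal_prod K H T = x <#\<^bsub>K\<^esub> E"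
proof -
  obtain x where x: "x \<in> carrier K" "x \<noteq> \<zero>" "x <#\<^bsub>K\<^esub> E \<subseteq> T" "\<exists>e\<in>x <#\<^bsub>K\<^esub> E. \<phi> e = \<one>\<^bsub>k\<^esub>"
    using Inv_T_normalize[OF E] by blast
  then obtain e where e: "e \<in> x <#\<^bsub>K\<^esub> E" "\<phi> e = \<one>\<^bsub>k\<^esub>"
    by blast
  have xE: "x <#\<^bsub>K\<^esub> E \<in> carrier T.Inv"
    by (rule T.l_coset_Inv(1)[OF x(1,2) E])
  show ?thesis
    using contract_complement[OF xE x(3) e] contract_frac(2)[OF T.InvD(1)[OF xE] x(3) e] x by blast
qed

end

section \<open>The sequence of class groups\<close>

context pullback_star
begin

lemma pre_Prin: "pre ` Prin k D \<subseteq> Prin K R"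
  using pre_Prin_iff subgroup.subset[OF D.Prin_subgroup] by blast

lemma ext_Prin: "(\<lambda>H. ideal_prod K H T) ` Prin K R \<subseteq> Prin K T"
proof (clarsimp simp: Prin_def)
  fix x assume "x \<in> carrier K" "x \<noteq> \<zero>"
  then show "\<exists>y. ideal_prod K (x <#\<^bsub>K\<^esub> R) T = y <#\<^bsub>K\<^esub> T \<and> y \<in> carrier K \<and> y \<noteq> \<zero>"
    using ideal_prod_l_coset[OF _ R.A_closed(7) A_closed(7)] R.prod_A[OF R_frac_T] by auto
qed

lemma pre_class:
  assumes "J \<in> carrier D.Inv"
  shows "the_elem ((\<lambda>J. ideal_class K R star (pre J)) ` ideal_class k D proj J) = ideal_class K R star (pre J)"
  using the_elem_induced[OF _ _ D.Prin_subgroup R.Prin_subgroup pre_hom pre_Prin assms]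
    D.comm_group_Inv R.comm_group_Inv by (simp add: ideal_class_def comm_group_def)

lemma ext_class:
  assumes "H \<in> carrier R.Inv"
  shows "the_elem ((\<lambda>H. ideal_class K T starT (ideal_prod K H T)) ` ideal_class K R star H)
    = ideal_class K T starT (ideal_prod K H T)"
  using the_elem_induced[OF _ _ R.Prin_subgroup T.Prin_subgroup ext_hom ext_Prin assms]
    R.comm_group_Inv T.comm_group_Inv by (simp add: ideal_class_def comm_group_def)

lemma class_groups_split_exact:
  "split_exact_sequence (Cl_group k D proj) (Cl_group K R star) (Cl_group K T starT)
    (\<lambda>S. the_elem ((\<lambda>J. ideal_class K R star (pre J)) ` S))
    (\<lambda>S. the_elem ((\<lambda>H. ideal_class K T starT (ideal_prod K H T)) ` S))"
  unfolding Cl_group_def ideal_class_def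
\<comment> \<open>Case 9 is injectivity on classes, 10 exactness in the middle, and 12 to 14 concern
  the complement: products, surjectivity, injectivity. The rest are group, subgroup and homomorphism
  facts and the inclusion of the complement.\<close>
proof (rule split_exact_sequence_quotients[where P = complement_ideals], goal_cases)
  case (9 J)
  then show ?case
    by (rule pre_Prin_iff)
next
  case (10 H)
  then show ?case
    using ext_Prin_iff by (simp add: ideal_class_def)
next
  case (12 H I)
  then show ?case
    by (rule complement_mult)
next
  case (13 E)
  then obtain H x where H: "H \<in> complement_ideals" "x \<in> carrier K - {\<zero>}" "ideal_prod K H T = x <#\<^bsub>K\<^esub> E"
    using complement_surj by blast
  have "ideal_prod K H T \<in> carrier T.Inv"
    using H(1) by (intro ext_Inv) (simp add: complement_ideals_def)
  then have "ideal_class K T starT (ideal_prod K H T) = ideal_class K T starT E"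
    using T.ideal_class_eq_iff 13 H(2,3) by blast
  then show ?case
    using H(1) by (auto simp: ideal_class_def)
next
  case (14 H I)
  then have HI: "H \<in> carrier R.Inv" "I \<in> carrier R.Inv"
    by (auto simp: complement_ideals_def)
  have "ideal_class K T starT (ideal_prod K H T) = ideal_class K T starT (ideal_prod K I T)"
    using 14(3) by (simp add: ideal_class_def)
  then obtain x where "x \<in> carrier K" "x \<noteq> \<zero>" "ideal_prod K H T = x <#\<^bsub>K\<^esub> ideal_prod K I T"
    using T.ideal_class_eq_iff[OF ext_Inv[OF HI(1)] ext_Inv[OF HI(2)]] by auto
  then have "\<exists>y\<in>carrier K - {\<zero>}. H = y <#\<^bsub>K\<^esub> I"
    using complement_inj 14 by blast
  then show ?case
    using R.ideal_class_eq_iff[OF HI] by (simp add: ideal_class_def)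
qed (auto simp: complement_ideals_def intro:
    D.comm_group_Inv R.comm_group_Inv T.comm_group_Inv
    D.Prin_subgroup R.Prin_subgroup T.Prin_subgroup pre_hom ext_hom)

end

section \<open>From the stated hypotheses to the pullback locale\<close>

lemma quotient_field_of_locale:
  assumes "quotient_field_of K A"
  shows "domain_in_field K A"
proof -
  have "field K" "subring A K"
    using assms unfolding quotient_field_of_def subdomain_def subcring_def by auto
  moreover have "\<exists>a\<in>A. \<exists>b\<in>A - {\<zero>\<^bsub>K\<^esub>}. x = a \<otimes>\<^bsub>K\<^esub> inv\<^bsub>K\<^esub> b" if "x \<in> carrier K" for x
    using assms that unfolding quotient_field_of_def by blast
  ultimately show ?thesis
    by (simp add: domain_in_field_def domain_in_field_axioms_def)
qed

lemma pullback_residue: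
  fixes K :: "('a, 'm) ring_scheme"
  assumes T: "quotient_field_of K T"
    and M: "maximalideal M (K\<lparr>carrier := T\<rparr>)" "M \<noteq> {\<zero>\<^bsub>K\<^esub>}"
    and k: "k = residue_field K T M"
    and D: "D \<noteq> carrier k" "quotient_field_of k D"
    and surj: "(\<lambda>u. Units (k\<lparr>carrier := D\<rparr>) #>\<^bsub>units_of k\<^esub> residue_map K T M u) ` Units (K\<lparr>carrier := T\<rparr>)
                 = carrier (units_of k Mod Units (k\<lparr>carrier := D\<rparr>))"
  shows "pullback K T k D (residue_map K T M)"
proof -
  let ?T = "K\<lparr>carrier := T\<rparr>"
  let ?\<phi> = "residue_map K T M"
  interpret T: domain_in_field K T
    by (rule quotient_field_of_locale[OF T])
  interpret D: domain_in_field k D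
    by (rule quotient_field_of_locale[OF D(2)])
  interpret M: maximalideal M ?T
    by (rule M)
  have k': "k = ?T Quot M"
    by (simp add: k residue_field_def)
  have phi: "?\<phi> = (+>\<^bsub>?T\<^esub>) M"
    by (rule ext) (simp add: residue_map_def)
  have hom: "?\<phi> \<in> ring_hom ?T k"
    unfolding phi k' by (rule M.rcos_ring_hom)
  show ?thesis
  proof (intro pullback.intro pullback_axioms.intro T.domain_in_field_axioms D.domain_in_field_axioms)
    show "D \<noteq> carrier k"
      by fact
    fix x y assume "x \<in> T" "y \<in> T"
    then show "?\<phi> (x \<oplus>\<^bsub>K\<^esub> y) = ?\<phi> x \<oplus>\<^bsub>k\<^esub> ?\<phi> y" "?\<phi> (x \<otimes>\<^bsub>K\<^esub> y) = ?\<phi> x \<otimes>\<^bsub>k\<^esub> ?\<phi> y"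
      using ring_hom_add[OF hom] ring_hom_mult[OF hom] by simp_all
  next
    fix x assume "x \<in> T"
    then show "?\<phi> x \<in> carrier k"
      using ring_hom_closed[OF hom] by simp
  next
    show "?\<phi> \<one>\<^bsub>K\<^esub> = \<one>\<^bsub>k\<^esub>"
      using ring_hom_one[OF hom] by simp
  next
    fix z assume "z \<in> carrier k"
    then show "\<exists>x\<in>T. ?\<phi> x = z"
      unfolding k' phi by (auto simp: FactRing_def A_RCOSETS_def')
  next
    obtain m where "m \<in> M" "m \<noteq> \<zero>\<^bsub>K\<^esub>"
      using M(2) additive_subgroup.zero_closed[OF M.additive_subgroup_axioms] by auto
    moreover have "?\<phi> m = \<zero>\<^bsub>k\<^esub>"
      unfolding phi k' using M.a_rcos_const[OF \<open>m \<in> M\<close>] by (simp add: FactRing_def)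
    ultimately show "\<exists>m\<in>T. m \<noteq> \<zero>\<^bsub>K\<^esub> \<and> ?\<phi> m = \<zero>\<^bsub>k\<^esub>"
      using M.Icarr by auto
  next
    fix z assume z: "z \<in> carrier k" "z \<noteq> \<zero>\<^bsub>k\<^esub>"
    let ?N = "Units (k\<lparr>carrier := D\<rparr>)"
    \<comment> \<open>As \<open>k\<close> is a field, a nonzero z is a unit of \<open>k\<close> and
      has a coset modulo the units of \<open>D\<close>. Surjectivity provides a unit u of
      \<open>T\<close> whose residue has the same coset, and membership of z in that coset yields
      the factor d.\<close>
    have "z \<in> carrier (units_of k)"
      using z by (simp add: units_of_carrier D.field_Units)
    then have "?N #>\<^bsub>units_of k\<^esub> z \<in> carrier (units_of k Mod ?N)"
      by (auto simp: carrier_FactGroup)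
    then obtain u where u: "u \<in> Units ?T" "?N #>\<^bsub>units_of k\<^esub> z = ?N #>\<^bsub>units_of k\<^esub> ?\<phi> u"
      unfolding surj[symmetric] by blast
    have "\<one>\<^bsub>k\<^esub> \<in> ?N"
      by (auto simp: Units_def)
    then have "\<one>\<^bsub>k\<^esub> \<otimes>\<^bsub>k\<^esub> z \<in> ?N #>\<^bsub>units_of k\<^esub> z"
      by (auto simp: r_coset_def units_of_mult)
    then have "z \<in> ?N #>\<^bsub>units_of k\<^esub> ?\<phi> u"
      using z u(2) by simp
    then obtain d where d: "d \<in> ?N" "z = d \<otimes>\<^bsub>k\<^esub> ?\<phi> u"
      by (auto simp: r_coset_def units_of_mult)
    then show "\<exists>u\<in>T. \<exists>v\<in>T. \<exists>d\<in>D. \<exists>d'\<in>D. u \<otimes>\<^bsub>K\<^esub> v = \<one>\<^bsub>K\<^esub> \<and> d \<otimes>\<^bsub>k\<^esub> d' = \<one>\<^bsub>k\<^esub> \<and>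
        z = d \<otimes>\<^bsub>k\<^esub> ?\<phi> u"
      using u(1) unfolding Units_def by fastforce
  qed
qed

theorem theorem2p17:
  fixes K :: "('a, 'm) ring_scheme"
    and T M R :: "'a set" and D :: "'a set set"
    and k :: "'a set ring" and \<phi> :: "'a \<Rightarrow> 'a set"
    and star :: "'a set \<Rightarrow> 'a set"
    and starphi :: "'a set set \<Rightarrow> 'a set set" and starT :: "'a set \<Rightarrow> 'a set"
  assumes T: "quotient_field_of K T"
    and M: "maximalideal M (K\<lparr>carrier := T\<rparr>)" "M \<noteq> {\<zero>\<^bsub>K\<^esub>}"
    and k: "k = residue_field K T M"
    and phi: "\<phi> = residue_map K T M"
    and D: "subring D k" "D \<noteq> carrier k" "quotient_field_of k D"
    and R: "R = residue_preimage K T M D"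
    and surj: "(\<lambda>u. Units (k\<lparr>carrier := D\<rparr>) #>\<^bsub>units_of k\<^esub> \<phi> u) ` Units (K\<lparr>carrier := T\<rparr>)
                 = carrier (units_of k Mod Units (k\<lparr>carrier := D\<rparr>))"
    and star: "star_operation K R star" "finite_type K R star"
    and starphi: "starphi = star_proj K T M D star"
    and starT: "starT = star_ext K T star"
  shows "(\<forall>J\<in>carrier (Inv_group k D starphi).
            residue_preimage K T M J \<in> carrier (Inv_group K R star) \<and>
            alpha_bar K T M D star (ideal_class k D starphi J)
              = ideal_class K R star (residue_preimage K T M J)) \<and>
         (\<forall>H\<in>carrier (Inv_group K R star).
            ideal_prod K H T \<in> carrier (Inv_group K T starT) \<and>
            beta_bar K T star (ideal_class K R star H)
              = ideal_class K T starT (ideal_prod K H T)) \<and>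
         split_exact_sequence (Cl_group k D starphi) (Cl_group K R star) (Cl_group K T starT)
           (alpha_bar K T M D star) (beta_bar K T star)"
proof -
  interpret P: pullback K T k D "residue_map K T M"
    by (rule pullback_residue[OF T M k D(2,3) surj[unfolded phi]])
  have pre: "P.pre = residue_preimage K T M"
    by (rule ext) (simp add: P.pre_def residue_preimage_def)
  interpret P: pullback_star K T k D "residue_map K T M" star
    by unfold_locales (use star in \<open>simp_all add: R pre\<close>)
  have proj: "P.proj = starphi"
    by (rule ext) (simp add: P.proj_def starphi star_proj_def pre k[symmetric])
  have alpha: "alpha_bar K T M D star = (\<lambda>S. the_elem ((\<lambda>J. ideal_class K R star (residue_preimage K T M J)) ` S))"
    by (rule ext) (simp add: alpha_bar_def R)
  have beta: "beta_bar K T star = (\<lambda>S. the_elem ((\<lambda>H. ideal_class K T starT (ideal_prod K H T)) ` S))"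
    by (rule ext) (simp add: beta_bar_def starT)
  note rew = pre proj R[symmetric] starT[symmetric]
  show ?thesis
    unfolding alpha beta
    using P.pre_hom[unfolded rew] P.pre_class[unfolded rew] P.ext_Inv[unfolded rew]
      P.ext_class[unfolded rew] P.class_groups_split_exact[unfolded rew]
    by (auto simp: hom_def)
qed

end
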